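(* The group $\tilde G_4^3$, which is a subgroup of index four in $G_4^3$, is isomorphic to the $4$-strand pure braid group of $\mathbb{R}P^2$ with two points fixed, i.e. to the fundamental group of the space of ordered $4$-tuples $(x_1,x_2,x_3,x_4)$ of pairwise distinct points of $\mathbb{R}P^2$ with $x_1=(1:0:0)$ and $x_2=(0:1:0)$.
   Context: The group $G_4^3$ is generated by elements $a_m$, one for each $3$-element subset $m\subset\{1,2,3,4\}$, with relations $a_m^2=1$ for every $m$, and $(a_{m^1}a_{m^2}a_{m^3}a_{m^4})^2=1$ for every ordering $m^1,m^2,m^3,m^4$ of the four $3$-element subsets. Let $X$ be the space of ordered $4$-tuples $(x_1,x_2,x_3,x_4)$ of pairwise distinct points of $\mathbb{R}P^2$ with $x_1=(1:0:0)$, $x_2=(0:1:0)$. A point of $X$ is singular if some three of the points $x_1,\dots,x_4$ are collinear. For a smooth path $\gamma$ in $X$ with parameter $t\in[0,1]$, $t$ is a singular value if $\gamma(t)$ is singular. A singular value $t$ at which exactly one triple $m$ of the points is collinear is said to be of type $m$. It is stable if for every sufficiently small perturbation of $\gamma$ there is exactly one parameter value near $t$ at which the three points indexed by $m$ are collinear. A path with nonsingular endpoints is good and stable if it has finitely many singular values, each of them has a type (only one triple is collinear), and each is stable. The word of such a path is $a_{m_1}\cdots a_{m_l}$, where $m_1,\dots,m_l$ are the types of its successive singular values. Let $z=((1:0:0),(0:1:0),(0:0:1),(1:1:1))\in X$. Then $\tilde G_4^3$ is the subgroup of $G_4^3$ consisting of the elements represented by words $a_{m_1}\cdots a_{m_l}$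 that are the word of some good and stable path in $X$ which both starts and ends at $z$. *)

theory Defs
  imports "HOL-Analysis.Analysis" "HOL-Algebra.Coset"
begin

section \<open>Groups given by generators and relators\<close>

text \<open>The letter \<open>(g, True)\<close> stands for \<open>g\<close> and \<open>(g, False)\<close> for its formal inverse.\<close>

type_synonym 'g word = "('g \<times> bool) list"

definition words :: "'g set \<Rightarrow> 'g word set" where
  "words S = lists (S \<times> UNIV)"

inductive_set pres_rel :: "'g set \<Rightarrow> 'g word set \<Rightarrow> ('g word \<times> 'g word) set"
  for S :: "'g set" and R :: "'g word set" where
  refl: "w \<in> words S \<Longrightarrow> (w, w) \<in> pres_rel S R"
| sym: "(v, w) \<in> pres_rel S R \<Longrightarrow> (w, v) \<in> pres_rel S R"
| trans: "(u, v) \<in> pres_rel S R \<Longrightarrow> (v, w) \<in> pres_rel S R \<Longrightarrow> (u, w) \<in> pres_rel S R"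
| cancel: "u \<in> words S \<Longrightarrow> v \<in> words S \<Longrightarrow> g \<in> S \<Longrightarrow>
    (u @ [(g, b), (g, \<not> b)] @ v, u @ v) \<in> pres_rel S R"
| relator: "u \<in> words S \<Longrightarrow> v \<in> words S \<Longrightarrow> r \<in> R \<Longrightarrow>
    (u @ r @ v, u @ v) \<in> pres_rel S R"

definition presented_group :: "'g set \<Rightarrow> 'g word set \<Rightarrow> 'g word set monoid" where
  "presented_group S R =
     \<lparr>carrier = words S // pres_rel S R,
      mult = (\<lambda>A B. \<Union>u\<in>A. \<Union>v\<in>B. pres_rel S R `` {u @ v}),
      one = pres_rel S R `` {[]}\<rparr>"

lemma words_append [simp]: "u @ v \<in> words S \<longleftrightarrow> u \<in> words S \<and> v \<in> words S"
  by (auto simp: words_def)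

lemma words_Nil [simp]: "[] \<in> words S"
  by (auto simp: words_def)

lemma words_Cons [simp]: "(g, b) # w \<in> words S \<longleftrightarrow> g \<in> S \<and> w \<in> words S"
  by (auto simp: words_def)

lemma pres_rel_words:
  assumes "R \<subseteq> words S" "(v, w) \<in> pres_rel S R"
  shows "v \<in> words S \<and> w \<in> words S"
  using assms(2) by induction (use assms(1) in auto)

lemma equiv_pres_rel:
  assumes "R \<subseteq> words S"
  shows "equiv (words S) (pres_rel S R)"
proof (rule equivI)
  show "pres_rel S R \<subseteq> words S \<times> words S"
    using pres_rel_words[OF assms] by auto
  show "refl_on (words S) (pres_rel S R)"
    by (rule refl_onI) (rule pres_rel.refl)
  show "sym (pres_rel S R)"
    by (rule symI) (rule pres_rel.sym)
  show "trans (pres_rel S R)"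
    by (rule transI) (rule pres_rel.trans)
qed

lemma pres_rel_append_left:
  assumes "R \<subseteq> words S" "(v, w) \<in> pres_rel S R" "u \<in> words S"
  shows "(u @ v, u @ w) \<in> pres_rel S R"
  using assms(2)
proof induction
  case (refl w)
  then show ?case using assms(3) by (intro pres_rel.refl) simp
next
  case (sym v w)
  then show ?case by (meson pres_rel.sym)
next
  case (trans u v w)
  then show ?case by (meson pres_rel.trans)
next
  case (cancel a c g b)
  then show ?case using pres_rel.cancel[of "u @ a" S c g b R] assms(3) by simp
next
  case (relator a c r)
  then show ?case using pres_rel.relator[of "u @ a" S c r R] assms(3) by simp
qed

lemma pres_rel_append_right:
  assumes "R \<subseteq> words S" "(v, w) \<in> pres_rel S R" "u \<in> words S"
  shows "(v @ u, w @ u) \<in> pres_rel S R"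
  using assms(2)
proof induction
  case (refl w)
  then show ?case using assms(3) by (intro pres_rel.refl) simp
next
  case (sym v w)
  then show ?case by (meson pres_rel.sym)
next
  case (trans u v w)
  then show ?case by (meson pres_rel.trans)
next
  case (cancel a c g b)
  then show ?case using pres_rel.cancel[of a S "c @ u" g b R] assms(3) by simp
next
  case (relator a c r)
  then show ?case using pres_rel.relator[of a S "c @ u" r R] assms(3) by simp
qed

lemma presented_group_mult:
  assumes "R \<subseteq> words S" "u \<in> words S" "v \<in> words S"
  shows "mult (presented_group S R) (pres_rel S R `` {u}) (pres_rel S R `` {v})
       = pres_rel S R `` {u @ v}"
proof -
  have "congruent2 (pres_rel S R) (pres_rel S R) (\<lambda>u v. pres_rel S R `` {u @ v})"
  proof (rule congruent2I[OF equiv_pres_rel[OF assms(1)] equiv_pres_rel[OF assms(1)]])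
    fix a b c assume "(a, b) \<in> pres_rel S R" "c \<in> words S"
    then show "pres_rel S R `` {a @ c} = pres_rel S R `` {b @ c}"
      by (intro equiv_class_eq[OF equiv_pres_rel[OF assms(1)]] pres_rel_append_right assms(1))
  next
    fix a b c assume "(a, b) \<in> pres_rel S R" "c \<in> words S"
    then show "pres_rel S R `` {c @ a} = pres_rel S R `` {c @ b}"
      by (intro equiv_class_eq[OF equiv_pres_rel[OF assms(1)]] pres_rel_append_left assms(1))
  qed
  from UN_equiv_class2[OF equiv_pres_rel[OF assms(1)] equiv_pres_rel[OF assms(1)] this assms(2,3)]
  show ?thesis by (simp add: presented_group_def)
qed

definition word_inv :: "'g word \<Rightarrow> 'g word" where
  "word_inv w = rev (map (\<lambda>(g, b). (g, \<not> b)) w)"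

lemma word_inv_words: "w \<in> words S \<Longrightarrow> word_inv w \<in> words S"
  by (auto simp: word_inv_def words_def)

lemma word_inv_left:
  assumes "R \<subseteq> words S" "w \<in> words S"
  shows "(word_inv w @ w, []) \<in> pres_rel S R"
  using assms(2)
proof (induction w)
  case Nil
  then show ?case by (simp add: word_inv_def pres_rel.refl)
next
  case (Cons x w)
  obtain g b where x: "x = (g, b)" by (cases x)
  have "(word_inv w @ [(g, \<not> b), (g, \<not> \<not> b)] @ w, word_inv w @ w) \<in> pres_rel S R"
    using Cons.prems by (intro pres_rel.cancel word_inv_words) (auto simp: x)
  moreover have "word_inv (x # w) @ x # w = word_inv w @ [(g, \<not> b), (g, \<not> \<not> b)] @ w"
    by (simp add: word_inv_def x)
  ultimately show ?case using Cons x pres_rel.trans by fastforce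
qed

lemma group_presented_group:
  assumes "R \<subseteq> words S"
  shows "group (presented_group S R)"
proof (rule groupI)
  let ?G = "presented_group S R"
  have carr: "carrier ?G = words S // pres_rel S R"
    and one: "one ?G = pres_rel S R `` {[]}"
    by (simp_all add: presented_group_def)
  note mult = presented_group_mult[OF assms]
  show "one ?G \<in> carrier ?G" by (auto simp: carr one intro: quotientI)
  show "x \<otimes>\<^bsub>?G\<^esub> y \<in> carrier ?G" if "x \<in> carrier ?G" "y \<in> carrier ?G" for x y
    using that by (auto simp: carr mult elim!: quotientE intro!: quotientI)
  show "x \<otimes>\<^bsub>?G\<^esub> y \<otimes>\<^bsub>?G\<^esub> z = x \<otimes>\<^bsub>?G\<^esub> (y \<otimes>\<^bsub>?G\<^esub> z)"
    if "x \<in> carrier ?G" "y \<in> carrier ?G" "z \<in> carrier ?G" for x y z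
    using that by (auto simp: carr mult elim!: quotientE)
  show "\<one>\<^bsub>?G\<^esub> \<otimes>\<^bsub>?G\<^esub> x = x" if "x \<in> carrier ?G" for x
    using that by (auto simp: carr one mult elim!: quotientE)
  show "\<exists>y\<in>carrier ?G. y \<otimes>\<^bsub>?G\<^esub> x = \<one>\<^bsub>?G\<^esub>" if x: "x \<in> carrier ?G" for x
  proof -
    obtain w where w: "x = pres_rel S R `` {w}" "w \<in> words S"
      using x by (auto simp: carr elim: quotientE)
    show ?thesis
      using w word_inv_words[OF w(2)] equiv_class_eq[OF equiv_pres_rel[OF assms]
          word_inv_left[OF assms w(2)]]
      by (intro bexI[of _ "pres_rel S R `` {word_inv w}"]) (auto simp: carr one mult intro: quotientI)
  qed
qed


section \<open>The group \<open>G\<^sub>4\<^sup>3\<close>\<close>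

text \<open>
  The index set \<open>{1, 2, 3, 4}\<close> is the four-element numeral type \<open>4\<close> (in which \<open>4 = 0\<close>).
\<close>

definition triples :: "4 set set" where
  "triples = {m. card m = 3}"

definition positive_word :: "'g list \<Rightarrow> 'g word" where
  "positive_word ms = map (\<lambda>m. (m, True)) ms"

definition G43_relators :: "4 set word set" where
  "G43_relators =
     {positive_word [m, m] | m. m \<in> triples} \<union>
     {positive_word (ms @ ms) | ms. distinct ms \<and> set ms = triples}"

definition G43 :: "4 set word set monoid" where
  "G43 = presented_group triples G43_relators"

definition G43_element :: "4 set list \<Rightarrow> 4 set word set" where
  "G43_element ms = pres_rel triples G43_relators `` {positive_word ms}"

lemma group_G43: "group G43"
  unfolding G43_def
proof (rule group_presented_group)
  have "positive_word ms \<in> words triples" if "set ms \<subseteq> triples" for ms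
    using that by (auto simp: positive_word_def words_def)
  then show "G43_relators \<subseteq> words triples"
    unfolding G43_relators_def by fastforce
qed


section \<open>The fundamental group\<close>

definition loops_at :: "'a::topological_space set \<Rightarrow> 'a \<Rightarrow> (real \<Rightarrow> 'a) set" where
  "loops_at S b = {p. path p \<and> path_image p \<subseteq> S \<and> pathstart p = b \<and> pathfinish p = b}"

definition homotopy_rel ::
    "'a::topological_space set \<Rightarrow> 'a \<Rightarrow> ((real \<Rightarrow> 'a) \<times> (real \<Rightarrow> 'a)) set" where
  "homotopy_rel S b = {(p, q). p \<in> loops_at S b \<and> q \<in> loops_at S b \<and> homotopic_paths S p q}"

definition fundamental_group ::
    "'a::topological_space set \<Rightarrow> 'a \<Rightarrow> (real \<Rightarrow> 'a) set monoid" where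
  "fundamental_group S b =
     \<lparr>carrier = loops_at S b // homotopy_rel S b,
      mult = (\<lambda>A B. \<Union>p\<in>A. \<Union>q\<in>B. homotopy_rel S b `` {p +++ q}),
      one = homotopy_rel S b `` {\<lambda>_. b}\<rparr>"

lemma equiv_homotopy_rel: "equiv (loops_at S b) (homotopy_rel S b)"
proof (rule equivI)
  show "homotopy_rel S b \<subseteq> loops_at S b \<times> loops_at S b"
    by (auto simp: homotopy_rel_def)
  show "refl_on (loops_at S b) (homotopy_rel S b)"
    by (rule refl_onI) (simp add: homotopy_rel_def, simp add: loops_at_def)
  show "sym (homotopy_rel S b)"
    by (rule symI) (auto simp: homotopy_rel_def homotopic_paths_sym_eq)
  show "trans (homotopy_rel S b)"
    by (rule transI) (unfold homotopy_rel_def, blast intro: homotopic_paths_trans)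
qed

lemma loops_at_join:
  "p \<in> loops_at S b \<Longrightarrow> q \<in> loops_at S b \<Longrightarrow> p +++ q \<in> loops_at S b"
  by (auto simp: loops_at_def path_image_join)

lemma fundamental_group_mult:
  assumes "p \<in> loops_at S b" "q \<in> loops_at S b"
  shows "mult (fundamental_group S b) (homotopy_rel S b `` {p}) (homotopy_rel S b `` {q})
       = homotopy_rel S b `` {p +++ q}"
proof -
  have "congruent2 (homotopy_rel S b) (homotopy_rel S b) (\<lambda>p q. homotopy_rel S b `` {p +++ q})"
  proof (rule congruent2I')
    fix p p' q q' assume *: "(p, p') \<in> homotopy_rel S b" "(q, q') \<in> homotopy_rel S b"
    then have "homotopic_paths S (p +++ q) (p' +++ q')"
      by (intro homotopic_paths_join) (auto simp: homotopy_rel_def loops_at_def)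
    with * show "homotopy_rel S b `` {p +++ q} = homotopy_rel S b `` {p' +++ q'}"
      by (intro equiv_class_eq[OF equiv_homotopy_rel]) (simp add: homotopy_rel_def loops_at_join)
  qed
  from UN_equiv_class2[OF equiv_homotopy_rel equiv_homotopy_rel this assms]
  show ?thesis by (simp add: fundamental_group_def)
qed

text \<open>
  The library states the following two facts in terms of \<^const>\<open>linepath\<close>,
  hence only for normed vector spaces.
\<close>

lemma homotopic_paths_const_left:
  fixes p :: "real \<Rightarrow> 'a::topological_space"
  assumes "path p" "path_image p \<subseteq> S"
  shows "homotopic_paths S ((\<lambda>_. pathstart p) +++ p) p"
proof (rule homotopic_paths_sym, rule homotopic_paths_reparametrize[OF assms])
  let ?f = "\<lambda>t::real. max 0 (2 * t - 1)"
  show "continuous_on {0..1} ?f" by (intro continuous_intros)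
  show "?f \<in> {0..1} \<rightarrow> {0..1}" by auto
  show "?f 0 = 0" "?f 1 = 1" by auto
  show "((\<lambda>_. pathstart p) +++ p) t = p (?f t)" if "t \<in> {0..1}" for t
  proof (cases "t \<le> 1/2")
    case True
    then have "?f t = 0" by simp
    with True show ?thesis by (simp add: joinpaths_def pathstart_def)
  next
    case False
    then have "?f t = 2 * t - 1" by simp
    with False show ?thesis by (simp add: joinpaths_def)
  qed
qed

lemma homotopic_paths_reversepath_const:
  fixes p :: "real \<Rightarrow> 'a::topological_space"
  assumes "path p" "path_image p \<subseteq> S"
  shows "homotopic_paths S (reversepath p +++ p) (\<lambda>_. pathfinish p)"
proof -
  let ?f = "\<lambda>x::real \<times> real. 1 - (1 - fst x) * min (2 * snd x) (2 - 2 * snd x)"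
  have f: "?f x \<in> {0..1}" if "x \<in> {0..1} \<times> {0..1}" for x
  proof -
    have "0 \<le> 1 - fst x" "1 - fst x \<le> 1"
      "0 \<le> min (2 * snd x) (2 - 2 * snd x)" "min (2 * snd x) (2 - 2 * snd x) \<le> 1"
      using that by (auto simp: mem_Times_iff)
    then show ?thesis by (auto intro: mult_le_one)
  qed
  have "continuous_on ({0..1} \<times> {0..1}) (\<lambda>x. p (?f x))"
  proof (rule continuous_on_compose2[of "{0..1}" p])
    show "continuous_on {0..1} p" using assms(1) by (simp add: path_def)
    show "continuous_on ({0..1} \<times> {0..1}) ?f" by (intro continuous_intros)
    show "?f ` ({0..1} \<times> {0..1}) \<subseteq> {0..1}" using f by blast
  qed
  moreover have "(\<lambda>x. p (?f x)) \<in> {0..1} \<times> {0..1} \<rightarrow> S"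
    using f assms(2) unfolding path_image_def by blast
  moreover have "p (?f (0, t)) = (reversepath p +++ p) t" for t
    by (auto simp: joinpaths_def reversepath_def min_def)
  ultimately show ?thesis
    unfolding homotopic_paths
    by (intro exI[of _ "\<lambda>x. p (?f x)"])
      (simp add: pathstart_def pathfinish_def joinpaths_def reversepath_def)
qed

lemma group_fundamental_group:
  assumes "b \<in> S"
  shows "group (fundamental_group S b)"
proof (rule groupI)
  let ?G = "fundamental_group S b" and ?r = "homotopy_rel S b"
  have carr: "carrier ?G = loops_at S b // ?r" and one: "one ?G = ?r `` {\<lambda>_. b}"
    by (simp_all add: fundamental_group_def)
  note mult = fundamental_group_mult
  have carrD: "\<exists>p. p \<in> loops_at S b \<and> x = ?r `` {p}" if "x \<in> carrier ?G" for x
    using that unfolding carr by (auto elim: quotientE)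
  have const: "(\<lambda>_. b) \<in> loops_at S b"
    using assms by (auto simp: loops_at_def path_def path_image_def pathstart_def pathfinish_def)
  have eqI: "?r `` {p} = ?r `` {q}"
    if "p \<in> loops_at S b" "q \<in> loops_at S b" "homotopic_paths S p q" for p q
    using that by (intro equiv_class_eq[OF equiv_homotopy_rel]) (auto simp: homotopy_rel_def)
  show "one ?G \<in> carrier ?G" using const by (simp add: carr one quotientI)
  show "x \<otimes>\<^bsub>?G\<^esub> y \<in> carrier ?G" if xyz: "x \<in> carrier ?G" "y \<in> carrier ?G" for x y
  proof -
    obtain p q where "p \<in> loops_at S b" "x = ?r `` {p}" "q \<in> loops_at S b" "y = ?r `` {q}"
      using carrD[OF xyz(1)] carrD[OF xyz(2)] by (elim exE conjE) (rule that)
    then show ?thesis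
      by (simp add: carr mult quotientI loops_at_join)
  qed
  show "x \<otimes>\<^bsub>?G\<^esub> y \<otimes>\<^bsub>?G\<^esub> z = x \<otimes>\<^bsub>?G\<^esub> (y \<otimes>\<^bsub>?G\<^esub> z)"
    if xyz: "x \<in> carrier ?G" "y \<in> carrier ?G" "z \<in> carrier ?G" for x y z
  proof -
    obtain p q r where *: "p \<in> loops_at S b" "x = ?r `` {p}"
      "q \<in> loops_at S b" "y = ?r `` {q}" "r \<in> loops_at S b" "z = ?r `` {r}"
      using carrD[OF xyz(1)] carrD[OF xyz(2)] carrD[OF xyz(3)] by (elim exE conjE) (rule that)
    have "homotopic_paths S (p +++ q +++ r) ((p +++ q) +++ r)"
      using * by (intro homotopic_paths_assoc) (auto simp: loops_at_def)
    then have "?r `` {p +++ q +++ r} = ?r `` {(p +++ q) +++ r}"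
      using * by (intro eqI loops_at_join)
    with * show ?thesis
      by (simp add: mult loops_at_join)
  qed
  show "\<one>\<^bsub>?G\<^esub> \<otimes>\<^bsub>?G\<^esub> x = x" if x: "x \<in> carrier ?G" for x
  proof -
    obtain p where p: "p \<in> loops_at S b" "x = ?r `` {p}"
      using carrD[OF x] by (elim exE conjE) (rule that)
    have "homotopic_paths S ((\<lambda>_. b) +++ p) p"
      using homotopic_paths_const_left[of p S] p by (simp add: loops_at_def)
    then have "?r `` {(\<lambda>_. b) +++ p} = ?r `` {p}"
      using p const by (intro eqI loops_at_join)
    with p const show ?thesis
      by (simp add: one mult)
  qed
  show "\<exists>y\<in>carrier ?G. y \<otimes>\<^bsub>?G\<^esub> x = \<one>\<^bsub>?G\<^esub>" if x: "x \<in> carrier ?G" for x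
  proof -
    obtain p where p: "p \<in> loops_at S b" "x = ?r `` {p}"
      using carrD[OF x] by (elim exE conjE) (rule that)
    have r: "reversepath p \<in> loops_at S b" using p by (auto simp: loops_at_def)
    have "homotopic_paths S (reversepath p +++ p) (\<lambda>_. b)"
      using homotopic_paths_reversepath_const[of p S] p by (simp add: loops_at_def)
    then have "?r `` {reversepath p +++ p} = ?r `` {\<lambda>_. b}"
      using p r const by (intro eqI loops_at_join)
    with p r have "?r `` {reversepath p} \<otimes>\<^bsub>?G\<^esub> x = \<one>\<^bsub>?G\<^esub>"
      by (simp add: one mult)
    moreover have "?r `` {reversepath p} \<in> carrier ?G"
      using r by (simp add: carr quotientI)
    ultimately show ?thesis by blast
  qed
qed


section \<open>The real projective plane\<close>

definition proportional :: "real^3 \<Rightarrow> real^3 \<Rightarrow> bool" where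
  "proportional u v \<longleftrightarrow> u \<noteq> 0 \<and> v \<noteq> 0 \<and> (\<exists>c. u = c *\<^sub>R v)"

lemma part_equivp_proportional: "part_equivp proportional"
proof (rule part_equivpI)
  show "\<exists>x. proportional x x"
    by (rule exI[of _ "axis 1 1"]) (auto simp: proportional_def axis_eq_0_iff intro: exI[of _ 1])
  show "symp proportional"
  proof (rule sympI)
    fix u v assume "proportional u v"
    then obtain c where "u = c *\<^sub>R v" "u \<noteq> 0" "v \<noteq> 0" by (auto simp: proportional_def)
    moreover from this have "v = inverse c *\<^sub>R u" by auto
    ultimately show "proportional v u" unfolding proportional_def by blast
  qed
  show "transp proportional"
    by (rule transpI) (auto simp: proportional_def)
qed

text \<open>\<open>rp2_point (vector [a, b, c])\<close> is the point \<open>(a : b : c)\<close>, provided \<open>(a, b, c)\<close> is nonzero.\<close>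

quotient_type rp2 = "real^3" / partial: proportional
  morphisms rp2_rep rp2_point
  by (rule part_equivp_proportional)

lemma rp2_point_eq_iff:
  assumes "u \<noteq> 0" "v \<noteq> 0"
  shows "rp2_point u = rp2_point v \<longleftrightarrow> (\<exists>c. u = c *\<^sub>R v)"
proof -
  have "proportional u u" "proportional v v"
    using assms by (auto simp: proportional_def intro: exI[of _ 1])
  then have "rp2_point u = rp2_point v \<longleftrightarrow> proportional u v"
    using Quotient_rel[OF Quotient_rp2] by blast
  then show ?thesis using assms by (simp add: proportional_def)
qed

lemma rp2_point_exhaust:
  obtains v where "v \<noteq> 0" "p = rp2_point v"
proof (rule that)
  show "rp2_rep p \<noteq> 0"
    using Quotient_rep_reflp[OF Quotient_rp2, of p] by (simp add: proportional_def)
  show "p = rp2_point (rp2_rep p)"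
    by (simp add: Quotient_abs_rep[OF Quotient_rp2])
qed

text \<open>The quotient topology of the nonzero vectors, which are open in \<open>\<real>\<^sup>3\<close>.\<close>

instantiation rp2 :: topological_space
begin

definition open_rp2 :: "rp2 set \<Rightarrow> bool" where
  "open_rp2 U \<longleftrightarrow> open {v. v \<noteq> 0 \<and> rp2_point v \<in> U}"

instance
proof
  show "open (UNIV :: rp2 set)"
    using open_Compl[OF closed_singleton[of "0 :: real^3"]]
    by (simp add: open_rp2_def Compl_eq)
next
  fix S T :: "rp2 set" assume "open S" "open T"
  then have "open ({v. v \<noteq> 0 \<and> rp2_point v \<in> S} \<inter> {v. v \<noteq> 0 \<and> rp2_point v \<in> T})"
    unfolding open_rp2_def by (rule open_Int)
  then show "open (S \<inter> T)" unfolding open_rp2_def by (rule back_subst) auto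
next
  fix K :: "rp2 set set" assume "\<forall>S\<in>K. open S"
  then have "open (\<Union>S\<in>K. {v. v \<noteq> 0 \<and> rp2_point v \<in> S})"
    unfolding open_rp2_def by blast
  then show "open (\<Union>K)" unfolding open_rp2_def by (rule back_subst) auto
qed

end

definition rp2_line :: "real^3 \<Rightarrow> rp2 set" where
  "rp2_line n = {rp2_point v | v. v \<noteq> 0 \<and> n \<bullet> v = 0}"

definition rp2_collinear :: "rp2 set \<Rightarrow> bool" where
  "rp2_collinear P \<longleftrightarrow> (\<exists>n. n \<noteq> 0 \<and> P \<subseteq> rp2_line n)"


section \<open>The configuration space\<close>

definition config_space :: "(rp2^4) set" where
  "config_space =
     {x. inj (\<lambda>i. x $ i) \<and>
         x $ 1 = rp2_point (vector [1, 0, 0]) \<and>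
         x $ 2 = rp2_point (vector [0, 1, 0])}"

definition base_config :: "rp2^4" where
  "base_config =
     (\<chi> i. if i = 1 then rp2_point (vector [1, 0, 0])
          else if i = 2 then rp2_point (vector [0, 1, 0])
          else if i = 3 then rp2_point (vector [0, 0, 1])
          else rp2_point (vector [1, 1, 1]))"

definition collinear_triples :: "rp2^4 \<Rightarrow> 4 set set" where
  "collinear_triples x = {m \<in> triples. rp2_collinear ((\<lambda>i. x $ i) ` m)}"

definition singular :: "rp2^4 \<Rightarrow> bool" where
  "singular x \<longleftrightarrow> collinear_triples x \<noteq> {}"


section \<open>Smooth paths and their singular values\<close>

text \<open>
  \<open>D n\<close> is the \<open>n\<close>-th derivative; it is one-sided at the ends when \<open>S\<close> is a closed interval.
\<close>

definition smooth_on :: "real set \<Rightarrow> (real \<Rightarrow> 'a::real_normed_vector) \<Rightarrow> bool" where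
  "smooth_on S f \<longleftrightarrow>
     (\<exists>D. (\<forall>t\<in>S. D (0::nat) t = f t) \<and>
          (\<forall>n. \<forall>t\<in>S. (D n has_vector_derivative D (Suc n) t) (at t within S)))"

text \<open>
  A path of configurations is smooth if it is given by smooth homogeneous coordinates:
  the projection \<open>\<real>\<^sup>3 - {0} \<rightarrow> \<real>P\<^sup>2\<close> is a surjective submersion, and a smooth path
  defined on an interval lifts along it globally.
\<close>

definition smooth_coords :: "(real \<Rightarrow> real^3^4) \<Rightarrow> (real \<Rightarrow> rp2^4) \<Rightarrow> bool" where
  "smooth_coords V \<gamma> \<longleftrightarrow>
     smooth_on {0..1} V \<and>
     (\<forall>t\<in>{0..1}. \<forall>i. V t $ i \<noteq> 0 \<and> \<gamma> t $ i = rp2_point (V t $ i))"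

definition smooth_path :: "(real \<Rightarrow> rp2^4) \<Rightarrow> bool" where
  "smooth_path \<gamma> \<longleftrightarrow> (\<exists>V. smooth_coords V \<gamma>) \<and> \<gamma> ` {0..1} \<subseteq> config_space"

definition singular_values :: "(real \<Rightarrow> rp2^4) \<Rightarrow> real set" where
  "singular_values \<gamma> = {t \<in> {0..1}. singular (\<gamma> t)}"

definition has_type :: "(real \<Rightarrow> rp2^4) \<Rightarrow> real \<Rightarrow> 4 set \<Rightarrow> bool" where
  "has_type \<gamma> t m \<longleftrightarrow> collinear_triples (\<gamma> t) = {m}"

definition C1_close :: "real \<Rightarrow> (real \<Rightarrow> 'a::real_normed_vector) \<Rightarrow> (real \<Rightarrow> 'a) \<Rightarrow> bool" where
  "C1_close \<epsilon> f g \<longleftrightarrow>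
     (\<forall>t\<in>{0..1}. norm (g t - f t) < \<epsilon> \<and>
        norm (vector_derivative g (at t within {0..1}) -
              vector_derivative f (at t within {0..1})) < \<epsilon>)"

text \<open>
  Small perturbations of a smooth path are smooth paths of configurations that are close to it
  in the \<open>C\<^sup>1\<close> sense; with respect to mere uniform closeness no singular value would be stable.
  The condition has to hold for all sufficiently small neighbourhoods of \<open>t\<close>.
  The choice of the homogeneous coordinates \<open>V\<close> is immaterial, since multiplication by a
  nowhere vanishing smooth function is a homeomorphism for the \<open>C\<^sup>1\<close> topology.
\<close>

definition stable :: "(real \<Rightarrow> rp2^4) \<Rightarrow> real \<Rightarrow> 4 set \<Rightarrow> bool" where
  "stable \<gamma> t m \<longleftrightarrow>
     (\<exists>V. smooth_coords V \<gamma> \<and>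
       (\<forall>\<^sub>F \<delta> in at_right 0. \<exists>\<epsilon>>0. \<forall>\<gamma>' V'.
          smooth_path \<gamma>' \<and> smooth_coords V' \<gamma>' \<and> C1_close \<epsilon> V V' \<longrightarrow>
          (\<exists>!t'. t' \<in> {0..1} \<and> \<bar>t' - t\<bar> < \<delta> \<and> m \<in> collinear_triples (\<gamma>' t'))))"

definition good_stable :: "(real \<Rightarrow> rp2^4) \<Rightarrow> bool" where
  "good_stable \<gamma> \<longleftrightarrow>
     smooth_path \<gamma> \<and> \<not> singular (\<gamma> 0) \<and> \<not> singular (\<gamma> 1) \<and>
     finite (singular_values \<gamma>) \<and>
     (\<forall>t\<in>singular_values \<gamma>. \<exists>m. has_type \<gamma> t m \<and> stable \<gamma> t m)"

definition path_word :: "(real \<Rightarrow> rp2^4) \<Rightarrow> 4 set list" where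
  "path_word \<gamma> = map (\<lambda>t. THE m. has_type \<gamma> t m) (sorted_list_of_set (singular_values \<gamma>))"

definition G43_tilde :: "4 set word set set" where
  "G43_tilde =
     {G43_element (path_word \<gamma>) | \<gamma>. good_stable \<gamma> \<and> \<gamma> 0 = base_config \<and> \<gamma> 1 = base_config}"

lemma base_config_in_config_space: "base_config \<in> config_space"
proof -
  have nz: "(vector [1, 0, 0] :: real^3) \<noteq> 0" "(vector [0, 1, 0] :: real^3) \<noteq> 0"
    "(vector [0, 0, 1] :: real^3) \<noteq> 0" "(vector [1, 1, 1] :: real^3) \<noteq> 0"
    by (auto simp: vec_eq_iff forall_3)
  have "inj (\<lambda>i. base_config $ i)"
    unfolding inj_def
    using nz by (auto simp: base_config_def forall_4 rp2_point_eq_iff vec_eq_iff forall_3)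
  moreover have "base_config $ 1 = rp2_point (vector [1, 0, 0])"
    "base_config $ 2 = rp2_point (vector [0, 1, 0])"
    by (simp_all add: base_config_def)
  ultimately show ?thesis
    unfolding config_space_def by blast
qed

end

theory Submission
  imports Defs
begin

text \<open>
  The configurations with three collinear points form four walls in \<open>X\<close>, one for each triple. Their
  complement consists of four contractible chambers, and every wall separates two pairs of chambers.
  So \<open>G\<^sub>4\<^sup>3\<close> acts on the chambers, through the Klein four-group, and the stabilizer of the
  chamber of \<open>z\<close> has index four.

  Different walls meet only where all four points are collinear, in codimension two, and a small loop
  around such a configuration crosses the walls in the order of a relator
  \<open>(a\<^bsub>1\<^esub>a\<^bsub>2\<^esub>a\<^bsub>3\<^esub>a\<^bsub>4\<^esub>)\<^sup>2\<close>. Hence sending a word to the class of a path that crosses the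
  corresponding walls is well defined on \<open>G\<^sub>4\<^sup>3\<close>, and it maps the stabilizer onto the fundamental
  group. For the injectivity, \<open>X\<close> carries a flat bundle with fibre \<open>G\<^sub>4\<^sup>3\<close> whose parallel transport
  multiplies by the letters of the walls that are crossed, so a null-homotopic loop has a trivial word.

  Finally the stabilizer is \<open>G43_tilde\<close>: at a stable singular value the determinant of the three
  points changes sign, so that a good and stable loop passes to the adjacent chamber; and every word in
  the stabilizer is the word of a polynomial loop, whose determinants have prescribed simple zeros.
\<close>

section \<open>The projective plane\<close>

text \<open>The obstacle is that the determinants are not functions on \<open>X\<close>: homogeneous
  coordinates are given only up to factors, and \<open>rp2_rep\<close> chooses them discontinuously.
  So all regions are cut out by predicates of two vectors that are invariant under rescaling, and
  products of determinants that rescale by squares replace the determinants themselves.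
  Contractibility is obtained from explicit charts onto convex sets, for the chambers, for the stars
  of the walls, and for neighbourhoods of the collinear quadruples. The latter have two slopes and
  two heights as coordinates. In the plane of heights the walls are four lines through the origin,
  which a circle meets twice each: hence a square of four letters, in one of three cyclic orders up
  to reversal. The relators enter twice, once as trivial products of path classes and once as the
  condition under which the local frames of the bundle fit together around such a quadruple. The
  polynomial loop comes from solving for the coordinates of the two moving points with the four
  determinants given; that it can start and end at \<open>z\<close> without extra zeros is exactly
  the condition that the word fixes the chamber.\<close>

lemma rp2_rep_nonzero [simp]: "rp2_rep p \<noteq> 0"
  using Quotient_rep_reflp[OF Quotient_rp2, of p] by (simp add: proportional_def)

lemma rp2_point_rep [simp]: "rp2_point (rp2_rep p) = p"
  by (simp add: Quotient_abs_rep[OF Quotient_rp2])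

lemma rp2_point_scaleR:
  assumes "c \<noteq> 0" "v \<noteq> 0"
  shows "rp2_point (c *\<^sub>R v) = rp2_point v"
  using assms by (subst rp2_point_eq_iff) auto

lemma rp2_rep_point:
  assumes "v \<noteq> 0"
  obtains c where "c \<noteq> 0" "rp2_rep (rp2_point v) = c *\<^sub>R v"
proof -
  have "rp2_point (rp2_rep (rp2_point v)) = rp2_point v" by simp
  then obtain c where c: "rp2_rep (rp2_point v) = c *\<^sub>R v"
    using assms by (subst (asm) rp2_point_eq_iff) auto
  then have "c \<noteq> 0" using rp2_rep_nonzero[of "rp2_point v"] by auto
  with c that show thesis by blast
qed

text \<open>The saturation of \<open>A - {0}\<close> is the union of its nonzero multiples, each of
  which is open.\<close>

lemma open_rp2_point_image:
  assumes "open A"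
  shows "open (rp2_point ` (A - {0}))"
proof -
  have "{v. v \<noteq> 0 \<and> rp2_point v \<in> rp2_point ` (A - {0})} = (\<Union>c\<in>-{0}. (\<lambda>v. c *\<^sub>R v) ` (A - {0}))"
  proof (intro Set.set_eqI iffI)
    fix v assume "v \<in> {v. v \<noteq> 0 \<and> rp2_point v \<in> rp2_point ` (A - {0})}"
    then obtain u where "v \<noteq> 0" "u \<in> A" "u \<noteq> 0" "rp2_point v = rp2_point u" by auto
    then obtain c where "v = c *\<^sub>R u" by (auto simp: rp2_point_eq_iff)
    with \<open>v \<noteq> 0\<close> \<open>u \<in> A\<close> \<open>u \<noteq> 0\<close> show "v \<in> (\<Union>c\<in>-{0}. (\<lambda>v. c *\<^sub>R v) ` (A - {0}))"
      by (auto intro!: bexI[of _ c])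
  qed (use rp2_point_scaleR in auto)
  also have "open \<dots>"
    using assms by (intro open_UN ballI open_scaling) (auto simp: open_delete)
  finally show ?thesis by (simp add: open_rp2_def)
qed

lemma continuous_on_rp2_point: "continuous_on (- {0}) rp2_point"
proof -
  have "open (- {0 :: real^3})" by (simp add: open_Compl)
  then show ?thesis
    by (subst continuous_on_open_vimage)
      (auto simp: open_rp2_def vimage_def Int_def conj_commute)
qed

section \<open>Properties of homogeneous coordinates that descend to configurations\<close>

definition scale_inv :: "(real^3 \<Rightarrow> real^3 \<Rightarrow> 'b) \<Rightarrow> bool" where
  "scale_inv F \<longleftrightarrow> (\<forall>c d v w. c \<noteq> 0 \<longrightarrow> d \<noteq> 0 \<longrightarrow> F (c *\<^sub>R v) (d *\<^sub>R w) = F v w)"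

text \<open>Since \<open>rp2_rep\<close> is not continuous, a neighbourhood cannot be pulled back
  along it. Openness of the projection yields a neighbourhood of \<open>x\<close> whose points have
  some representatives in the given open set, and \<open>scale_inv\<close> carries \<open>R\<close>
  over to the chosen representatives.\<close>

lemma eventually_rp2_lift:
  fixes R :: "real^3 \<Rightarrow> real^3 \<Rightarrow> bool" and x :: "rp2^4"
  assumes inv: "scale_inv R"
    and ev: "eventually (\<lambda>u. R (fst u) (snd u)) (nhds (rp2_rep (x $ 3), rp2_rep (x $ 4)))"
  shows "eventually (\<lambda>x. R (rp2_rep (x $ 3)) (rp2_rep (x $ 4))) (nhds x)"
proof -
  obtain S where S: "open S" "(rp2_rep (x $ 3), rp2_rep (x $ 4)) \<in> S" "\<And>u. u \<in> S \<Longrightarrow> R (fst u) (snd u)"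
    using ev unfolding eventually_nhds by blast
  then obtain A B where AB: "open A" "open B" "rp2_rep (x $ 3) \<in> A" "rp2_rep (x $ 4) \<in> B" "A \<times> B \<subseteq> S"
    by (metis open_prod_elim mem_Sigma_iff)
  define N where "N = {y :: rp2^4. y $ 3 \<in> rp2_point ` (A - {0}) \<and> y $ 4 \<in> rp2_point ` (B - {0})}"
  have "N = (\<lambda>y. y $ 3) -` (rp2_point ` (A - {0})) \<inter> (\<lambda>y. y $ 4) -` (rp2_point ` (B - {0}))"
    by (auto simp: N_def)
  then have "open N"
    using open_rp2_point_image[OF AB(1)] open_rp2_point_image[OF AB(2)]
    by (auto intro!: open_Int open_vimage_vec_nth)
  moreover have "x \<in> N"
    unfolding N_def using AB(3,4) by (auto intro!: image_eqI[of _ rp2_point "rp2_rep _"])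
  moreover have "R (rp2_rep (y $ 3)) (rp2_rep (y $ 4))" if y: "y \<in> N" for y
  proof -
    obtain a b where ab: "a \<in> A" "a \<noteq> 0" "y $ 3 = rp2_point a" "b \<in> B" "b \<noteq> 0" "y $ 4 = rp2_point b"
      using y unfolding N_def by blast
    obtain c where c: "c \<noteq> 0" "rp2_rep (y $ 3) = c *\<^sub>R a" using rp2_rep_point[OF ab(2)] ab(3) by metis
    obtain d where d: "d \<noteq> 0" "rp2_rep (y $ 4) = d *\<^sub>R b" using rp2_rep_point[OF ab(5)] ab(6) by metis
    have "(a, b) \<in> S" using ab AB(5) by auto
    from S(3)[OF this] show ?thesis using c d inv by (simp add: scale_inv_def)
  qed
  ultimately show "eventually (\<lambda>x. R (rp2_rep (x $ 3)) (rp2_rep (x $ 4))) (nhds x)"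
    unfolding eventually_nhds by blast
qed

lemma tendsto_rp2_lift:
  fixes F :: "real^3 \<Rightarrow> real^3 \<Rightarrow> 'b::topological_space" and x :: "rp2^4"
  assumes inv: "scale_inv F"
    and cont: "((\<lambda>u. F (fst u) (snd u)) \<longlongrightarrow> F (rp2_rep (x $ 3)) (rp2_rep (x $ 4)))
      (nhds (rp2_rep (x $ 3), rp2_rep (x $ 4)))"
  shows "((\<lambda>x. F (rp2_rep (x $ 3)) (rp2_rep (x $ 4))) \<longlongrightarrow> F (rp2_rep (x $ 3)) (rp2_rep (x $ 4))) (nhds x)"
proof (rule topological_tendstoI)
  fix T assume T: "open T" "F (rp2_rep (x $ 3)) (rp2_rep (x $ 4)) \<in> T"
  show "eventually (\<lambda>x. F (rp2_rep (x $ 3)) (rp2_rep (x $ 4)) \<in> T) (nhds x)"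
    by (rule eventually_rp2_lift[where R = "\<lambda>v w. F v w \<in> T"])
      (use inv topological_tendstoD[OF cont T] in \<open>simp_all add: scale_inv_def\<close>)
qed

definition conf :: "real^3 \<Rightarrow> real^3 \<Rightarrow> rp2^4" where
  "conf v w = (\<chi> i. if i = 1 then rp2_point (vector [1, 0, 0])
          else if i = 2 then rp2_point (vector [0, 1, 0])
          else if i = 3 then rp2_point v else rp2_point w)"

lemma conf_nth [simp]:
  "conf v w $ 1 = rp2_point (vector [1, 0, 0])" "conf v w $ 2 = rp2_point (vector [0, 1, 0])"
  "conf v w $ 3 = rp2_point v" "conf v w $ 4 = rp2_point w"
  by (simp_all add: conf_def)

lemma continuous_on_conf:
  assumes "continuous_on A f" "continuous_on A g" "\<And>t. t \<in> A \<Longrightarrow> f t \<noteq> 0" "\<And>t. t \<in> A \<Longrightarrow> g t \<noteq> 0"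
  shows "continuous_on A (\<lambda>t. conf (f t) (g t))"
proof -
  have f: "continuous_on A (\<lambda>t. rp2_point (f t))"
    using assms by (intro continuous_on_compose2[OF continuous_on_rp2_point]) auto
  have g: "continuous_on A (\<lambda>t. rp2_point (g t))"
    using assms by (intro continuous_on_compose2[OF continuous_on_rp2_point]) auto
  have "continuous_on A (\<lambda>t. conf (f t) (g t) $ i)" for i
  proof -
    have "\<forall>i. continuous_on A (\<lambda>t. conf (f t) (g t) $ i)" using f g by (simp add: forall_4)
    then show ?thesis by blast
  qed
  then show ?thesis
    unfolding continuous_on_def by (auto intro: vec_tendstoI)
qed

text \<open>Comparing all paths with common ends, instead of contracting loops at a base point, lets
  the empty set qualify. This matters because two of the eight sign vectors that index the cells are
  inconsistent.\<close>

definition simple_conn :: "'a::topological_space set \<Rightarrow> bool" where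
  "simple_conn U \<longleftrightarrow> path_connected U \<and>
     (\<forall>p q. path p \<and> path q \<and> path_image p \<subseteq> U \<and> path_image q \<subseteq> U \<and>
        pathstart p = pathstart q \<and> pathfinish p = pathfinish q \<longrightarrow> homotopic_paths U p q)"

text \<open>Paths in the image are pulled back by \<open>\<kappa>\<close>, joined by the
  straight-line homotopy inside the convex set, and pushed forward again by
  \<open>\<psi>\<close>.\<close>

lemma simple_conn_chart:
  fixes C :: "'c::real_normed_vector set" and \<psi> :: "'c \<Rightarrow> 'a::topological_space"
  assumes C: "convex C" and \<psi>: "continuous_on C \<psi>" and \<kappa>: "continuous_on (\<psi> ` C) \<kappa>"
    and inv: "\<And>c. c \<in> C \<Longrightarrow> \<kappa> (\<psi> c) = c"
  shows "simple_conn (\<psi> ` C)"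
  unfolding simple_conn_def
proof (intro conjI allI impI)
  show "path_connected (\<psi> ` C)"
    using path_connected_continuous_image[OF \<psi> convex_imp_path_connected[OF C]] .
  fix p q assume pq: "path p \<and> path q \<and> path_image p \<subseteq> \<psi> ` C \<and> path_image q \<subseteq> \<psi> ` C \<and>
        pathstart p = pathstart q \<and> pathfinish p = pathfinish q"
  have im: "\<kappa> y \<in> C" "\<psi> (\<kappa> y) = y" if "y \<in> \<psi> ` C" for y using that inv by auto
  have pth: "path (\<kappa> \<circ> p)" "path (\<kappa> \<circ> q)"
    using pq \<kappa> by (auto intro!: path_continuous_image intro: continuous_on_subset)
  have "homotopic_paths C (\<kappa> \<circ> p) (\<kappa> \<circ> q)"
  proof (rule homotopic_paths_linear[OF pth])
    show "pathstart (\<kappa> \<circ> q) = pathstart (\<kappa> \<circ> p)" "pathfinish (\<kappa> \<circ> q) = pathfinish (\<kappa> \<circ> p)"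
      using pq by (auto simp: pathstart_compose pathfinish_compose)
    fix t :: real assume "t \<in> {0..1}"
    then have "p t \<in> \<psi> ` C" "q t \<in> \<psi> ` C" using pq by (auto simp: path_image_def)
    then show "closed_segment ((\<kappa> \<circ> p) t) ((\<kappa> \<circ> q) t) \<subseteq> C"
      using im C by (auto intro!: closed_segment_subset simp: convex_contains_segment)
  qed
  then have *: "homotopic_paths (\<psi> ` C) (\<psi> \<circ> (\<kappa> \<circ> p)) (\<psi> \<circ> (\<kappa> \<circ> q))"
    by (rule homotopic_paths_continuous_image[OF _ \<psi>]) auto
  have e: "homotopic_paths (\<psi> ` C) r (\<psi> \<circ> (\<kappa> \<circ> r))" if "path r" "path_image r \<subseteq> \<psi> ` C" for r
    using that im(2) by (intro homotopic_paths_eq) (force simp: path_image_def)+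
  show "homotopic_paths (\<psi> ` C) p q"
    using e[of p] e[of q] * pq by (meson homotopic_paths_sym homotopic_paths_trans)
qed

lemma simple_connD:
  assumes "simple_conn U" "path p" "path q" "path_image p \<subseteq> U" "path_image q \<subseteq> U"
    "pathstart p = pathstart q" "pathfinish p = pathfinish q"
  shows "homotopic_paths U p q"
  using assms unfolding simple_conn_def by blast

lemma simple_conn_path:
  assumes "simple_conn U" "x \<in> U" "y \<in> U"
  obtains p where "path p" "path_image p \<subseteq> U" "pathstart p = x" "pathfinish p = y"
  using assms unfolding simple_conn_def path_connected_def by metis

section \<open>Homotopy classes of paths\<close>

lemma homotopic_paths_const_right:
  fixes p :: "real \<Rightarrow> 'a::topological_space"
  assumes "path p" "path_image p \<subseteq> S"
  shows "homotopic_paths S (p +++ (\<lambda>_. pathfinish p)) p"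
proof -
  have "homotopic_paths S ((\<lambda>_. pathstart (reversepath p)) +++ reversepath p) (reversepath p)"
    using assms by (intro homotopic_paths_const_left) auto
  then have "homotopic_paths S (reversepath ((\<lambda>_. pathstart (reversepath p)) +++ reversepath p)) p"
    using homotopic_paths_reversepath_D by fastforce
  then show ?thesis
    by (subst (asm) reversepath_joinpaths) (auto simp: reversepath_def pathstart_def pathfinish_def)
qed

definition path_in :: "'a::topological_space set \<Rightarrow> 'a \<Rightarrow> 'a \<Rightarrow> (real \<Rightarrow> 'a) \<Rightarrow> bool" where
  "path_in U x y p \<longleftrightarrow> path p \<and> path_image p \<subseteq> U \<and> pathstart p = x \<and> pathfinish p = y"

lemma path_in_join : "path_in U x y p \<Longrightarrow> path_in U y z q \<Longrightarrow> path_in U x z (p +++ q)"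
  by (auto simp: path_in_def path_image_join)

lemma path_in_reverse : "path_in U x y p \<Longrightarrow> path_in U y x (reversepath p)"
  by (auto simp: path_in_def)

lemma path_in_const : "x \<in> U \<Longrightarrow> path_in U x x (\<lambda>_. x)"
  by (auto simp: path_in_def path_def path_image_def pathstart_def pathfinish_def)

lemma path_in_mono: "path_in U x y p \<Longrightarrow> U \<subseteq> V \<Longrightarrow> path_in V x y p"
  by (auto simp: path_in_def)

lemma path_in_start: "path_in U x y p \<Longrightarrow> x \<in> U"
  unfolding path_in_def using pathstart_in_path_image by blast

lemma path_in_finish: "path_in U x y p \<Longrightarrow> y \<in> U"
  unfolding path_in_def using pathfinish_in_path_image by blast

lemma path_in_homotopic:
  "homotopic_paths U p q \<Longrightarrow> path_in U x y p \<Longrightarrow> path_in U x y q"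
  unfolding path_in_def
  using homotopic_paths_imp_path homotopic_paths_imp_subset homotopic_paths_imp_pathstart
    homotopic_paths_imp_pathfinish by metis

lemma simple_conn_homotopic:
  "simple_conn U \<Longrightarrow> path_in U x y p \<Longrightarrow> path_in U x y q \<Longrightarrow> homotopic_paths U p q"
  by (rule simple_connD) (simp_all add: path_in_def)

lemma simple_conn_path_in:
  assumes "simple_conn U" "x \<in> U" "y \<in> U"
  obtains p where "path_in U x y p"
proof -
  obtain p where "path p" "path_image p \<subseteq> U" "pathstart p = x" "pathfinish p = y"
    by (rule simple_conn_path[OF assms])
  then show thesis by (intro that) (simp add: path_in_def)
qed

lemma hom_assoc:
  assumes "path_in X x y p" "path_in X y z q" "path_in X z w r"
  shows "homotopic_paths X ((p +++ q) +++ r) (p +++ (q +++ r))"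
  using assms by (intro homotopic_paths_sym[OF homotopic_paths_assoc]) (auto simp: path_in_def)

lemma hom_cong:
  assumes "homotopic_paths X p p'" "homotopic_paths X q q'" "path_in X x y p" "path_in X y z q"
  shows "homotopic_paths X (p +++ q) (p' +++ q')"
  using assms by (intro homotopic_paths_join) (auto simp: path_in_def)

lemma hom_refl: "path_in X x y p \<Longrightarrow> homotopic_paths X p p"
  by (auto simp: path_in_def)

lemma hom_cancel:
  assumes d: "path_in X x y d" and q: "path_in X y z q"
  shows "homotopic_paths X (reversepath d +++ (d +++ q)) q"
proof -
  have r: "path_in X y x (reversepath d)" using d by (rule path_in_reverse)
  have "homotopic_paths X (reversepath d +++ (d +++ q)) ((reversepath d +++ d) +++ q)"
    using hom_assoc[OF r d q] by (rule homotopic_paths_sym)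
  also have "homotopic_paths X \<dots> ((\<lambda>_. pathstart q) +++ q)"
  proof (rule hom_cong[OF _ hom_refl[OF q] _ q])
    show "homotopic_paths X (reversepath d +++ d) (\<lambda>_. pathstart q)"
      using homotopic_paths_reversepath_const[of d X] d q by (simp add: path_in_def)
  qed (rule path_in_join[OF r d])
  also have "homotopic_paths X \<dots> q"
    using q by (intro homotopic_paths_const_left) (auto simp: path_in_def)
  finally show ?thesis .
qed

text \<open>A detour along \<open>e\<close> and back does not change the class. This is the device
  for cutting a path at a point that is first moved elsewhere.\<close>

lemma hom_insert:
  assumes a: "path_in X x u a" and e: "path_in X z u e" and n: "path_in X u y n"
  shows "homotopic_paths X (a +++ n) ((a +++ reversepath e) +++ (e +++ n))"
proof -
  have r: "path_in X u z (reversepath e)" using e by (rule path_in_reverse)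
  have "homotopic_paths X ((a +++ reversepath e) +++ (e +++ n)) (a +++ (reversepath e +++ (e +++ n)))"
    by (rule hom_assoc[OF a r path_in_join[OF e n]])
  also have "homotopic_paths X \<dots> (a +++ n)"
    by (rule hom_cong[OF hom_refl[OF a] hom_cancel[OF e n] a]) (rule path_in_join[OF r path_in_join[OF e n]])
  finally show ?thesis by (rule homotopic_paths_sym)
qed

text \<open>The connecting paths \<open>\<delta>\<close> are an arbitrary choice without any
  continuity. They extend the class of a loop to a functor \<open>F\<close> from all paths in
  \<open>X\<close> to the fundamental group; the constant choice at \<open>b\<close> makes
  \<open>F\<close> of a loop at \<open>b\<close> its own class.\<close>

locale path_functor =
  fixes X :: "'a::topological_space set" and b :: 'a and \<delta> :: "'a \<Rightarrow> real \<Rightarrow> 'a"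
  assumes \<delta>: "x \<in> X \<Longrightarrow> path_in X b x (\<delta> x)"
    and b: "b \<in> X" and \<delta>_b: "\<delta> b = (\<lambda>_. b)"
begin

abbreviation "P \<equiv> fundamental_group X b"

definition F :: "(real \<Rightarrow> 'a) \<Rightarrow> (real \<Rightarrow> 'a) set" where
  "F p = homotopy_rel X b `` {\<delta> (pathstart p) +++ p +++ reversepath (\<delta> (pathfinish p))}"

sublocale P: group P
  by (rule group_fundamental_group[OF b])

lemma class_eq:
  assumes "homotopic_paths X p q" "path_in X b b p"
  shows "homotopy_rel X b `` {p} = homotopy_rel X b `` {q}"
proof -
  have "path_in X b b q" using assms path_in_homotopic by metis
  with assms show ?thesis
    by (intro equiv_class_eq[OF equiv_homotopy_rel]) (auto simp: homotopy_rel_def loops_at_def path_in_def)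
qed

lemma F_carrier:
  assumes "path_in X x y p" shows "F p \<in> carrier P"
proof -
  have "path_in X b b (\<delta> x +++ p +++ reversepath (\<delta> y))"
    by (rule path_in_join[OF \<delta>[OF path_in_start[OF assms]]
          path_in_join[OF assms path_in_reverse[OF \<delta>[OF path_in_finish[OF assms]]]]])
  then have "\<delta> x +++ p +++ reversepath (\<delta> y) \<in> loops_at X b"
    by (auto simp: path_in_def loops_at_def)
  with assms show ?thesis by (simp add: F_def fundamental_group_def quotientI path_in_def)
qed

lemma F_homotopic:
  assumes "homotopic_paths X p q" "path_in X x y p"
  shows "F p = F q"
proof -
  have q: "path_in X x y q" using assms path_in_homotopic by metis
  have dx: "path_in X b x (\<delta> x)" "path_in X y b (reversepath (\<delta> y))"
    using \<delta>[OF path_in_start[OF assms(2)]] path_in_reverse[OF \<delta>[OF path_in_finish[OF assms(2)]]] .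
  have "homotopic_paths X (\<delta> x +++ p +++ reversepath (\<delta> y)) (\<delta> x +++ q +++ reversepath (\<delta> y))"
    using assms(2) q dx by (intro homotopic_paths_join assms(1)) (auto simp: path_in_def)
  moreover have "path_in X b b (\<delta> x +++ p +++ reversepath (\<delta> y))"
    by (rule path_in_join[OF dx(1) path_in_join[OF assms(2) dx(2)]])
  ultimately show ?thesis
    unfolding F_def using class_eq assms(2) q by (simp add: path_in_def)
qed

lemma F_join:
  assumes p: "path_in X x y p" and q: "path_in X y z q"
  shows "F (p +++ q) = F p \<otimes>\<^bsub>P\<^esub> F q"
proof -
  let ?x = "\<delta> x" and ?y = "\<delta> y" and ?z = "reversepath (\<delta> z)"
  have d: "path_in X b x ?x" "path_in X b y ?y" "path_in X z b ?z"
    using \<delta>[OF path_in_start[OF p]] \<delta>[OF path_in_finish[OF p]]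
      path_in_reverse[OF \<delta>[OF path_in_finish[OF q]]] .
  let ?l = "?x +++ p +++ reversepath ?y" and ?r = "?y +++ q +++ ?z"
  have ry: "path_in X y b (reversepath ?y)" using d(2) by (rule path_in_reverse)
  note pr = path_in_join[OF p ry] and qr = path_in_join[OF q d(3)]
  have l: "path_in X b b ?l" and r: "path_in X b b ?r"
    by (rule path_in_join[OF d(1) pr] path_in_join[OF d(2) qr])+
  have "homotopic_paths X (?l +++ ?r) (?x +++ ((p +++ reversepath ?y) +++ ?r))"
    by (rule hom_assoc[OF d(1) pr r])
  also have "homotopic_paths X \<dots> (?x +++ (p +++ (reversepath ?y +++ ?r)))"
    by (rule hom_cong[OF hom_refl[OF d(1)] hom_assoc[OF p ry r] d(1) path_in_join[OF pr r]])
  also have "homotopic_paths X \<dots> (?x +++ (p +++ (q +++ ?z)))"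
    by (rule hom_cong[OF hom_refl[OF d(1)]
          hom_cong[OF hom_refl[OF p] hom_cancel[OF d(2) qr] p path_in_join[OF ry r]] d(1)
          path_in_join[OF p path_in_join[OF ry r]]])
  also have "homotopic_paths X \<dots> (?x +++ ((p +++ q) +++ ?z))"
    by (rule hom_cong[OF hom_refl[OF d(1)] homotopic_paths_sym[OF hom_assoc[OF p q d(3)]] d(1)
          path_in_join[OF p qr]])
  finally have *: "homotopic_paths X (?l +++ ?r) (?x +++ ((p +++ q) +++ ?z))" .
  have "F p \<otimes>\<^bsub>P\<^esub> F q = homotopy_rel X b `` {?l +++ ?r}"
    using p q l r by (simp add: F_def path_in_def fundamental_group_mult loops_at_def)
  also have "\<dots> = homotopy_rel X b `` {?x +++ ((p +++ q) +++ ?z)}"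
    by (rule class_eq[OF * path_in_join[OF l r]])
  also have "\<dots> = F (p +++ q)" using p q by (simp add: F_def path_in_def)
  finally show ?thesis ..
qed

lemma F_const:
  assumes "x \<in> X" shows "F (\<lambda>_. x) = \<one>\<^bsub>P\<^esub>"
proof -
  have c: "path_in X x x (\<lambda>_. x)" using assms by (rule path_in_const)
  have "homotopic_paths X ((\<lambda>_. x) +++ (\<lambda>_. x)) (\<lambda>_. x)"
    using homotopic_paths_const_left[of "\<lambda>_. x" X] c by (simp add: path_in_def)
  then have "F ((\<lambda>_. x) +++ (\<lambda>_. x)) = F (\<lambda>_. x)" by (rule F_homotopic[OF _ path_in_join[OF c c]])
  \<comment> \<open>The class of a constant path is idempotent, and the only idempotent of a group
    is the unit.\<close>
  then show ?thesis using F_join[OF c c] F_carrier[OF c] P.l_cancel_one by simp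
qed

lemma F_loop:
  assumes "path_in X b b p" shows "F p = homotopy_rel X b `` {p}"
proof -
  have c: "path_in X b b (\<lambda>_. b)" using b by (rule path_in_const)
  have r: "reversepath (\<lambda>_. b) = (\<lambda>_. b)" by (simp add: reversepath_def)
  note pc = path_in_join[OF assms c]
  have "homotopic_paths X ((\<lambda>_. b) +++ p +++ (\<lambda>_. b)) (p +++ (\<lambda>_. b))"
    using homotopic_paths_const_left[of "p +++ (\<lambda>_. b)" X] pc by (simp add: path_in_def)
  also have "homotopic_paths X \<dots> p"
    using homotopic_paths_const_right[of p X] assms by (simp add: path_in_def)
  finally have *: "homotopic_paths X ((\<lambda>_. b) +++ p +++ (\<lambda>_. b)) p" .
  show ?thesis
    using class_eq[OF * path_in_join[OF c pc]] assms by (simp add: F_def path_in_def \<delta>_b r)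
qed

lemma F_simple_conn:
  assumes "simple_conn U" "U \<subseteq> X" "path_in U x y p" "path_in U x y q"
  shows "F p = F q"
  by (rule F_homotopic[OF homotopic_paths_subset[OF simple_conn_homotopic[OF assms(1,3,4)] assms(2)]
        path_in_mono[OF assms(3,2)]])

lemma F_trivial_loop:
  assumes "simple_conn U" "U \<subseteq> X" "path_in U x x p"
  shows "F p = \<one>\<^bsub>P\<^esub>"
proof -
  have x: "x \<in> U" by (rule path_in_start[OF assms(3)])
  with assms(2) have "x \<in> X" by blast
  then show ?thesis using F_simple_conn[OF assms path_in_const[OF x]] F_const by simp
qed

lemma F_reverse:
  assumes "path_in X x y p"
  shows "F p \<otimes>\<^bsub>P\<^esub> F (reversepath p) = \<one>\<^bsub>P\<^esub>" "F (reversepath p) \<otimes>\<^bsub>P\<^esub> F p = \<one>\<^bsub>P\<^esub>"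
proof -
  have *: "F (reversepath p) \<otimes>\<^bsub>P\<^esub> F p = \<one>\<^bsub>P\<^esub>" if "path_in X x y p" for x y p
  proof -
    have "homotopic_paths X (reversepath p +++ p) (\<lambda>_. y)"
      using homotopic_paths_reversepath_const[of p X] that by (simp add: path_in_def)
    then have "F (reversepath p +++ p) = F (\<lambda>_. y)"
      by (rule F_homotopic[OF _ path_in_join[OF path_in_reverse[OF that] that]])
    then show ?thesis
      using F_join[OF path_in_reverse[OF that] that] F_const[OF path_in_finish[OF that]] by simp
  qed
  show "F (reversepath p) \<otimes>\<^bsub>P\<^esub> F p = \<one>\<^bsub>P\<^esub>" by (rule *[OF assms])
  show "F p \<otimes>\<^bsub>P\<^esub> F (reversepath p) = \<one>\<^bsub>P\<^esub>" using *[OF path_in_reverse[OF assms]] by simp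
qed

end

section \<open>Cutting paths along an open cover\<close>

lemma open_path_preimage:
  fixes p :: "real \<Rightarrow> 'a::topological_space"
  assumes "path p" "open U" "p t \<in> U" "t \<in> {0..1}"
  obtains d where "d > 0" "\<And>s. s \<in> {0..1} \<Longrightarrow> \<bar>s - t\<bar> < d \<Longrightarrow> p s \<in> U"
proof -
  have "continuous (at t within {0..1}) p"
    using assms by (auto simp: path_def continuous_on_eq_continuous_within)
  then have "eventually (\<lambda>s. p s \<in> U) (at t within {0..1})"
    using assms(2,3) unfolding continuous_within by (rule topological_tendstoD)
  then obtain d where d: "d > 0" "\<And>s. s \<in> {0..1} \<Longrightarrow> s \<noteq> t \<Longrightarrow> dist s t < d \<Longrightarrow> p s \<in> U"
    unfolding eventually_at by auto
  then show thesis using that[of d] assms(3) by (metis dist_real_def)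
qed

lemma path_in_compose_linepath:
  assumes "path p" "0 \<le> a" "a \<le> b" "b \<le> 1" "\<And>r. a \<le> r \<Longrightarrow> r \<le> b \<Longrightarrow> p r \<in> U"
  shows "path_in U (p a) (p b) (p \<circ> linepath a b)"
proof -
  have "closed_segment a b \<subseteq> {0..1}" using assms by (auto simp: closed_segment_eq_real_ivl)
  then have "path (p \<circ> linepath a b)"
    using assms(1) by (intro path_continuous_image) (auto simp: path_def elim: continuous_on_subset)
  then show ?thesis
    using assms by (auto simp: path_in_def path_image_compose pathstart_compose pathfinish_compose closed_segment_eq_real_ivl)
qed

lemma homotopic_paths_compose_linepath:
  fixes p :: "real \<Rightarrow> 'a::topological_space"
  assumes "path p" "path_image p \<subseteq> X" "0 \<le> a" "a \<le> b" "b \<le> c" "c \<le> 1"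
  shows "homotopic_paths X ((p \<circ> linepath a b) +++ (p \<circ> linepath b c)) (p \<circ> linepath a c)"
proof -
  have "homotopic_paths {0..1} (linepath a b +++ linepath b c) (linepath a c)"
  proof (rule homotopic_paths_linear)
    fix t :: real assume t: "t \<in> {0..1}"
    have "path_image (linepath a b +++ linepath b c) \<subseteq> {0..1}" "path_image (linepath a c) \<subseteq> {0..1}"
      using assms by (auto simp: path_image_join closed_segment_eq_real_ivl)
    then have "(linepath a b +++ linepath b c) t \<in> {0..1}" "linepath a c t \<in> {0..1}"
      using t unfolding path_image_def by blast+
    then show "closed_segment ((linepath a b +++ linepath b c) t) (linepath a c t) \<subseteq> {0..1}"
      by (intro closed_segment_subset) auto
  qed auto
  then have "homotopic_paths X (p \<circ> (linepath a b +++ linepath b c)) (p \<circ> linepath a c)"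
    by (rule homotopic_paths_continuous_image) (use assms in \<open>auto simp: path_def path_image_def\<close>)
  then show ?thesis by (simp add: path_compose_join)
qed

text \<open>Paths are cut at points of the family of open sets \<open>\<U>\<close> that are moved into the dense set \<open>D\<close>.\<close>

lemma path_decomposition:
  fixes X :: "'a::topological_space set"
  assumes cover: "X = \<Union>\<U>"
    and opn: "\<And>U. U \<in> \<U> \<Longrightarrow> \<exists>T. open T \<and> U = X \<inter> T"
    and dense: "\<And>U V x. U \<in> \<U> \<Longrightarrow> V \<in> \<U> \<Longrightarrow> x \<in> U \<inter> V \<Longrightarrow> \<exists>y\<in>D. \<exists>p. path_in (U \<inter> V) y x p"
    and hom: "\<And>p q x y. x \<in> D \<Longrightarrow> y \<in> D \<Longrightarrow> path_in X x y p \<Longrightarrow> homotopic_paths X p q \<Longrightarrow> R p \<Longrightarrow> R q"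
    and join: "\<And>p q x y z. x \<in> D \<Longrightarrow> y \<in> D \<Longrightarrow> z \<in> D \<Longrightarrow> path_in X x y p \<Longrightarrow> path_in X y z q \<Longrightarrow>
       R p \<Longrightarrow> R q \<Longrightarrow> R (p +++ q)"
    and small: "\<And>U p x y. U \<in> \<U> \<Longrightarrow> x \<in> D \<Longrightarrow> y \<in> D \<Longrightarrow> path_in U x y p \<Longrightarrow> R p"
    and p: "path_in X x y p" "x \<in> D" "y \<in> D"
  shows "R p"
proof -
  \<comment> \<open>The path \<open>p\<close> may meet \<open>D\<close> only at its ends. A piece of
    it is therefore prolonged at both sides by paths into \<open>D\<close>, each within one member
    of the cover; quantifying over all prolongations makes the property pass from two adjacent
    pieces to their union.\<close>
  define Q where "Q a b \<longleftrightarrow> (0 \<le> a \<and> a \<le> b \<and> b \<le> 1 \<longrightarrow>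
    (\<forall>U\<in>\<U>. \<forall>V\<in>\<U>. \<forall>x\<in>D. \<forall>y\<in>D. \<forall>\<alpha> \<beta>. path_in U x (p a) \<alpha> \<longrightarrow> path_in V (p b) y \<beta> \<longrightarrow>
       R (\<alpha> +++ ((p \<circ> linepath a b) +++ \<beta>))))" for a b :: real
  have sub: "path_in X (p a) (p b) ((p \<circ> linepath a b))" if "0 \<le> a" "a \<le> b" "b \<le> 1" for a b
    using p(1) that by (intro path_in_compose_linepath) (auto simp: path_in_def path_image_def)
  have UX: "path_in X x y q" if "U \<in> \<U>" "path_in U x y q" for U x y q
    using that cover by (auto intro: path_in_mono)
  have "(0::real) \<le> 1" by simp
  then have "Q 0 1"
  proof (induction rule: Bolzano)
    case (trans a b c)
    show ?case unfolding Q_def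
    proof (intro impI ballI allI)
      fix U V x y \<alpha> \<beta> assume *: "0 \<le> a \<and> a \<le> c \<and> c \<le> 1" "U \<in> \<U>" "V \<in> \<U>" "x \<in> D" "y \<in> D"
        "path_in U x (p a) \<alpha>" "path_in V (p c) y \<beta>"
      have s: "path_in X (p a) (p b) ((p \<circ> linepath a b))" "path_in X (p b) (p c) ((p \<circ> linepath b c))"
        "path_in X (p a) (p c) ((p \<circ> linepath a c))"
        using sub[of a b] sub[of b c] sub[of a c] * \<open>a \<le> b\<close> \<open>b \<le> c\<close> by simp_all
      \<comment> \<open>The path \<open>e\<close> found here ends the left piece when reversed and
        begins the right piece, so both hypotheses apply and the two copies cancel.\<close>
      obtain W where W: "W \<in> \<U>" "p b \<in> W"
        using path_in_finish[OF s(1)] unfolding cover by (elim UnionE)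
      from W(2) have "p b \<in> W \<inter> W" by simp
      from dense[OF W(1) W(1) this] obtain z e where z: "z \<in> D" "path_in W z (p b) e"
        unfolding Int_absorb by (elim bexE exE)
      have re: "path_in W (p b) z (reversepath e)" by (rule path_in_reverse[OF z(2)])
      note ab = UX[OF *(2,6)] UX[OF *(3,7)] UX[OF W(1) z(2)] UX[OF W(1) re]
      have "R (\<alpha> +++ ((p \<circ> linepath a b) +++ reversepath e))"
        using trans(1)[unfolded Q_def, rule_format, OF _ *(2) W(1) *(4) z(1) *(6) re] *(1) \<open>a \<le> b\<close> \<open>b \<le> c\<close> by linarith
      moreover have "R (e +++ ((p \<circ> linepath b c) +++ \<beta>))"
        using trans(2)[unfolded Q_def, rule_format, OF _ W(1) *(3) z(1) *(5) z(2) *(7)] *(1) \<open>a \<le> b\<close> \<open>b \<le> c\<close> by linarith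
      moreover have pi: "path_in X x z (\<alpha> +++ ((p \<circ> linepath a b) +++ reversepath e))"
        "path_in X z y (e +++ ((p \<circ> linepath b c) +++ \<beta>))"
        by (insert ab s, (assumption | rule path_in_join)+)
      ultimately have R: "R ((\<alpha> +++ ((p \<circ> linepath a b) +++ reversepath e)) +++ (e +++ ((p \<circ> linepath b c) +++ \<beta>)))"
        by (intro join[OF *(4) z(1) *(5) pi])
      have t: "path_in X (p b) y ((p \<circ> linepath b c) +++ \<beta>)" by (rule path_in_join[OF s(2) ab(2)])
      have "homotopic_paths X ((\<alpha> +++ ((p \<circ> linepath a b) +++ reversepath e)) +++ (e +++ ((p \<circ> linepath b c) +++ \<beta>)))
          (\<alpha> +++ (((p \<circ> linepath a b) +++ reversepath e) +++ (e +++ ((p \<circ> linepath b c) +++ \<beta>))))"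
        by (rule hom_assoc) (insert ab s, (assumption | rule path_in_join path_in_reverse)+)
      also have "homotopic_paths X \<dots> (\<alpha> +++ ((p \<circ> linepath a b) +++ ((p \<circ> linepath b c) +++ \<beta>)))"
        by (rule hom_cong[OF hom_refl[OF ab(1)] homotopic_paths_sym[OF hom_insert[OF s(1) ab(3) t]] ab(1)])
          (insert ab s, (assumption | rule path_in_join path_in_reverse)+)
      also have "homotopic_paths X \<dots> (\<alpha> +++ (((p \<circ> linepath a b) +++ (p \<circ> linepath b c)) +++ \<beta>))"
        by (rule hom_cong[OF hom_refl[OF ab(1)] homotopic_paths_sym[OF hom_assoc[OF s(1,2) ab(2)]] ab(1)])
          (insert ab s, (assumption | rule path_in_join path_in_reverse)+)
      also have "homotopic_paths X \<dots> (\<alpha> +++ ((p \<circ> linepath a c) +++ \<beta>))"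
      proof (rule hom_cong[OF hom_refl[OF ab(1)] hom_cong[OF _ hom_refl[OF ab(2)] _ ab(2)] ab(1)])
        show "homotopic_paths X ((p \<circ> linepath a b) +++ (p \<circ> linepath b c)) ((p \<circ> linepath a c))"
          using p(1) * \<open>a \<le> b\<close> \<open>b \<le> c\<close> by (intro homotopic_paths_compose_linepath) (auto simp: path_in_def)
      qed (insert s ab, (assumption | rule path_in_join path_in_reverse)+)
      finally show "R (\<alpha> +++ ((p \<circ> linepath a c) +++ \<beta>))"
        by (rule hom[OF *(4,5) path_in_join[OF pi] _ R])
    qed
  next
    case (local t)
    then have t: "t \<in> {0..1}" by simp
    have pt: "path p" "p t \<in> X" using p(1) t by (auto simp: path_in_def path_image_def)
    then obtain W T where W: "W \<in> \<U>" "p t \<in> W" "open T" "W = X \<inter> T" using cover opn by (metis UnionE)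
    then obtain d where d: "d > 0" "\<And>s. s \<in> {0..1} \<Longrightarrow> \<bar>s - t\<bar> < d \<Longrightarrow> p s \<in> T"
      using open_path_preimage[OF pt(1) W(3) _ t] by blast
    have "Q a b" if ab: "a \<le> t" "t \<le> b" "b - a < d" for a b
      unfolding Q_def
    proof (intro impI ballI allI)
      fix U V x y \<alpha> \<beta> assume *: "0 \<le> a \<and> a \<le> b \<and> b \<le> 1" "U \<in> \<U>" "V \<in> \<U>" "x \<in> D" "y \<in> D"
        "path_in U x (p a) \<alpha>" "path_in V (p b) y \<beta>"
      let ?s = "(p \<circ> linepath a b)"
      have "p r \<in> W" if "a \<le> r" "r \<le> b" for r
        using that ab * d(2)[of r] W(4) p(1) by (auto simp: path_in_def path_image_def)
      then have sW: "path_in W (p a) (p b) ?s"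
        using pt * by (intro path_in_compose_linepath) auto
      have "p a \<in> U \<inter> W" "p b \<in> V \<inter> W"
        using path_in_start[OF sW] path_in_finish[OF sW] path_in_finish[OF *(6)] path_in_start[OF *(7)] by auto
      \<comment> \<open>The corrections \<open>e\<close> and \<open>f\<close> lie in intersections,
        so that the first prolongation with its correction, the corrected middle piece and the last
        prolongation with its correction each stay in one member of the cover, where
        \<open>small\<close> applies.\<close>
      then obtain u e v f where u: "u \<in> D" "path_in (U \<inter> W) u (p a) e" and v: "v \<in> D" "path_in (V \<inter> W) v (p b) f"
        using dense[OF *(2) W(1)] dense[OF *(3) W(1)] by blast
      have e: "path_in U u (p a) e" "path_in W u (p a) e" "path_in U (p a) u (reversepath e)"
        by (rule path_in_mono[OF u(2) Int_lower1] path_in_mono[OF u(2) Int_lower2]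
            path_in_reverse[OF path_in_mono[OF u(2) Int_lower1]])+
      have f: "path_in V v (p b) f" "path_in W v (p b) f" "path_in W (p b) v (reversepath f)"
        by (rule path_in_mono[OF v(2) Int_lower1] path_in_mono[OF v(2) Int_lower2]
            path_in_reverse[OF path_in_mono[OF v(2) Int_lower2]])+
      have X: "path_in X x (p a) \<alpha>" "path_in X (p b) y \<beta>" "path_in X (p a) (p b) ?s"
        "path_in X u (p a) e" "path_in X v (p b) f"
        "path_in X (p a) u (reversepath e)" "path_in X (p b) v (reversepath f)"
        by (rule UX[OF *(2,6)] UX[OF *(3,7)] UX[OF W(1) sW] UX[OF *(2) e(1)] UX[OF *(3) f(1)]
            UX[OF *(2) e(3)] UX[OF W(1) f(3)])+
      have pi: "path_in X x u (\<alpha> +++ reversepath e)" "path_in X u v (e +++ (?s +++ reversepath f))"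
        "path_in X v y (f +++ \<beta>)" by (insert X, (assumption | rule path_in_join)+)
      have "R (\<alpha> +++ reversepath e)" by (rule small[OF *(2,4) u(1)]) (rule path_in_join[OF *(6) e(3)])
      moreover have "R (e +++ (?s +++ reversepath f))" by (rule small[OF W(1) u(1) v(1)]) (rule path_in_join[OF e(2) path_in_join[OF sW f(3)]])
      moreover have "R (f +++ \<beta>)" by (rule small[OF *(3) v(1) *(5)]) (rule path_in_join[OF f(1) *(7)])
      ultimately have R: "R ((\<alpha> +++ reversepath e) +++ ((e +++ (?s +++ reversepath f)) +++ (f +++ \<beta>)))"
        by (intro join[OF *(4) u(1) *(5) pi(1) path_in_join[OF pi(2,3)]] join[OF u(1) v(1) *(5) pi(2,3)])
      have "homotopic_paths X ((e +++ (?s +++ reversepath f)) +++ (f +++ \<beta>)) (e +++ ((?s +++ reversepath f) +++ (f +++ \<beta>)))"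
        by (rule hom_assoc) (insert X, (assumption | rule path_in_join path_in_reverse)+)
      also have "homotopic_paths X \<dots> (e +++ (?s +++ \<beta>))"
        by (rule hom_cong[OF hom_refl[OF X(4)] homotopic_paths_sym[OF hom_insert[OF X(3,5,2)]] X(4)])
          (insert X, (assumption | rule path_in_join path_in_reverse)+)
      finally have h: "homotopic_paths X ((e +++ (?s +++ reversepath f)) +++ (f +++ \<beta>)) (e +++ (?s +++ \<beta>))" .
      have "homotopic_paths X ((\<alpha> +++ reversepath e) +++ ((e +++ (?s +++ reversepath f)) +++ (f +++ \<beta>)))
          ((\<alpha> +++ reversepath e) +++ (e +++ (?s +++ \<beta>)))"
        by (rule hom_cong[OF hom_refl[OF pi(1)] h pi(1) path_in_join[OF pi(2,3)]])
      also have "homotopic_paths X \<dots> (\<alpha> +++ (?s +++ \<beta>))"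
        by (rule homotopic_paths_sym[OF hom_insert[OF X(1,4) path_in_join[OF X(3,2)]]])
      finally show "R (\<alpha> +++ (?s +++ \<beta>))"
        by (rule hom[OF *(4,5) path_in_join[OF pi(1) path_in_join[OF pi(2,3)]] _ R])
    qed
    then show ?case using d(1) by blast
  qed
  have xy: "x = p 0" "y = p 1" using p(1) by (auto simp: path_in_def pathstart_def pathfinish_def)
  obtain U V where "U \<in> \<U>" "x \<in> U" "V \<in> \<U>" "y \<in> V"
    using path_in_start[OF p(1)] path_in_finish[OF p(1)] unfolding cover by (elim UnionE)
  then have R: "R ((\<lambda>_. x) +++ ((p \<circ> linepath 0 1) +++ (\<lambda>_. y)))"
    using \<open>Q 0 1\<close>[unfolded Q_def, rule_format, OF _ _ _ p(2,3), of U V "\<lambda>_. x" "\<lambda>_. y"] xy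
    by (simp add: path_in_const)
  have c: "path_in X x x (\<lambda>_. x)" "path_in X y y (\<lambda>_. y)"
    by (rule path_in_const[OF path_in_start[OF p(1)]] path_in_const[OF path_in_finish[OF p(1)]])+
  have p01: "p \<circ> linepath 0 1 = p" by (auto simp: linepath_def)
  have "homotopic_paths X ((\<lambda>_. x) +++ (p +++ (\<lambda>_. y))) (p +++ (\<lambda>_. y))"
    using homotopic_paths_const_left[of "p +++ (\<lambda>_. y)" X] path_in_join[OF p(1) c(2)]
    by (simp add: path_in_def)
  also have "homotopic_paths X \<dots> p"
    using homotopic_paths_const_right[of p X] p(1) by (simp add: path_in_def)
  finally show "R p"
    by (rule hom[OF p(2,3) path_in_join[OF c(1) path_in_join[OF p(1) c(2)]] _ R[unfolded p01]])
qed

section \<open>Flat bundles\<close>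

lemma eventually_nhds_continuous_on:
  assumes "continuous_on K h" "k \<in> K" "eventually P (nhds (h k))"
  shows "eventually (\<lambda>y. y \<in> K \<longrightarrow> P (h y)) (nhds k)"
proof -
  have "(h \<longlongrightarrow> h k) (at k within K)" using assms by (auto simp: continuous_on_def)
  then have "eventually (\<lambda>y. P (h y)) (at k within K)"
    using assms(3) by (auto simp: filterlim_iff)
  then have "eventually (\<lambda>y. y \<noteq> k \<longrightarrow> y \<in> K \<longrightarrow> P (h y)) (nhds k)"
    unfolding eventually_at_filter .
  then show ?thesis
    by eventually_elim (use eventually_nhds_x_imp_x[OF assms(3)] in auto)
qed

lemma constant_on_connected:
  assumes "connected K" "\<And>k. k \<in> K \<Longrightarrow> eventually (\<lambda>y. y \<in> K \<longrightarrow> d y = d k) (nhds k)" "k \<in> K" "l \<in> K"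
  shows "d k = d l"
proof (rule connected_local_const[OF assms(1,3,4)], rule ballI)
  fix k assume "k \<in> K"
  from assms(2)[OF this] show "eventually (\<lambda>y. d k = d y) (at k within K)"
    unfolding eventually_at_filter by eventually_elim auto
qed

text \<open>
  A family of maps \<open>w : U \<rightarrow> G\<close> on open sets covering \<open>X\<close>, any two of which differ locally by a
  left translation, is a flat bundle with fibre \<open>G\<close>; \<open>sec\<close> are its sections along a map \<open>h\<close>.
\<close>

locale developing = group G for G (structure) +
  fixes X :: "'x::topological_space set" and \<F> :: "('x set \<times> ('x \<Rightarrow> 'g)) set"
  assumes w_carrier: "(U, w) \<in> \<F> \<Longrightarrow> x \<in> U \<Longrightarrow> w x \<in> carrier G"
    and cover: "x \<in> X \<Longrightarrow> \<exists>(U, w)\<in>\<F>. x \<in> U"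
    and compat: "(U, w) \<in> \<F> \<Longrightarrow> (U', w') \<in> \<F> \<Longrightarrow> x \<in> U \<Longrightarrow> x \<in> U' \<Longrightarrow> x \<in> X \<Longrightarrow>
      \<exists>c\<in>carrier G. eventually (\<lambda>y. y \<in> X \<longrightarrow> y \<in> U' \<and> w' y = c \<otimes> w y) (nhds x)"
begin

definition sec :: "('k::topological_space \<Rightarrow> 'x) \<Rightarrow> 'k set \<Rightarrow> ('k \<Rightarrow> 'g) \<Rightarrow> bool" where
  "sec h K \<sigma> \<longleftrightarrow> continuous_on K h \<and> h ` K \<subseteq> X \<and>
     (\<forall>k\<in>K. \<exists>(U, w)\<in>\<F>. h k \<in> U \<and>
       (\<exists>g\<in>carrier G. eventually (\<lambda>y. y \<in> K \<longrightarrow> h y \<in> U \<and> \<sigma> y = g \<otimes> w (h y)) (nhds k)))"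

text \<open>Transitions between charts are left translations, so a function that is a translate of
  one frame near a point is a translate of every frame defined there.\<close>

lemma sec_chart:
  assumes "sec h K \<sigma>" "k \<in> K" "(U, w) \<in> \<F>" "h k \<in> U"
  shows "\<exists>g\<in>carrier G. eventually (\<lambda>y. y \<in> K \<longrightarrow> h y \<in> U \<and> \<sigma> y = g \<otimes> w (h y)) (nhds k)"
proof -
  obtain U' w' g where 1: "(U', w') \<in> \<F>" "h k \<in> U'" "g \<in> carrier G"
    and ev: "eventually (\<lambda>y. y \<in> K \<longrightarrow> h y \<in> U' \<and> \<sigma> y = g \<otimes> w' (h y)) (nhds k)"
    using assms(1,2) unfolding sec_def by blast
  have X: "h y \<in> X" if "y \<in> K" for y using assms(1) that unfolding sec_def by blast
  obtain c where c: "c \<in> carrier G" "eventually (\<lambda>y. y \<in> X \<longrightarrow> y \<in> U' \<and> w' y = c \<otimes> w y) (nhds (h k))"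
    using compat[OF assms(3) 1(1) assms(4) 1(2) X[OF assms(2)]] by blast
  \<comment> \<open>Compatibility of a chart with itself is how openness of \<open>U\<close> in
    \<open>X\<close> is expressed.\<close>
  obtain c' where c': "eventually (\<lambda>y. y \<in> X \<longrightarrow> y \<in> U \<and> w y = c' \<otimes> w y) (nhds (h k))"
    using compat[OF assms(3,3,4,4) X[OF assms(2)]] by blast
  have h: "continuous_on K h" using assms(1) by (simp add: sec_def)
  have "eventually (\<lambda>y. y \<in> K \<longrightarrow> h y \<in> U \<and> \<sigma> y = (g \<otimes> c) \<otimes> w (h y)) (nhds k)"
    using ev eventually_nhds_continuous_on[OF h assms(2) c(2)]
      eventually_nhds_continuous_on[OF h assms(2) c']
  proof eventually_elim
    case (elim y)
    show ?case
    proof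
      assume y: "y \<in> K"
      then have "h y \<in> U" using elim X by blast
      then have "w (h y) \<in> carrier G" using w_carrier[OF assms(3)] by blast
      then show "h y \<in> U \<and> \<sigma> y = (g \<otimes> c) \<otimes> w (h y)"
        using elim X[OF y] y 1(3) c(1) \<open>h y \<in> U\<close> by (simp add: m_assoc)
    qed
  qed
  then show ?thesis using 1(3) c(1) by blast
qed

lemma sec_carrier:
  assumes "sec h K \<sigma>" "k \<in> K" shows "\<sigma> k \<in> carrier G"
proof -
  obtain U w g where *: "(U, w) \<in> \<F>" "h k \<in> U" "g \<in> carrier G"
    "eventually (\<lambda>y. y \<in> K \<longrightarrow> h y \<in> U \<and> \<sigma> y = g \<otimes> w (h y)) (nhds k)"
    using assms unfolding sec_def by blast
  from eventually_nhds_x_imp_x[OF *(4)] assms(2) have "\<sigma> k = g \<otimes> w (h k)" by blast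
  then show ?thesis using w_carrier[OF *(1,2)] *(3) by simp
qed

lemma secI_chart:
  assumes "continuous_on K h" "h ` K \<subseteq> X" "(U, w) \<in> \<F>" "h ` K \<subseteq> U" "g \<in> carrier G"
    "\<And>k. k \<in> K \<Longrightarrow> \<sigma> k = g \<otimes> w (h k)"
  shows "sec h K \<sigma>"
  unfolding sec_def
proof (intro conjI ballI assms(1,2))
  fix k assume k: "k \<in> K"
  have "eventually (\<lambda>y. y \<in> K \<longrightarrow> h y \<in> U \<and> \<sigma> y = g \<otimes> w (h y)) (nhds k)"
    using assms(4,6) by (intro always_eventually) auto
  then show "\<exists>(U, w)\<in>\<F>. h k \<in> U \<and>
       (\<exists>g\<in>carrier G. eventually (\<lambda>y. y \<in> K \<longrightarrow> h y \<in> U \<and> \<sigma> y = g \<otimes> w (h y)) (nhds k))"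
    using k assms(3,4,5) by blast
qed

lemma sec_scale:
  assumes "sec h K \<sigma>" "c \<in> carrier G"
  shows "sec h K (\<lambda>k. c \<otimes> \<sigma> k)"
  unfolding sec_def
proof (intro conjI ballI)
  show "continuous_on K h" "h ` K \<subseteq> X" using assms(1) by (auto simp: sec_def)
  fix k assume k: "k \<in> K"
  then obtain U w g where *: "(U, w) \<in> \<F>" "h k \<in> U" "g \<in> carrier G"
    "eventually (\<lambda>y. y \<in> K \<longrightarrow> h y \<in> U \<and> \<sigma> y = g \<otimes> w (h y)) (nhds k)"
    using assms(1) unfolding sec_def by blast
  have "eventually (\<lambda>y. y \<in> K \<longrightarrow> h y \<in> U \<and> c \<otimes> \<sigma> y = (c \<otimes> g) \<otimes> w (h y)) (nhds k)"
    using *(4) by eventually_elim (use w_carrier[OF *(1)] *(3) assms(2) in \<open>auto simp: m_assoc\<close>)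
  then show "\<exists>(U, w)\<in>\<F>. h k \<in> U \<and>
       (\<exists>g\<in>carrier G. eventually (\<lambda>y. y \<in> K \<longrightarrow> h y \<in> U \<and> c \<otimes> \<sigma> y = g \<otimes> w (h y)) (nhds k))"
    using *(1,2,3) assms(2) by blast
qed

text \<open>Near each point both sections are left translates of the same frame, which cancels in
  the product of \<open>\<sigma>\<close> with the inverse of \<open>\<tau>\<close>. That product is
  thus locally constant.\<close>

lemma sec_unique:
  assumes "sec h K \<sigma>" "sec h K \<tau>" "connected K" "k \<in> K" "\<sigma> k = \<tau> k" "l \<in> K"
  shows "\<sigma> l = \<tau> l"
proof -
  define d where "d y = \<sigma> y \<otimes> inv (\<tau> y)" for y
  have "d k = d l"
  proof (rule constant_on_connected[OF assms(3) _ assms(4,6)])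
    fix k assume k: "k \<in> K"
    then obtain U w where U: "(U, w) \<in> \<F>" "h k \<in> U" using assms(1) unfolding sec_def by blast
    obtain g where g: "g \<in> carrier G" "eventually (\<lambda>y. y \<in> K \<longrightarrow> h y \<in> U \<and> \<sigma> y = g \<otimes> w (h y)) (nhds k)"
      using sec_chart[OF assms(1) k U] by blast
    obtain g' where g': "g' \<in> carrier G" "eventually (\<lambda>y. y \<in> K \<longrightarrow> h y \<in> U \<and> \<tau> y = g' \<otimes> w (h y)) (nhds k)"
      using sec_chart[OF assms(2) k U] by blast
    have "eventually (\<lambda>y. y \<in> K \<longrightarrow> d y = g \<otimes> inv g') (nhds k)"
      using g(2) g'(2)
    proof eventually_elim
      case (elim y)
      show ?case
      proof
        assume "y \<in> K"
        with elim have *: "h y \<in> U" "\<sigma> y = g \<otimes> w (h y)" "\<tau> y = g' \<otimes> w (h y)" by auto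
        have c: "w (h y) \<in> carrier G" using w_carrier[OF U(1) *(1)] .
        have "d y = g \<otimes> (w (h y) \<otimes> (inv (w (h y)) \<otimes> inv g'))"
          unfolding d_def * using c g(1) g'(1) by (simp add: inv_mult_group m_assoc)
        also have "w (h y) \<otimes> (inv (w (h y)) \<otimes> inv g') = inv g'"
          using c g'(1) by (simp add: m_assoc[symmetric])
        finally show "d y = g \<otimes> inv g'" .
      qed
    qed
    moreover from this have "d k = g \<otimes> inv g'" using eventually_nhds_x_imp_x k by fastforce
    ultimately show "eventually (\<lambda>y. y \<in> K \<longrightarrow> d y = d k) (nhds k)" by simp
  qed
  moreover have "d k = \<one>" unfolding d_def assms(5) using sec_carrier[OF assms(2,4)] by simp
  ultimately have "\<sigma> l \<otimes> inv (\<tau> l) = \<one>" by (simp add: d_def)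
  then show ?thesis using sec_carrier[OF assms(1,6)] sec_carrier[OF assms(2,6)] by (metis inv_equality inv_inv inv_closed)
qed

lemma sec_compose:
  fixes f :: "'j::topological_space \<Rightarrow> 'k::topological_space"
  assumes "sec h K \<sigma>" "continuous_on J f" "f ` J \<subseteq> K"
  shows "sec (h \<circ> f) J (\<sigma> \<circ> f)"
  unfolding sec_def
proof (intro conjI ballI)
  have *: "continuous_on K h" "h ` K \<subseteq> X" using assms(1) by (auto simp: sec_def)
  show "continuous_on J (h \<circ> f)" using *(1) assms(2,3) by (intro continuous_on_compose) (auto intro: continuous_on_subset)
  show "(h \<circ> f) ` J \<subseteq> X" using *(2) assms(3) by auto
  fix j assume j: "j \<in> J"
  then have k: "f j \<in> K" using assms(3) by blast
  then obtain U w g where U: "(U, w) \<in> \<F>" "h (f j) \<in> U" "g \<in> carrier G"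
    "eventually (\<lambda>y. y \<in> K \<longrightarrow> h y \<in> U \<and> \<sigma> y = g \<otimes> w (h y)) (nhds (f j))"
    using assms(1) unfolding sec_def by blast
  have "eventually (\<lambda>y. y \<in> J \<longrightarrow> (h \<circ> f) y \<in> U \<and> (\<sigma> \<circ> f) y = g \<otimes> w ((h \<circ> f) y)) (nhds j)"
    using eventually_nhds_continuous_on[OF assms(2) j U(4)] by eventually_elim (use assms(3) in auto)
  then show "\<exists>(U, w)\<in>\<F>. (h \<circ> f) j \<in> U \<and> (\<exists>g\<in>carrier G.
      eventually (\<lambda>y. y \<in> J \<longrightarrow> (h \<circ> f) y \<in> U \<and> (\<sigma> \<circ> f) y = g \<otimes> w ((h \<circ> f) y)) (nhds j))"
    using U(1,2,3) by auto
qed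

lemma sec_cong:
  assumes "sec h K \<sigma>" "\<And>k. k \<in> K \<Longrightarrow> h k = h' k" "\<And>k. k \<in> K \<Longrightarrow> \<sigma> k = \<sigma>' k"
  shows "sec h' K \<sigma>'"
proof -
  have "continuous_on K h' = continuous_on K h" using assms(2) by (intro continuous_on_cong) auto
  moreover have "h' ` K = h ` K" using assms(2) by force
  moreover have "\<exists>(U, w)\<in>\<F>. h' k \<in> U \<and> (\<exists>g\<in>carrier G.
      eventually (\<lambda>y. y \<in> K \<longrightarrow> h' y \<in> U \<and> \<sigma>' y = g \<otimes> w (h' y)) (nhds k))" if k: "k \<in> K" for k
  proof -
    obtain U w g where U: "(U, w) \<in> \<F>" "h k \<in> U" "g \<in> carrier G"
      "eventually (\<lambda>y. y \<in> K \<longrightarrow> h y \<in> U \<and> \<sigma> y = g \<otimes> w (h y)) (nhds k)"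
      using assms(1) k unfolding sec_def by blast
    have "eventually (\<lambda>y. y \<in> K \<longrightarrow> h' y \<in> U \<and> \<sigma>' y = g \<otimes> w (h' y)) (nhds k)"
      using U(4) by eventually_elim (use assms(2,3) in force)
    then show ?thesis using U(1,2,3) assms(2)[OF k] by auto
  qed
  ultimately show ?thesis using assms(1) unfolding sec_def by auto
qed

lemma sec_glue:
  assumes "closed A" "closed B" "sec h A \<sigma>" "sec h B \<tau>" "\<And>k. k \<in> A \<inter> B \<Longrightarrow> \<sigma> k = \<tau> k"
  shows "sec h (A \<union> B) (\<lambda>k. if k \<in> A then \<sigma> k else \<tau> k)"
  unfolding sec_def
proof (intro conjI ballI)
  show "continuous_on (A \<union> B) h" using assms by (intro continuous_on_closed_Un) (auto simp: sec_def)
  show "h ` (A \<union> B) \<subseteq> X" using assms by (auto simp: sec_def)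
  let ?\<rho> = "\<lambda>k. if k \<in> A then \<sigma> k else \<tau> k"
  fix k assume k: "k \<in> A \<union> B"
  then have "h k \<in> X" using assms(3,4) by (auto simp: sec_def)
  then obtain U w where U: "(U, w) \<in> \<F>" "h k \<in> U" using cover by blast
  have a: "\<exists>g\<in>carrier G. eventually (\<lambda>y. y \<in> A \<longrightarrow> h y \<in> U \<and> \<sigma> y = g \<otimes> w (h y)) (nhds k)"
    if "k \<in> A" using sec_chart[OF assms(3) that U] .
  have b: "\<exists>g\<in>carrier G. eventually (\<lambda>y. y \<in> B \<longrightarrow> h y \<in> U \<and> \<tau> y = g \<otimes> w (h y)) (nhds k)"
    if "k \<in> B" using sec_chart[OF assms(4) that U] .
  have na: "eventually (\<lambda>y. y \<notin> A) (nhds k)" if "k \<notin> A"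
    using that assms(1) eventually_nhds_in_open[of "- A" k] by auto
  have nb: "eventually (\<lambda>y. y \<notin> B) (nhds k)" if "k \<notin> B"
    using that assms(2) eventually_nhds_in_open[of "- B" k] by auto
  have "\<exists>g\<in>carrier G. eventually (\<lambda>y. y \<in> A \<union> B \<longrightarrow> h y \<in> U \<and> ?\<rho> y = g \<otimes> w (h y)) (nhds k)"
  proof -
    consider "k \<in> A" "k \<in> B" | "k \<notin> A" "k \<in> B" | "k \<in> A" "k \<notin> B" using k by blast
    then show ?thesis
    proof cases
      case 1
      obtain g where g: "g \<in> carrier G" "eventually (\<lambda>y. y \<in> A \<longrightarrow> h y \<in> U \<and> \<sigma> y = g \<otimes> w (h y)) (nhds k)"
        using a 1 by blast
      obtain g' where g': "g' \<in> carrier G" "eventually (\<lambda>y. y \<in> B \<longrightarrow> h y \<in> U \<and> \<tau> y = g' \<otimes> w (h y)) (nhds k)"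
        using b 1 by blast
      have "g \<otimes> w (h k) = g' \<otimes> w (h k)"
        using eventually_nhds_x_imp_x[OF g(2)] eventually_nhds_x_imp_x[OF g'(2)] assms(5)[of k] 1 by auto
      then have "g = g'" using g(1) g'(1) w_carrier[OF U] by (simp add: right_cancel)
      with g g' have "eventually (\<lambda>y. y \<in> A \<union> B \<longrightarrow> h y \<in> U \<and> ?\<rho> y = g \<otimes> w (h y)) (nhds k)"
        by (auto elim: eventually_elim2)
      with g(1) show ?thesis by blast
    next
      case 2
      obtain g' where g': "g' \<in> carrier G" "eventually (\<lambda>y. y \<in> B \<longrightarrow> h y \<in> U \<and> \<tau> y = g' \<otimes> w (h y)) (nhds k)"
        using b 2 by blast
      have "eventually (\<lambda>y. y \<in> A \<union> B \<longrightarrow> h y \<in> U \<and> ?\<rho> y = g' \<otimes> w (h y)) (nhds k)"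
        using g'(2) na[OF 2(1)] by eventually_elim auto
      with g'(1) show ?thesis by blast
    next
      case 3
      obtain g where g: "g \<in> carrier G" "eventually (\<lambda>y. y \<in> A \<longrightarrow> h y \<in> U \<and> \<sigma> y = g \<otimes> w (h y)) (nhds k)"
        using a 3 by blast
      have "eventually (\<lambda>y. y \<in> A \<union> B \<longrightarrow> h y \<in> U \<and> ?\<rho> y = g \<otimes> w (h y)) (nhds k)"
        using g(2) nb[OF 3(2)] by eventually_elim auto
      with g(1) show ?thesis by blast
    qed
  qed
  with U show "\<exists>(U, w)\<in>\<F>. h k \<in> U \<and> (\<exists>g\<in>carrier G.
      eventually (\<lambda>y. y \<in> A \<union> B \<longrightarrow> h y \<in> U \<and> ?\<rho> y = g \<otimes> w (h y)) (nhds k))" by blast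
qed

text \<open>A left translation of one section makes the two agree at \<open>k\<close>; uniqueness
  spreads the agreement over the connected overlap.\<close>

lemma sec_glue_connected:
  assumes "closed A" "closed B" "sec h A \<sigma>" "sec h B \<tau>" "connected (A \<inter> B)" "k \<in> A \<inter> B"
  shows "\<exists>\<rho>. sec h (A \<union> B) \<rho>"
proof -
  let ?c = "\<sigma> k \<otimes> inv (\<tau> k)"
  have c: "\<sigma> k \<in> carrier G" "\<tau> k \<in> carrier G"
    using sec_carrier[OF assms(3)] sec_carrier[OF assms(4)] assms(6) by auto
  have sub: "sec h (A \<inter> B) \<rho>" if "sec h K \<rho>" "A \<inter> B \<subseteq> K" for K \<rho>
    using sec_compose[OF that(1), of "A \<inter> B" "\<lambda>x. x"] that(2) by (simp add: comp_def)
  have t: "sec h B (\<lambda>k. ?c \<otimes> \<tau> k)" using sec_scale[OF assms(4)] c by simp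
  have "\<sigma> l = ?c \<otimes> \<tau> l" if "l \<in> A \<inter> B" for l
    by (rule sec_unique[OF sub[OF assms(3)] sub[OF t] assms(5,6) _ that]) (use c in \<open>auto simp: m_assoc\<close>)
  from sec_glue[OF assms(1,2,3) t this] show ?thesis by blast
qed

text \<open>Small rectangles map into a chart and carry a section. The inner subdivision stacks them
  to a thin strip of full height over a neighbourhood of \<open>x\<close>, the outer one puts the
  strips side by side; adjacent pieces overlap in a segment, which is connected.\<close>

lemma sec_square:
  fixes h :: "real \<times> real \<Rightarrow> 'x"
  assumes h: "continuous_on ({0..1} \<times> {0..1}) h" "h ` ({0..1} \<times> {0..1}) \<subseteq> X"
  shows "\<exists>\<sigma>. sec h ({0..1} \<times> {0..1}) \<sigma>"
proof -
  define E where "E a b c d \<longleftrightarrow> (\<exists>\<sigma>. sec h ({a..b} \<times> {c..d}) \<sigma>)" for a b c d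
  have E1: "E a e c d" if prem: "E a b c d" "E b e c d" "a \<le> b" "b \<le> e" "c \<le> d" for a b c d e
  proof -
    obtain \<sigma> \<tau> where "sec h ({a..b} \<times> {c..d}) \<sigma>" "sec h ({b..e} \<times> {c..d}) \<tau>"
      using prem(1,2) unfolding E_def by blast
    moreover have i: "({a..b} \<times> {c..d}) \<inter> ({b..e} \<times> {c..d}) = {b} \<times> {c..d}"
      and u: "({a..b} \<times> {c..d}) \<union> ({b..e} \<times> {c..d}) = {a..e} \<times> {c..d}" using prem(3-5) by auto
    moreover have "connected ({b} \<times> {c..d})" by (intro connected_Times) auto
    ultimately show ?thesis
      using sec_glue_connected[of "{a..b} \<times> {c..d}" "{b..e} \<times> {c..d}" h \<sigma> \<tau> "(b, c)"] prem(5)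
      unfolding E_def by (auto simp: i u closed_Times)
  qed
  have E2: "E a b c e" if prem: "E a b c d" "E a b d e" "a \<le> b" "c \<le> d" "d \<le> e" for a b c d e
  proof -
    obtain \<sigma> \<tau> where "sec h ({a..b} \<times> {c..d}) \<sigma>" "sec h ({a..b} \<times> {d..e}) \<tau>"
      using prem(1,2) unfolding E_def by blast
    moreover have i: "({a..b} \<times> {c..d}) \<inter> ({a..b} \<times> {d..e}) = {a..b} \<times> {d}"
      and u: "({a..b} \<times> {c..d}) \<union> ({a..b} \<times> {d..e}) = {a..b} \<times> {c..e}" using prem(3-5) by auto
    moreover have "connected ({a..b} \<times> {d})" by (intro connected_Times) auto
    ultimately show ?thesis
      using sec_glue_connected[of "{a..b} \<times> {c..d}" "{a..b} \<times> {d..e}" h \<sigma> \<tau> "(a, d)"] prem(3)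
      unfolding E_def by (auto simp: i u closed_Times)
  qed
  define S where "S a b \<longleftrightarrow> (0 \<le> a \<and> a \<le> b \<and> b \<le> 1 \<longrightarrow> E a b 0 1)" for a b
  have "(0::real) \<le> 1" by simp
  then have "S 0 1"
  proof (induction rule: Bolzano)
    case (trans a b c) then show ?case unfolding S_def using E1[of a b 0 1 c] by auto
  next
    case (local x)
    \<comment> \<open>The admissible width of the strip may shrink with each gluing step, so it is
      existentially quantified inside the property and the minimum is taken.\<close>
    define R where "R c d \<longleftrightarrow> (0 \<le> c \<and> c \<le> d \<and> d \<le> 1 \<longrightarrow>
      (\<exists>\<delta>>0. \<forall>a b. 0 \<le> a \<and> a \<le> x \<and> x \<le> b \<and> b \<le> 1 \<and> b - a < \<delta> \<longrightarrow> E a b c d))" for c d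
    have "(0::real) \<le> 1" by simp
    then have "R 0 1"
    proof (induction rule: Bolzano)
      case (trans c d e)
      show ?case unfolding R_def
      proof
        assume *: "0 \<le> c \<and> c \<le> e \<and> e \<le> 1"
        obtain \<delta>1 where 1: "\<delta>1 > 0" "\<And>a b. 0 \<le> a \<and> a \<le> x \<and> x \<le> b \<and> b \<le> 1 \<and> b - a < \<delta>1 \<Longrightarrow> E a b c d"
          using trans * unfolding R_def by (meson order_trans)
        obtain \<delta>2 where 2: "\<delta>2 > 0" "\<And>a b. 0 \<le> a \<and> a \<le> x \<and> x \<le> b \<and> b \<le> 1 \<and> b - a < \<delta>2 \<Longrightarrow> E a b d e"
          using trans * unfolding R_def by (meson order_trans)
        have "E a b c e" if "0 \<le> a \<and> a \<le> x \<and> x \<le> b \<and> b \<le> 1 \<and> b - a < min \<delta>1 \<delta>2" for a b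
          using E2[OF 1(2) 2(2)] that trans by auto
        then show "\<exists>\<delta>>0. \<forall>a b. 0 \<le> a \<and> a \<le> x \<and> x \<le> b \<and> b \<le> 1 \<and> b - a < \<delta> \<longrightarrow> E a b c e"
          using 1(1) 2(1) by (intro exI[of _ "min \<delta>1 \<delta>2"]) auto
      qed
    next
      case (local y)
      have xy: "(x, y) \<in> {0..1} \<times> {0..1}" using local \<open>0 \<le> x\<close> \<open>x \<le> 1\<close> by auto
      then have "h (x, y) \<in> X" using h(2) by blast
      then obtain U w where U: "(U, w) \<in> \<F>" "h (x, y) \<in> U" using cover by blast
      obtain c where "eventually (\<lambda>z. z \<in> X \<longrightarrow> z \<in> U \<and> w z = c \<otimes> w z) (nhds (h (x, y)))"
        using compat[OF U(1,1,2,2) \<open>h (x, y) \<in> X\<close>] by blast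
      from eventually_nhds_continuous_on[OF h(1) xy this]
      have "eventually (\<lambda>z. z \<in> {0..1} \<times> {0..1} \<longrightarrow> h z \<in> U) (nhds (x, y))"
        by eventually_elim (use h(2) in blast)
      then obtain r where r: "r > 0" "\<And>z. dist z (x, y) < r \<Longrightarrow> z \<in> {0..1} \<times> {0..1} \<Longrightarrow> h z \<in> U"
        unfolding eventually_nhds_metric by blast
      have small: "E a b c d" if prem: "0 \<le> a" "a \<le> x" "x \<le> b" "b \<le> 1" "b - a < r/2"
        "0 \<le> c" "c \<le> y" "y \<le> d" "d \<le> 1" "d - c < r/2" for a b c d
      proof -
        have "h z \<in> U" if z: "z \<in> {a..b} \<times> {c..d}" for z
        proof (rule r(2))
          obtain z1 z2 where zz: "z = (z1, z2)" by fastforce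
          have "dist z (x, y) \<le> \<bar>z1 - x\<bar> + \<bar>z2 - y\<bar>"
            unfolding zz dist_Pair_Pair dist_real_def by (rule sqrt_sum_squares_le_sum_abs[THEN order_trans]) auto
          also have "\<dots> < r/2 + r/2" using z prem zz by auto
          finally show "dist z (x, y) < r" by simp
          show "z \<in> {0..1} \<times> {0..1}" using z prem zz by auto
        qed
        moreover have sub: "{a..b} \<times> {c..d} \<subseteq> {0..1} \<times> {0..1}" using prem by auto
        ultimately have "sec h ({a..b} \<times> {c..d}) (\<lambda>z. \<one> \<otimes> w (h z))"
          using h(2) continuous_on_subset[OF h(1) sub] by (intro secI_chart[OF _ _ U(1)]) (blast | simp)+
        then show ?thesis unfolding E_def by blast
      qed
      have "R c d" if "c \<le> y \<and> y \<le> d \<and> d - c < r/2" for c d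
        unfolding R_def using small r(1) that by (intro impI exI[of _ "r/2"]) auto
      then show ?case using r(1) by (intro exI[of _ "r/2"]) auto
    qed
    then obtain \<delta> where "\<delta> > 0" "\<And>a b. 0 \<le> a \<and> a \<le> x \<and> x \<le> b \<and> b \<le> 1 \<and> b - a < \<delta> \<Longrightarrow> E a b 0 1"
      unfolding R_def by auto
    then show ?case unfolding S_def by (intro exI[of _ \<delta>]) auto
  qed
  then show ?thesis unfolding S_def E_def by simp
qed

text \<open>Parallel transport of \<open>g\<close> along \<open>p\<close>, as a relation: it is
  single-valued by \<open>tr_unique\<close>, and values are produced for paths in a chart, for
  joins, and by homotopy.\<close>

definition tr :: "(real \<Rightarrow> 'x) \<Rightarrow> 'g \<Rightarrow> 'g \<Rightarrow> bool" where
  "tr p g g' \<longleftrightarrow> (\<exists>\<sigma>. sec p {0..1} \<sigma> \<and> \<sigma> 0 = g \<and> \<sigma> 1 = g')"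

lemma tr_unique:
  assumes "tr p g g'" "tr p g g''" shows "g' = g''"
proof -
  obtain \<sigma> \<tau> where s: "sec p {0..1} \<sigma>" "\<sigma> 0 = g" "\<sigma> 1 = g'" "sec p {0..1} \<tau>" "\<tau> 0 = g" "\<tau> 1 = g''"
    using assms unfolding tr_def by blast
  have "\<sigma> 1 = \<tau> 1" by (rule sec_unique[OF s(1,4), of 0]) (use s in auto)
  then show ?thesis using s by simp
qed

lemma tr_join:
  assumes "tr p g g'" "tr q g' g''" "pathfinish p = pathstart q"
  shows "tr (p +++ q) g g''"
proof -
  obtain \<sigma> \<tau> where s: "sec p {0..1} \<sigma>" "\<sigma> 0 = g" "\<sigma> 1 = g'" "sec q {0..1} \<tau>" "\<tau> 0 = g'" "\<tau> 1 = g''"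
    using assms(1,2) unfolding tr_def by blast
  have "sec (p \<circ> (\<lambda>t. 2 * t)) {0..1/2} (\<sigma> \<circ> (\<lambda>t. 2 * t))"
    by (rule sec_compose[OF s(1)]) (auto intro!: continuous_intros)
  then have 1: "sec (p +++ q) {0..1/2} (\<lambda>t. \<sigma> (2 * t))"
    by (rule sec_cong) (auto simp: joinpaths_def)
  have "sec (q \<circ> (\<lambda>t. 2 * t - 1)) {1/2..1} (\<tau> \<circ> (\<lambda>t. 2 * t - 1))"
    by (rule sec_compose[OF s(4)]) (auto intro!: continuous_intros)
  then have 2: "sec (p +++ q) {1/2..1} (\<lambda>t. \<tau> (2 * t - 1))"
  proof (rule sec_cong)
    fix k :: real assume "k \<in> {1/2..1}"
    then show "(q \<circ> (\<lambda>t. 2 * t - 1)) k = (p +++ q) k"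
    proof (cases "k = 1/2")
      case True
      show ?thesis unfolding True using assms(3) by (simp add: joinpaths_def pathfinish_def pathstart_def)
    qed (auto simp: joinpaths_def)
  qed simp
  have "sec (p +++ q) ({0..1/2} \<union> {1/2..1}) (\<lambda>t. if t \<in> {0..1/2} then \<sigma> (2 * t) else \<tau> (2 * t - 1))"
  proof (rule sec_glue[OF _ _ 1 2])
    fix k :: real assume "k \<in> {0..1/2} \<inter> {1/2..1}"
    then have "k = 1/2" by simp
    show "\<sigma> (2 * k) = \<tau> (2 * k - 1)" unfolding \<open>k = 1/2\<close> using s by simp
  qed auto
  moreover have "{0..1/2} \<union> {1/2..1} = {0..1::real}" by auto
  ultimately show ?thesis
    unfolding tr_def using s by (intro exI[of _ "\<lambda>t. if t \<in> {0..1/2} then \<sigma> (2 * t) else \<tau> (2 * t - 1)"]) auto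
qed

lemma tr_chart:
  assumes "path_in U x y p" "U \<subseteq> X" "(U, w) \<in> \<F>" "g \<in> carrier G"
  shows "tr p g (g \<otimes> inv (w x) \<otimes> w y)"
proof -
  have c: "w x \<in> carrier G" using w_carrier[OF assms(3) path_in_start[OF assms(1)]] .
  have "sec p {0..1} (\<lambda>t. (g \<otimes> inv (w x)) \<otimes> w (p t))"
    using assms c by (intro secI_chart[OF _ _ assms(3)]) (auto simp: path_in_def path_def path_image_def)
  then show ?thesis
    unfolding tr_def using assms(1,4) c
    by (intro exI[of _ "\<lambda>t. (g \<otimes> inv (w x)) \<otimes> w (p t)"])
      (auto simp: path_in_def pathstart_def pathfinish_def m_assoc)
qed

text \<open>A section over the square of the homotopy restricts to sections along both paths. On the
  two sides where the homotopy stands still it is constant, because a constant function is also a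
  section there.\<close>

lemma tr_homotopic:
  assumes "homotopic_paths X p q" "tr p g g'"
  shows "tr q g g'"
proof -
  let ?I = "{0..1::real}"
  obtain h where h: "continuous_on (?I \<times> ?I) h" "h \<in> (?I \<times> ?I) \<rightarrow> X"
    "\<And>t. t \<in> ?I \<Longrightarrow> h (0, t) = p t" "\<And>t. t \<in> ?I \<Longrightarrow> h (1, t) = q t"
    "\<And>s. s \<in> ?I \<Longrightarrow> h (s, 0) = p 0" "\<And>s. s \<in> ?I \<Longrightarrow> h (s, 1) = p 1"
    using assms(1) unfolding homotopic_paths by (auto simp: pathstart_def pathfinish_def)
  obtain \<sigma> where s: "sec p ?I \<sigma>" "\<sigma> 0 = g" "\<sigma> 1 = g'" using assms(2) unfolding tr_def by blast
  have gc: "g \<in> carrier G" using sec_carrier[OF s(1), of 0] s(2) by simp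
  obtain \<rho>' where r': "sec h (?I \<times> ?I) \<rho>'" using sec_square[OF h(1)] h(2) by blast
  have c: "\<rho>' (0, 0) \<in> carrier G" using sec_carrier[OF r'] by simp
  define \<rho> where "\<rho> z = (g \<otimes> inv (\<rho>' (0, 0))) \<otimes> \<rho>' z" for z
  have r: "sec h (?I \<times> ?I) \<rho>" unfolding \<rho>_def using sec_scale[OF r'] gc c by auto
  have r0: "\<rho> (0, 0) = g" unfolding \<rho>_def using gc c by (simp add: m_assoc)
  have v: "sec h' ?I (\<lambda>t. \<rho> (s, t))" if "s \<in> ?I" "\<And>t. t \<in> ?I \<Longrightarrow> h (s, t) = h' t" for s h'
    by (rule sec_cong[OF sec_compose[OF r, of ?I "\<lambda>t. (s, t)"]]) (use that in \<open>auto intro!: continuous_intros\<close>)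
  have u: "sec h' ?I (\<lambda>s. \<rho> (s, t))" if "t \<in> ?I" "\<And>s. s \<in> ?I \<Longrightarrow> h (s, t) = h' s" for t h'
    by (rule sec_cong[OF sec_compose[OF r, of ?I "\<lambda>s. (s, t)"]]) (use that in \<open>auto intro!: continuous_intros\<close>)
  have const: "\<rho> (1, t) = \<rho> (0, t)" if t: "t \<in> ?I" and ht: "\<And>s. s \<in> ?I \<Longrightarrow> h (s, t) = x" for t x
  proof -
    have a: "sec (\<lambda>_. x) ?I (\<lambda>s. \<rho> (s, t))" by (rule u[OF t ht])
    have "sec (\<lambda>_. x) ?I (\<lambda>_. \<rho> (0, t))"
      by (rule sec_cong[OF sec_compose[OF a, of ?I "\<lambda>_. 0"]]) auto
    from sec_unique[OF a this, of 0 1] show ?thesis by simp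
  qed
  have "\<sigma> 1 = \<rho> (0, 1)"
    by (rule sec_unique[OF s(1) v[of 0 p], of 0 1]) (use h(3) r0 s(2) in auto)
  moreover have "\<rho> (1, 1) = \<rho> (0, 1)" "\<rho> (1, 0) = \<rho> (0, 0)"
    using const[OF _ h(6)] const[OF _ h(5)] by auto
  moreover have "sec q ?I (\<lambda>t. \<rho> (1, t))" by (rule v) (use h(4) in auto)
  ultimately show ?thesis unfolding tr_def using s r0 by (intro exI[of _ "\<lambda>t. \<rho> (1, t)"]) auto
qed

end

section \<open>Walls and chambers\<close>

text \<open>
  With \<open>v\<close> and \<open>w\<close> homogeneous coordinates of \<open>x\<^sub>3\<close> and \<open>x\<^sub>4\<close>, the triple opposite to \<open>x\<^sub>i\<close> is
  collinear if and only if \<open>wall i v w = 0\<close>.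
\<close>

definition wall :: "4 \<Rightarrow> real^3 \<Rightarrow> real^3 \<Rightarrow> real" where
  "wall i v w = (if i = 1 then v$1 * w$3 - v$3 * w$1
     else if i = 2 then v$2 * w$3 - v$3 * w$2 else if i = 3 then w$3 else v$3)"

text \<open>The component of the cross product of \<open>v\<close> and \<open>w\<close> that is not,
  up to sign, one of the first two walls.\<close>

definition minor12 :: "real^3 \<Rightarrow> real^3 \<Rightarrow> real" where
  "minor12 v w = v$1 * w$2 - v$2 * w$1"

lemma wall_simps [simp]:
  "wall 1 v w = v$1 * w$3 - v$3 * w$1" "wall 2 v w = v$2 * w$3 - v$3 * w$2"
  "wall 3 v w = w$3" "wall 4 v w = v$3"
  by (simp_all add: wall_def)

lemma all4_neq: "(\<forall>j::4. j \<noteq> i \<longrightarrow> P j) \<longleftrightarrow>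
   (i \<noteq> 1 \<longrightarrow> P 1) \<and> (i \<noteq> 2 \<longrightarrow> P 2) \<and> (i \<noteq> 3 \<longrightarrow> P 3) \<and> (i \<noteq> 4 \<longrightarrow> P 4)"
  by (auto simp: forall_4)

lemma vec3_eq_0: "(v::real^3) = 0 \<longleftrightarrow> v$1 = 0 \<and> v$2 = 0 \<and> v$3 = 0"
  by (simp add: vec_eq_iff forall_3)

lemma proportional_iff:
  fixes v w :: "real^3" assumes "v \<noteq> 0" "w \<noteq> 0"
  shows "(\<exists>c. v = c *\<^sub>R w) \<longleftrightarrow> wall 1 v w = 0 \<and> wall 2 v w = 0 \<and> minor12 v w = 0"
proof
  assume "wall 1 v w = 0 \<and> wall 2 v w = 0 \<and> minor12 v w = 0"
  then have e: "v$1 * w$3 = v$3 * w$1" "v$2 * w$3 = v$3 * w$2" "v$1 * w$2 = v$2 * w$1"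
    by (auto simp: minor12_def)
  consider "w$1 \<noteq> 0" | "w$2 \<noteq> 0" | "w$3 \<noteq> 0" using assms(2) by (auto simp: vec3_eq_0)
  then show "\<exists>c. v = c *\<^sub>R w"
  proof cases
    case 1 then show ?thesis using e by (intro exI[of _ "v$1 / w$1"]) (simp add: vec_eq_iff forall_3 field_simps)
  next
    case 2 then show ?thesis using e by (intro exI[of _ "v$2 / w$2"]) (simp add: vec_eq_iff forall_3 field_simps)
  next
    case 3 then show ?thesis using e by (intro exI[of _ "v$3 / w$3"]) (simp add: vec_eq_iff forall_3 field_simps)
  qed
qed (auto simp: minor12_def)

definition distinct_pts :: "real^3 \<Rightarrow> real^3 \<Rightarrow> bool" where
  "distinct_pts v w \<longleftrightarrow> (v$2 \<noteq> 0 \<or> v$3 \<noteq> 0) \<and> (v$1 \<noteq> 0 \<or> v$3 \<noteq> 0) \<and> (w$2 \<noteq> 0 \<or> w$3 \<noteq> 0) \<and>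
     (w$1 \<noteq> 0 \<or> w$3 \<noteq> 0) \<and> (wall 1 v w \<noteq> 0 \<or> wall 2 v w \<noteq> 0 \<or> minor12 v w \<noteq> 0)"

lemma distinct_pts_nonzero: "distinct_pts v w \<Longrightarrow> v \<noteq> 0 \<and> w \<noteq> 0"
  by (auto simp: distinct_pts_def)

lemma conf_in_config_space:
  assumes "v \<noteq> 0" "w \<noteq> 0"
  shows "conf v w \<in> config_space \<longleftrightarrow> distinct_pts v w"
proof -
  let ?e1 = "vector [1, 0, 0] :: real^3" and ?e2 = "vector [0, 1, 0] :: real^3"
  have e: "?e1 \<noteq> 0" "?e2 \<noteq> 0" by (auto simp: vec3_eq_0)
  have c1: "(\<exists>c. ?e1 = c *\<^sub>R u) \<longleftrightarrow> u$2 = 0 \<and> u$3 = 0" if "u \<noteq> 0" for u :: "real^3"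
    using that e by (subst proportional_iff) (auto simp: minor12_def)
  have c2: "(\<exists>c. ?e2 = c *\<^sub>R u) \<longleftrightarrow> u$1 = 0 \<and> u$3 = 0" if "u \<noteq> 0" for u :: "real^3"
    using that e by (subst proportional_iff) (auto simp: minor12_def)
  have i4: "inj f \<longleftrightarrow> f 1 \<noteq> f 2 \<and> f 1 \<noteq> f 3 \<and> f 1 \<noteq> f 4 \<and> f 2 \<noteq> f 3 \<and> f 2 \<noteq> f 4 \<and> f 3 \<noteq> f 4"
    for f :: "4 \<Rightarrow> rp2"
    unfolding inj_def forall_4 by auto
  have e12: "rp2_point ?e1 \<noteq> rp2_point ?e2"
    using e by (simp add: rp2_point_eq_iff c1)
  have "conf v w \<in> config_space \<longleftrightarrow> rp2_point ?e1 \<noteq> rp2_point v \<and> rp2_point ?e1 \<noteq> rp2_point w \<and>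
     rp2_point ?e2 \<noteq> rp2_point v \<and> rp2_point ?e2 \<noteq> rp2_point w \<and> rp2_point v \<noteq> rp2_point w"
    unfolding config_space_def mem_Collect_eq i4 using e12 by simp
  also have "\<dots> \<longleftrightarrow> distinct_pts v w"
    using assms e by (simp add: rp2_point_eq_iff c1 c2 proportional_iff distinct_pts_def) blast
  finally show ?thesis .
qed

abbreviation v3 :: "rp2^4 \<Rightarrow> real^3" where "v3 x \<equiv> rp2_rep (x $ 3)"
abbreviation v4 :: "rp2^4 \<Rightarrow> real^3" where "v4 x \<equiv> rp2_rep (x $ 4)"

lemma conf_rep: "x \<in> config_space \<Longrightarrow> conf (v3 x) (v4 x) = x"
  by (simp add: config_space_def vec_eq_iff forall_4)

lemma distinct_pts_rep: "x \<in> config_space \<Longrightarrow> distinct_pts (v3 x) (v4 x)"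
  using conf_rep conf_in_config_space[of "v3 x" "v4 x"] by simp

lemma scale_inv_conf:
  assumes "scale_inv F" "v \<noteq> 0" "w \<noteq> 0"
  shows "F (v3 (conf v w)) (v4 (conf v w)) = F v w"
proof -
  obtain c d where "c \<noteq> 0" "rp2_rep (rp2_point v) = c *\<^sub>R v" "d \<noteq> 0" "rp2_rep (rp2_point w) = d *\<^sub>R w"
    using rp2_rep_point[OF assms(2)] rp2_rep_point[OF assms(3)] by metis
  then show ?thesis using assms(1) by (simp add: scale_inv_def)
qed

definition region :: "(real^3 \<Rightarrow> real^3 \<Rightarrow> bool) \<Rightarrow> (rp2^4) set" where
  "region R = {x \<in> config_space. R (v3 x) (v4 x)}"

lemma region_subset: "region R \<subseteq> config_space"
  by (auto simp: region_def)

lemma conf_in_region: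
  assumes "scale_inv R" "distinct_pts v w"
  shows "conf v w \<in> region R \<longleftrightarrow> R v w"
  using scale_inv_conf[OF assms(1)] distinct_pts_nonzero[OF assms(2)] assms(2)
  by (simp add: region_def conf_in_config_space)

lemma region_cases:
  assumes "x \<in> region R"
  obtains v w where "distinct_pts v w" "R v w" "x = conf v w" "v = v3 x" "w = v4 x"
  using assms distinct_pts_rep conf_rep unfolding region_def by (metis (mono_tags, lifting) mem_Collect_eq)

lemma region_open:
  assumes "scale_inv R" "\<And>v w. distinct_pts v w \<Longrightarrow> R v w \<Longrightarrow> eventually (\<lambda>u. R (fst u) (snd u)) (nhds (v, w))"
    and x: "x \<in> region R"
  shows "eventually (\<lambda>y. y \<in> config_space \<longrightarrow> y \<in> region R) (nhds x)"
proof -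
  have "eventually (\<lambda>u. R (fst u) (snd u)) (nhds (v3 x, v4 x))"
    using x distinct_pts_rep by (intro assms(2)) (auto simp: region_def)
  then have "eventually (\<lambda>y. R (v3 y) (v4 y)) (nhds x)" by (rule eventually_rp2_lift[OF assms(1)])
  then show ?thesis by eventually_elim (simp add: region_def)
qed

lemma open_in_config_space:
  assumes "U \<subseteq> config_space" "\<And>x. x \<in> U \<Longrightarrow> eventually (\<lambda>y. y \<in> config_space \<longrightarrow> y \<in> U) (nhds x)"
  shows "\<exists>T. open T \<and> U = config_space \<inter> T"
proof -
  have "\<exists>S. open S \<and> x \<in> S \<and> config_space \<inter> S \<subseteq> U" if "x \<in> U" for x
    using assms(2)[OF that] unfolding eventually_nhds by blast
  then obtain S where S: "\<And>x. x \<in> U \<Longrightarrow> open (S x) \<and> x \<in> S x \<and> config_space \<inter> S x \<subseteq> U" by metis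
  show ?thesis
    by (rule exI[of _ "\<Union>(S ` U)"]) (use S assms(1) in blast)
qed

text \<open>\<open>F\<close> reads coordinates off homogeneous vectors, \<open>f\<close> and
  \<open>g\<close> rebuild vectors from coordinates. Rebuilding needs to be right only up to nonzero
  factors, which is what lets a region of configurations have a convex chart.\<close>

lemma region_simple_conn:
  fixes C :: "'c::real_normed_vector set" and F :: "real^3 \<Rightarrow> real^3 \<Rightarrow> 'c"
  assumes C: "convex C" and R: "scale_inv R" and F: "scale_inv F"
    and fg: "continuous_on C f" "continuous_on C g"
    and 1: "\<And>c. c \<in> C \<Longrightarrow> distinct_pts (f c) (g c) \<and> R (f c) (g c) \<and> F (f c) (g c) = c"
    and 2: "\<And>v w. distinct_pts v w \<Longrightarrow> R v w \<Longrightarrow> F v w \<in> C"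
    and 3: "\<And>v w. distinct_pts v w \<Longrightarrow> R v w \<Longrightarrow> \<exists>a b. a \<noteq> 0 \<and> b \<noteq> 0 \<and> v = a *\<^sub>R f (F v w) \<and> w = b *\<^sub>R g (F v w)"
    and 4: "\<And>v w. distinct_pts v w \<Longrightarrow> R v w \<Longrightarrow> ((\<lambda>u. F (fst u) (snd u)) \<longlongrightarrow> F v w) (nhds (v, w))"
  shows "simple_conn (region R)"
proof -
  let ?\<psi> = "\<lambda>c. conf (f c) (g c)" and ?\<kappa> = "\<lambda>x. F (v3 x) (v4 x)"
  have nz: "f c \<noteq> 0" "g c \<noteq> 0" if "c \<in> C" for c using 1[OF that] distinct_pts_nonzero by blast+
  have img: "?\<psi> ` C = region R"
  proof (intro subset_antisym subsetI)
    fix x assume "x \<in> ?\<psi> ` C"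
    then show "x \<in> region R" using 1 conf_in_region[OF R] by auto
  next
    fix x assume "x \<in> region R"
    then obtain v w where x: "distinct_pts v w" "R v w" "x = conf v w" by (rule region_cases)
    obtain a b where ab: "a \<noteq> 0" "b \<noteq> 0" "v = a *\<^sub>R f (F v w)" "w = b *\<^sub>R g (F v w)"
      using 3[OF x(1,2)] by blast
    have c: "F v w \<in> C" using 2 x by blast
    have "rp2_point v = rp2_point (f (F v w))" "rp2_point w = rp2_point (g (F v w))"
      using ab rp2_point_scaleR nz[OF c] by metis+
    then have "x = ?\<psi> (F v w)" unfolding x(3) by (simp add: vec_eq_iff forall_4)
    with c show "x \<in> ?\<psi> ` C" by blast
  qed
  have "simple_conn (?\<psi> ` C)"
  proof (rule simple_conn_chart[OF C, where \<kappa> = ?\<kappa>])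
    show "continuous_on C ?\<psi>" using fg nz by (intro continuous_on_conf)
    show "?\<kappa> (?\<psi> c) = c" if "c \<in> C" for c
      using scale_inv_conf[OF F nz[OF that]] 1[OF that] by simp
    show "continuous_on (?\<psi> ` C) ?\<kappa>"
      unfolding img continuous_on_def
    proof
      fix x assume x: "x \<in> region R"
      have "((\<lambda>u. F (fst u) (snd u)) \<longlongrightarrow> F (v3 x) (v4 x)) (nhds (v3 x, v4 x))"
        using x distinct_pts_rep by (intro 4) (auto simp: region_def)
      then have "(?\<kappa> \<longlongrightarrow> ?\<kappa> x) (nhds x)" by (rule tendsto_rp2_lift[OF F])
      then show "(?\<kappa> \<longlongrightarrow> ?\<kappa> x) (at x within region R)"
        by (rule filterlim_mono) (auto simp: at_within_def)
    qed
  qed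
  then show ?thesis unfolding img .
qed

text \<open>
  Unlike the signs of the determinants, those of the following products do not depend on the
  coordinates. The sign vectors of \<open>(sA, sB)\<close> index the four chambers; the star of a chamber and a
  wall consists of the chamber, the adjacent chamber and the part of the wall between them.
\<close>

definition sA where "sA v w = wall 1 v w * (v$3 * w$3)"
definition sB where "sB v w = wall 2 v w * (v$3 * w$3)"
definition sC where "sC v w = wall 1 v w * wall 2 v w"

fun chamber :: "bool \<times> bool \<Rightarrow> real^3 \<Rightarrow> real^3 \<Rightarrow> bool" where
  "chamber (a, b) v w \<longleftrightarrow> (\<forall>j. wall j v w \<noteq> 0) \<and> (sA v w > 0 \<longleftrightarrow> a) \<and> (sB v w > 0 \<longleftrightarrow> b)"

fun star :: "bool \<times> bool \<Rightarrow> 4 \<Rightarrow> real^3 \<Rightarrow> real^3 \<Rightarrow> bool" where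
  "star (a, b) i v w \<longleftrightarrow> (\<forall>j. j \<noteq> i \<longrightarrow> wall j v w \<noteq> 0) \<and>
     (if i = 1 then (sB v w > 0 \<longleftrightarrow> b) else if i = 2 then (sA v w > 0 \<longleftrightarrow> a)
      else (sC v w > 0 \<longleftrightarrow> (a \<longleftrightarrow> b)))"

text \<open>The cells are neighbourhoods of the configurations of four collinear points.\<close>

definition cell_slopes :: "bool \<times> bool \<times> bool \<Rightarrow> (real \<times> real) set" where
  "cell_slopes e = {(s, s'). (if fst e then 0 < s else s < 0) \<and> (if fst (snd e) then 0 < s' else s' < 0) \<and>
     (if snd (snd e) then 0 < s' - s else s' - s < 0)}"

definition cell :: "bool \<times> bool \<times> bool \<Rightarrow> real^3 \<Rightarrow> real^3 \<Rightarrow> bool" where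
  "cell e v w \<longleftrightarrow> v$1 \<noteq> 0 \<and> w$1 \<noteq> 0 \<and> (v$2 / v$1, w$2 / w$1) \<in> cell_slopes e"

lemma wchD:
  assumes "cell e v w"
  shows "v$1 \<noteq> 0" "w$1 \<noteq> 0" "v$2 \<noteq> 0" "w$2 \<noteq> 0" "minor12 v w \<noteq> 0" "(v$2 / v$1, w$2 / w$1) \<in> cell_slopes e"
proof -
  show *: "v$1 \<noteq> 0" "w$1 \<noteq> 0" and w: "(v$2 / v$1, w$2 / w$1) \<in> cell_slopes e"
    using assms by (auto simp: cell_def)
  have "v$2 / v$1 \<noteq> 0" "w$2 / w$1 \<noteq> 0" "w$2 / w$1 - v$2 / v$1 \<noteq> 0"
    using w by (auto simp: cell_slopes_def split: if_splits)
  with * show "v$2 \<noteq> 0" "w$2 \<noteq> 0" "minor12 v w \<noteq> 0" by (auto simp: minor12_def field_simps)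
qed

definition nonsing where "nonsing v w \<longleftrightarrow> (\<forall>j. wall j v w \<noteq> 0)"

lemma wall_scale: "wall i (c *\<^sub>R v) (d *\<^sub>R w) = (if i = 3 then d else if i = 4 then c else c * d) * wall i v w"
  using exhaust_4[of i] by (auto simp: algebra_simps)

lemma wall_scale_0: "c \<noteq> 0 \<Longrightarrow> d \<noteq> 0 \<Longrightarrow> wall i (c *\<^sub>R v) (d *\<^sub>R w) = 0 \<longleftrightarrow> wall i v w = 0"
  unfolding wall_scale by auto

lemma sABC_scale:
  "sA (c *\<^sub>R v) (d *\<^sub>R w) = (c * d)\<^sup>2 * sA v w" "sB (c *\<^sub>R v) (d *\<^sub>R w) = (c * d)\<^sup>2 * sB v w"
  "sC (c *\<^sub>R v) (d *\<^sub>R w) = (c * d)\<^sup>2 * sC v w"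
  by (simp_all add: sA_def sB_def sC_def power2_eq_square algebra_simps)

lemma sABC_scale_pos:
  assumes "c \<noteq> 0" "d \<noteq> 0"
  shows "sA (c *\<^sub>R v) (d *\<^sub>R w) > 0 \<longleftrightarrow> sA v w > 0" "sB (c *\<^sub>R v) (d *\<^sub>R w) > 0 \<longleftrightarrow> sB v w > 0"
    "sC (c *\<^sub>R v) (d *\<^sub>R w) > 0 \<longleftrightarrow> sC v w > 0"
  using assms unfolding sABC_scale by (auto simp: zero_less_mult_iff)

lemma scale_inv_nonsing: "scale_inv nonsing"
  by (simp add: scale_inv_def nonsing_def wall_scale_0)

lemma scale_inv_chamber: "scale_inv (chamber v)"
  by (cases v) (simp add: scale_inv_def wall_scale_0 sABC_scale_pos)

lemma scale_inv_star: "scale_inv (star v i)"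
  by (cases v) (simp add: scale_inv_def wall_scale_0 sABC_scale_pos)

lemma scale_inv_cell: "scale_inv (cell e)"
  by (simp add: scale_inv_def cell_def)

lemma star_distinct_pts: "star v i p q \<Longrightarrow> distinct_pts p q"
proof (cases v)
  case (Pair a b)
  assume "star v i p q"
  then have *: "i = 1 \<or> wall 1 p q \<noteq> 0" "i = 2 \<or> wall 2 p q \<noteq> 0" "i = 3 \<or> wall 3 p q \<noteq> 0" "i = 4 \<or> wall 4 p q \<noteq> 0"
    using Pair by auto
  then show ?thesis using exhaust_4[of i] by (auto simp: distinct_pts_def)
qed

lemma nonsing_distinct_pts: "nonsing v w \<Longrightarrow> distinct_pts v w"
  by (auto simp: nonsing_def forall_4 distinct_pts_def)

lemma cell_distinct_pts: "cell e v w \<Longrightarrow> distinct_pts v w"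
  using wchD[of e v w] by (auto simp: distinct_pts_def)

lemma star_iff:
  "star (a, b) 1 v w \<longleftrightarrow> wall 2 v w \<noteq> 0 \<and> w$3 \<noteq> 0 \<and> v$3 \<noteq> 0 \<and> (sB v w > 0 \<longleftrightarrow> b)"
  "star (a, b) 2 v w \<longleftrightarrow> wall 1 v w \<noteq> 0 \<and> w$3 \<noteq> 0 \<and> v$3 \<noteq> 0 \<and> (sA v w > 0 \<longleftrightarrow> a)"
  "star (a, b) 3 v w \<longleftrightarrow> wall 1 v w \<noteq> 0 \<and> wall 2 v w \<noteq> 0 \<and> v$3 \<noteq> 0 \<and> (sC v w > 0 \<longleftrightarrow> (a \<longleftrightarrow> b))"
  "star (a, b) 4 v w \<longleftrightarrow> wall 1 v w \<noteq> 0 \<and> wall 2 v w \<noteq> 0 \<and> w$3 \<noteq> 0 \<and> (sC v w > 0 \<longleftrightarrow> (a \<longleftrightarrow> b))"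
  by (auto simp: all4_neq)

declare star.simps [simp del]

lemma chamber_nonsing: "chamber v p q \<Longrightarrow> nonsing p q"
  by (cases v) (auto simp: nonsing_def)

section \<open>Convex charts of chambers, stars and cells\<close>

lemma convex_linear_sign:
  fixes l :: "'a::real_vector \<Rightarrow> real"
  assumes "linear l"
  shows "convex {z. if e then 0 < l z else l z < 0}"
proof -
  have "convex (l -` (if e then {0<..} else {..<0}))" by (intro convex_linear_vimage assms) auto
  moreover have "l -` (if e then {0<..} else {..<0}) = {z. if e then 0 < l z else l z < 0}" by auto
  ultimately show ?thesis by simp
qed

lemma tendsto_nhdsI: "isCont f x \<Longrightarrow> (f \<longlongrightarrow> f x) (nhds x)"
  by (simp add: tendsto_at_iff_tendsto_nhds isCont_def)

lemma continuous_on_vector3 [continuous_intros]: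
  fixes f g h :: "'a::topological_space \<Rightarrow> real"
  assumes "continuous_on S f" "continuous_on S g" "continuous_on S h"
  shows "continuous_on S (\<lambda>x. vector [f x, g x, h x] :: real^3)"
proof -
  have "(\<lambda>x. vector [f x, g x, h x] :: real^3) = (\<lambda>x. \<chi> i. if i = 1 then f x else if i = 2 then g x else h x)"
    by (simp add: fun_eq_iff vec_eq_iff forall_3)
  moreover have "continuous_on S (\<lambda>x. (\<chi> i. if i = 1 then f x else if i = 2 then g x else h x) :: real^3)"
  proof (rule continuous_on_vec_lambda)
    fix i :: 3
    show "continuous_on S (\<lambda>x. if i = 1 then f x else if i = 2 then g x else h x)"
      using assms by (cases "i = 1"; cases "i = 2") simp_all
  qed
  ultimately show ?thesis by (simp only:)
qed

text \<open>When neither \<open>x_3\<close> nor \<open>x_4\<close> lies on the line through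
  \<open>x_1\<close> and \<open>x_2\<close>, both can be normalized to last coordinate 1, and the
  other four coordinates form a global chart.\<close>

lemma simple_conn_affine:
  fixes e :: "bool" and S :: "(real \<times> real \<times> real \<times> real) set"
  assumes S: "convex S" and inv: "scale_inv R"
    and R: "\<And>v w. distinct_pts v w \<Longrightarrow> R v w \<Longrightarrow> v$3 \<noteq> 0 \<and> w$3 \<noteq> 0"
    and S1: "\<And>a b c d. (a, b, c, d) \<in> S \<longleftrightarrow> R (vector [a, b, 1]) (vector [c, d, 1])"
    and gd: "\<And>v w. R v w \<Longrightarrow> distinct_pts v w"
  shows "simple_conn (region R)"
proof -
  have eq: "v = v$3 *\<^sub>R vector [v$1/v$3, v$2/v$3, 1]" if "v$3 \<noteq> 0" for v :: "real^3"
    using that by (simp add: vec_eq_iff forall_3)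
  show ?thesis
proof (rule region_simple_conn[OF S inv, where F = "\<lambda>v w. (v$1/v$3, v$2/v$3, w$1/w$3, w$2/w$3)"
      and f = "\<lambda>(a, b, c, d). vector [a, b, 1]" and g = "\<lambda>(a, b, c, d). vector [c, d, 1]"], goal_cases)
  case 1 show ?case by (simp add: scale_inv_def)
next
  case 2 show ?case unfolding case_prod_beta by (intro continuous_intros)
next
  case 3 show ?case unfolding case_prod_beta by (intro continuous_intros)
next
  case (4 c) then show ?case by (cases c) (auto simp: S1 gd)
next
  case (5 v w)
  have "R (v$3 *\<^sub>R vector [v$1/v$3, v$2/v$3, 1]) (w$3 *\<^sub>R vector [w$1/w$3, w$2/w$3, 1])"
    using 5 eq[of v] eq[of w] R[OF 5] by simp
  then show ?case using inv R[OF 5] unfolding S1 scale_inv_def by simp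
next
  case (6 v w)
  then show ?case
    using R[OF 6] eq[of v] eq[of w] by (intro exI[of _ "v$3"] exI[of _ "w$3"]) simp
next
  case (7 v w)
  have "isCont (\<lambda>u :: (real^3) \<times> (real^3). (fst u$1/fst u$3, fst u$2/fst u$3, snd u$1/snd u$3, snd u$2/snd u$3)) (v, w)"
    using R[OF 7] by (intro continuous_intros) auto
  from tendsto_nhdsI[OF this] show ?case by simp
qed
qed

text \<open>For \<open>x_3 = (a : b : 1)\<close> and \<open>x_4 = (c : d : 1)\<close> the values of
  \<open>sA\<close> and \<open>sB\<close> are \<open>a - c\<close> and \<open>b - d\<close>, so a
  chamber is the intersection of two half-spaces.\<close>

lemma simple_conn_chamber: "simple_conn (region (chamber v))"
proof (cases v)
  case (Pair a b)
  show ?thesis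
  proof (rule simple_conn_affine[OF _ scale_inv_chamber])
    have l: "linear (\<lambda>(a, b, c, d). a - c :: real)" "linear (\<lambda>(a, b, c, d). b - d :: real)"
      by (auto intro!: linearI simp: algebra_simps)
    show "convex ({z. if a then 0 < (\<lambda>(a, b, c, d). a - c :: real) z else (\<lambda>(a, b, c, d). a - c :: real) z < 0} \<inter>
        {z. if b then 0 < (\<lambda>(a, b, c, d). b - d :: real) z else (\<lambda>(a, b, c, d). b - d :: real) z < 0})"
      by (rule convex_Int[OF convex_linear_sign[OF l(1)] convex_linear_sign[OF l(2)]])
  qed (use chamber_nonsing nonsing_distinct_pts in \<open>auto simp: Pair forall_4 sA_def sB_def\<close>)
qed

lemma simple_conn_star1: "simple_conn (region (star v 1))"
proof (cases v)
  case (Pair a b)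
  show ?thesis
  proof (rule simple_conn_affine[OF _ scale_inv_star])
    have l: "linear (\<lambda>(a, b, c, d). b - d :: real)"
      by (auto intro!: linearI simp: algebra_simps)
    show "convex {z. if b then 0 < (\<lambda>(a, b, c, d). b - d :: real) z else (\<lambda>(a, b, c, d). b - d :: real) z < 0}"
      by (rule convex_linear_sign[OF l])
  next
    show "star v 1 p q \<Longrightarrow> distinct_pts p q" for p q by (rule star_distinct_pts)
  qed (auto simp: Pair star_iff sB_def)
qed

lemma simple_conn_star2: "simple_conn (region (star v 2))"
proof (cases v)
  case (Pair a b)
  show ?thesis
  proof (rule simple_conn_affine[OF _ scale_inv_star])
    have l: "linear (\<lambda>(a, b, c, d). a - c :: real)"
      by (auto intro!: linearI simp: algebra_simps)
    show "convex {z. if a then 0 < (\<lambda>(a, b, c, d). a - c :: real) z else (\<lambda>(a, b, c, d). a - c :: real) z < 0}"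
      by (rule convex_linear_sign[OF l])
  next
    show "star v 2 p q \<Longrightarrow> distinct_pts p q" for p q by (rule star_distinct_pts)
  qed (auto simp: Pair star_iff sA_def)
qed

lemma sign_quotient:
  fixes x y :: real
  assumes "x \<noteq> 0" "y \<noteq> 0" "x * y > 0 \<longleftrightarrow> P"
  shows "if P then 0 < y / x else y / x < 0"
  using assms by (auto simp: zero_less_mult_iff zero_less_divide_iff divide_less_0_iff linorder_neq_iff)

lemma linear_coords:
  "linear (\<lambda>(a, b, c, d). a :: real)" "linear (\<lambda>(a, b, c, d). b :: real)" "linear (\<lambda>(a, b, c, d). c :: real)"
  "linear (\<lambda>(a, b, c, d). c - a :: real)"
  by (auto intro!: linearI simp: algebra_simps)

text \<open>
  Coordinates in which the star of the wall at infinity of \<open>x\<^sub>4\<close> is convex: \<open>x\<^sub>3 = (a : b : 1)\<close>,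
  and \<open>x\<^sub>4\<close> is \<open>(1 : s : q)\<close> seen from \<open>x\<^sub>3\<close>.
\<close>

lemma simple_conn_star3: "simple_conn (region (star v 3))"
proof (cases v)
  case (Pair a b)
  let ?C = "{z. if a = b then 0 < (\<lambda>(a, b, c, d). c :: real) z else (\<lambda>(a, b, c, d). c :: real) z < 0}
     :: (real \<times> real \<times> real \<times> real) set"
  have C: "convex ?C" by (rule convex_linear_sign[OF linear_coords(3)])
  show ?thesis
  proof (rule region_simple_conn[OF C scale_inv_star,
      where F = "\<lambda>v w. (v$1/v$3, v$2/v$3, wall 2 v w/wall 1 v w, - (v$3 * w$3/wall 1 v w))"
      and f = "\<lambda>(a, b, s, q). vector [a, b, 1]" and g = "\<lambda>(a, b, s, q). vector [1 + q*a, s + q*b, q]"], goal_cases)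
    case 1 show ?case unfolding scale_inv_def wall_scale by (simp del: wall_simps)
  next
    case 2 show ?case unfolding case_prod_beta by (intro continuous_intros)
  next
    case 3 show ?case unfolding case_prod_beta by (intro continuous_intros)
  next
    case (4 c)
    obtain a' b' s q where c: "c = (a', b', s, q)" by (cases c)
    show ?case
      using 4 unfolding c by (cases "a = b") (auto simp: Pair star_iff sC_def distinct_pts_def algebra_simps)
  next
    case (5 v w)
    then show ?case
      using sign_quotient[of "wall 1 v w" "wall 2 v w" "a = b"] unfolding Pair star_iff sC_def by (simp del: wall_simps)
  next
    case (6 v w)
    then have nz: "v$3 \<noteq> 0" "wall 1 v w \<noteq> 0" unfolding Pair by (auto simp: star_iff)
    have 2: "w$2 = - (wall 1 v w/v$3) * (wall 2 v w/wall 1 v w - v$3 * w$3/wall 1 v w * (v$2/v$3))"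
      using nz by (simp add: divide_simps)
    have 1: "w$1 = - (wall 1 v w/v$3) * (1 - v$3 * w$3/wall 1 v w * (v$1/v$3))"
      using nz by (simp add: divide_simps)
    show ?case
      using nz 1 2 by (intro exI[of _ "v$3"] exI[of _ "- (wall 1 v w/v$3)"]) (simp add: vec_eq_iff forall_3 del: wall_simps)
  next
    case (7 v w)
    then have nz: "v$3 \<noteq> 0" "v$1 * w$3 - v$3 * w$1 \<noteq> 0" unfolding Pair by (auto simp: star_iff)
    have "isCont (\<lambda>u :: (real^3) \<times> (real^3). (fst u$1/fst u$3, fst u$2/fst u$3, wall 2 (fst u) (snd u)/wall 1 (fst u) (snd u),
        - (fst u$3 * snd u$3/wall 1 (fst u) (snd u)))) (v, w)"
      unfolding wall_simps using nz by (intro continuous_intros) auto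
    from tendsto_nhdsI[OF this] show ?case by simp
  qed
qed

text \<open>The chart of the third wall with the two moving points exchanged: \<open>s\<close> is
  the slope of the line joining them, and the wall is \<open>p = 0\<close>.\<close>

lemma simple_conn_star4: "simple_conn (region (star v 4))"
proof (cases v)
  case (Pair a b)
  let ?C = "{z. if a = b then 0 < (\<lambda>(a, b, c, d). c :: real) z else (\<lambda>(a, b, c, d). c :: real) z < 0}
     :: (real \<times> real \<times> real \<times> real) set"
  have C: "convex ?C" by (rule convex_linear_sign[OF linear_coords(3)])
  show ?thesis
  proof (rule region_simple_conn[OF C scale_inv_star,
      where F = "\<lambda>v w. (w$1/w$3, w$2/w$3, wall 2 v w/wall 1 v w, v$3 * w$3/wall 1 v w)"
      and g = "\<lambda>(c, d, s, p). vector [c, d, 1]" and f = "\<lambda>(c, d, s, p). vector [1 + p*c, s + p*d, p]"], goal_cases)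
    case 1 show ?case unfolding scale_inv_def wall_scale by (simp del: wall_simps)
  next
    case 2 show ?case unfolding case_prod_beta by (intro continuous_intros)
  next
    case 3 show ?case unfolding case_prod_beta by (intro continuous_intros)
  next
    case (4 c)
    obtain a' b' s q where c: "c = (a', b', s, q)" by (cases c)
    show ?case
      using 4 unfolding c by (cases "a = b") (auto simp: Pair star_iff sC_def distinct_pts_def algebra_simps)
  next
    case (5 v w)
    then show ?case
      using sign_quotient[of "wall 1 v w" "wall 2 v w" "a = b"] unfolding Pair star_iff sC_def by (simp del: wall_simps)
  next
    case (6 v w)
    then have nz: "w$3 \<noteq> 0" "wall 1 v w \<noteq> 0" unfolding Pair by (auto simp: star_iff)
    have 2: "v$2 = (wall 1 v w/w$3) * (wall 2 v w/wall 1 v w + v$3 * w$3/wall 1 v w * (w$2/w$3))"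
      using nz by (simp add: divide_simps)
    have 1: "v$1 = (wall 1 v w/w$3) * (1 + v$3 * w$3/wall 1 v w * (w$1/w$3))"
      using nz by (simp add: divide_simps)
    show ?case
      using nz 1 2 by (intro exI[of _ "wall 1 v w/w$3"] exI[of _ "w$3"]) (simp add: vec_eq_iff forall_3 del: wall_simps)
  next
    case (7 v w)
    then have nz: "w$3 \<noteq> 0" "v$1 * w$3 - v$3 * w$1 \<noteq> 0" unfolding Pair by (auto simp: star_iff)
    have "isCont (\<lambda>u :: (real^3) \<times> (real^3). (snd u$1/snd u$3, snd u$2/snd u$3, wall 2 (fst u) (snd u)/wall 1 (fst u) (snd u),
        fst u$3 * snd u$3/wall 1 (fst u) (snd u))) (v, w)"
      unfolding wall_simps using nz by (intro continuous_intros) auto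
    from tendsto_nhdsI[OF this] show ?case by simp
  qed
qed

lemma simple_conn_star: "simple_conn (region (star v i))"
  using exhaust_4[of i] simple_conn_star1 simple_conn_star2 simple_conn_star3 simple_conn_star4 by metis

lemma convex_cell_slopes: "convex (cell_slopes e)"
proof -
  have l: "linear (\<lambda>(a, b). a :: real)" "linear (\<lambda>(a, b). b :: real)" "linear (\<lambda>(a, b). b - a :: real)"
    by (auto intro!: linearI simp: algebra_simps)
  have "cell_slopes e = {z. if fst e then 0 < (\<lambda>(a, b). a :: real) z else (\<lambda>(a, b). a :: real) z < 0} \<inter>
     ({z. if fst (snd e) then 0 < (\<lambda>(a, b). b :: real) z else (\<lambda>(a, b). b :: real) z < 0} \<inter>
      {z. if snd (snd e) then 0 < (\<lambda>(a, b). b - a :: real) z else (\<lambda>(a, b). b - a :: real) z < 0})"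
    by (auto simp: cell_slopes_def)
  then show ?thesis
    using convex_Int[OF convex_linear_sign[OF l(1), of "fst e"] convex_Int[OF
        convex_linear_sign[OF l(2), of "fst (snd e)"] convex_linear_sign[OF l(3), of "snd (snd e)"]]]
    by (simp only:)
qed

text \<open>The first pair consists of the slopes, the second of the heights over the line through
  \<open>x_1\<close> and \<open>x_2\<close>; all four points are collinear when both heights
  vanish.\<close>

definition cell_pt :: "(real \<times> real) \<times> (real \<times> real) \<Rightarrow> rp2^4" where
  "cell_pt z = conf (vector [1, fst (fst z), fst (snd z)]) (vector [1, snd (fst z), snd (snd z)])"

lemma cell_vector:
  "cell e (vector [1, s, p]) (vector [1, s', q]) \<longleftrightarrow> (s, s') \<in> cell_slopes e"
  by (simp add: cell_def)

lemma simple_conn_cell: "simple_conn (region (cell e))"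
proof -
  have C: "convex (cell_slopes e \<times> (UNIV :: (real \<times> real) set))" by (intro convex_Times convex_cell_slopes convex_UNIV)
  show ?thesis
  proof (rule region_simple_conn[OF C scale_inv_cell,
      where F = "\<lambda>v w. ((v$2/v$1, w$2/w$1), (v$3/v$1, w$3/w$1))"
      and f = "\<lambda>z. vector [1, fst (fst z), fst (snd z)]" and g = "\<lambda>z. vector [1, snd (fst z), snd (snd z)]"], goal_cases)
    case 1 show ?case by (simp add: scale_inv_def)
  next
    case 2 show ?case by (intro continuous_intros)
  next
    case 3 show ?case by (intro continuous_intros)
  next
    case (4 c)
    then have "cell e (vector [1, fst (fst c), fst (snd c)]) (vector [1, snd (fst c), snd (snd c)])"
      unfolding cell_vector by auto
    then show ?case using cell_distinct_pts by auto
  next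
    case (5 v w)
    then show ?case using wchD(6) by auto
  next
    case (6 v w)
    then show ?case
      using wchD[OF 6(2)] by (intro exI[of _ "v$1"] exI[of _ "w$1"]) (auto simp: vec_eq_iff forall_3)
  next
    case (7 v w)
    then have nz: "v$1 \<noteq> 0" "w$1 \<noteq> 0" using wchD by blast+
    have "isCont (\<lambda>u :: (real^3) \<times> (real^3). ((fst u$2/fst u$1, snd u$2/snd u$1), (fst u$3/fst u$1, snd u$3/snd u$1))) (v, w)"
      using nz by (intro continuous_intros) auto
    from tendsto_nhdsI[OF this] show ?case by simp
  qed
qed

section \<open>Openness of the pieces and density of the nonsingular configurations\<close>

lemma tendsto_wall: "((\<lambda>u. wall i (fst u) (snd u)) \<longlongrightarrow> wall i v w) (nhds (v, w))"
proof -
  have "isCont (\<lambda>u. wall i (fst u) (snd u)) (v, w)"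
    using exhaust_4[of i] by (auto intro!: continuous_intros)
  from tendsto_nhdsI[OF this] show ?thesis by simp
qed

lemma tendsto_sABC:
  "((\<lambda>u. sA (fst u) (snd u)) \<longlongrightarrow> sA v w) (nhds (v, w))"
  "((\<lambda>u. sB (fst u) (snd u)) \<longlongrightarrow> sB v w) (nhds (v, w))"
  "((\<lambda>u. sC (fst u) (snd u)) \<longlongrightarrow> sC v w) (nhds (v, w))"
proof -
  have "isCont (\<lambda>u. sA (fst u) (snd u)) (v, w)" "isCont (\<lambda>u. sB (fst u) (snd u)) (v, w)"
    "isCont (\<lambda>u. sC (fst u) (snd u)) (v, w)"
    unfolding sA_def sB_def sC_def wall_simps by (intro continuous_intros)+
  then show "((\<lambda>u. sA (fst u) (snd u)) \<longlongrightarrow> sA v w) (nhds (v, w))"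
    "((\<lambda>u. sB (fst u) (snd u)) \<longlongrightarrow> sB v w) (nhds (v, w))"
    "((\<lambda>u. sC (fst u) (snd u)) \<longlongrightarrow> sC v w) (nhds (v, w))"
    using tendsto_nhdsI by fastforce+
qed

lemma eventually_nonzero:
  fixes f :: "'a \<Rightarrow> real"
  shows "(f \<longlongrightarrow> l) F \<Longrightarrow> l \<noteq> 0 \<Longrightarrow> eventually (\<lambda>u. f u \<noteq> 0) F"
  using tendsto_imp_eventually_ne by blast

lemma eventually_pos_iff:
  fixes f :: "'a \<Rightarrow> real"
  assumes "(f \<longlongrightarrow> l) F" "l \<noteq> 0"
  shows "eventually (\<lambda>u. f u > 0 \<longleftrightarrow> l > 0) F"
proof (cases "l > 0")
  case True
  then have "eventually (\<lambda>u. f u > 0) F" using assms(1) order_tendstoD(1) by blast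
  then show ?thesis using True by (auto elim: eventually_mono)
next
  case False
  then have "eventually (\<lambda>u. f u < 0) F" using assms order_tendstoD(2)[of f l F 0] by simp
  then show ?thesis using False by (auto elim!: eventually_mono)
qed

lemma star_sign_nonzero:
  assumes "star (a, b) i v w"
  shows "(if i = 1 then sB v w else if i = 2 then sA v w else sC v w) \<noteq> 0"
  using assms exhaust_4[of i] by (auto simp: star_iff sA_def sB_def sC_def)

lemma eventually_star:
  assumes "star v i p q"
  shows "eventually (\<lambda>u. star v i (fst u) (snd u)) (nhds (p, q))"
proof (cases v)
  case (Pair a b)
  have nz: "eventually (\<lambda>u. j \<noteq> i \<longrightarrow> wall j (fst u) (snd u) \<noteq> 0) (nhds (p, q))" for j
    using assms eventually_nonzero[OF tendsto_wall, of j p q] unfolding Pair star.simps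
    by (cases "j = i") (auto elim: eventually_mono)
  have t: "((\<lambda>u. if i = 1 then sB (fst u) (snd u) else if i = 2 then sA (fst u) (snd u) else sC (fst u) (snd u))
     \<longlongrightarrow> (if i = 1 then sB p q else if i = 2 then sA p q else sC p q)) (nhds (p, q))"
    using tendsto_sABC by simp
  have ev: "eventually (\<lambda>u. (if i = 1 then sB (fst u) (snd u) else if i = 2 then sA (fst u) (snd u) else sC (fst u) (snd u)) > 0
     \<longleftrightarrow> (if i = 1 then sB p q else if i = 2 then sA p q else sC p q) > 0) (nhds (p, q))"
    by (rule eventually_pos_iff[OF t star_sign_nonzero[OF assms[unfolded Pair]]])
  show ?thesis
    using ev nz[of 1] nz[of 2] nz[of 3] nz[of 4]
  proof eventually_elim
    case (elim u)
    then have "\<forall>j. j \<noteq> i \<longrightarrow> wall j (fst u) (snd u) \<noteq> 0" unfolding forall_4 by blast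
    with elim(1) assms show ?case unfolding Pair star.simps by (simp split: if_splits)
  qed
qed

lemma open_cell_slopes: "open (cell_slopes e)"
proof -
  have "cell_slopes e = ((if fst e then {0<..} else {..<0}) \<times> (if fst (snd e) then {0<..} else {..<0})) \<inter>
    (\<lambda>z. snd z - fst z) -` (if snd (snd e) then {0<..} else {..<0})"
    by (auto simp: cell_slopes_def)
  also have "open \<dots>"
    by (intro open_Int open_Times open_vimage) (auto intro!: continuous_intros)
  finally show ?thesis .
qed

lemma eventually_cell:
  assumes "cell e v w"
  shows "eventually (\<lambda>u. cell e (fst u) (snd u)) (nhds (v, w))"
proof -
  note nz = wchD(1,2)[OF assms]
  have "isCont (\<lambda>u :: (real^3) \<times> (real^3). (fst u$2/fst u$1, snd u$2/snd u$1)) (v, w)"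
    using nz by (intro continuous_intros) auto
  from topological_tendstoD[OF tendsto_nhdsI[OF this] open_cell_slopes, of e]
  have 1: "eventually (\<lambda>u :: (real^3) \<times> (real^3). (fst u$2/fst u$1, snd u$2/snd u$1) \<in> cell_slopes e) (nhds (v, w))"
    using wchD(6)[OF assms] by simp
  have "isCont (\<lambda>u :: (real^3) \<times> (real^3). fst u$1) (v, w)" "isCont (\<lambda>u :: (real^3) \<times> (real^3). snd u$1) (v, w)"
    by (intro continuous_intros)+
  from eventually_nonzero[OF tendsto_nhdsI[OF this(1)]] eventually_nonzero[OF tendsto_nhdsI[OF this(2)]]
  have "eventually (\<lambda>u :: (real^3) \<times> (real^3). fst u$1 \<noteq> 0) (nhds (v, w))"
    "eventually (\<lambda>u :: (real^3) \<times> (real^3). snd u$1 \<noteq> 0) (nhds (v, w))" using nz by auto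
  with 1 show ?thesis by eventually_elim (simp add: cell_def)
qed

lemma quadratic_eventually_nonzero:
  fixes A B C :: real
  assumes "A \<noteq> 0 \<or> B \<noteq> 0 \<or> C \<noteq> 0"
  shows "eventually (\<lambda>t. A + B * t + C * t\<^sup>2 \<noteq> 0) (at_right 0)"
proof -
  have fin: "finite {t. poly [:A, B, C:] t = 0}"
    using assms by (intro poly_roots_finite) auto
  have "open (- ({t. poly [:A, B, C:] t = 0} - {0}))"
    using fin by (intro open_Compl finite_imp_closed) simp
  from eventually_nhds_in_open[OF this, of 0]
  have "eventually (\<lambda>t. t \<notin> {t. poly [:A, B, C:] t = 0} - {0}) (at_right 0)"
    unfolding eventually_at_filter by (auto elim: eventually_mono)
  moreover have "eventually (\<lambda>t. t > (0::real)) (at_right 0)" by (rule eventually_at_right_less)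
  ultimately show ?thesis
    by eventually_elim (auto simp: power2_eq_square algebra_simps)
qed

text \<open>Moving toward the coordinates of the base configuration turns each wall into a
  polynomial in \<open>t\<close>. Its top coefficient is the value of the wall at that nonsingular
  configuration, -1 for the walls 1 and 2 and 1 for the other two, so no wall vanishes
  identically.\<close>

lemma eventually_nonsing_toward_base:
  "eventually (\<lambda>t. nonsing (v + t *\<^sub>R vector [0, 0, 1]) (w + t *\<^sub>R vector [1, 1, 1])) (at_right 0)"
proof -
  have *: "eventually (\<lambda>t. (v$1 * w$3 - v$3 * w$1) + (v$1 - v$3 - w$1) * t + (-1) * t\<^sup>2 \<noteq> 0) (at_right 0)"
    "eventually (\<lambda>t. (v$2 * w$3 - v$3 * w$2) + (v$2 - v$3 - w$2) * t + (-1) * t\<^sup>2 \<noteq> 0) (at_right 0)"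
    "eventually (\<lambda>t. w$3 + 1 * t + 0 * t\<^sup>2 \<noteq> 0) (at_right 0)"
    "eventually (\<lambda>t. v$3 + 1 * t + 0 * t\<^sup>2 \<noteq> 0) (at_right 0)"
    by (rule quadratic_eventually_nonzero, simp)+
  then show ?thesis
    by eventually_elim (simp add: nonsing_def forall_4 power2_eq_square algebra_simps)
qed

text \<open>The motion toward the base configuration leaves all walls at once, even from a collinear
  quadruple. A short initial piece stays in the open set \<open>U\<close>; traversed backwards it is
  the path sought.\<close>

lemma nonsingular_nearby:
  assumes "x \<in> config_space" "eventually (\<lambda>y. y \<in> config_space \<longrightarrow> y \<in> U) (nhds x)"
  obtains y p where "y \<in> region nonsing" "path_in U y x p"
proof -
  let ?v = "\<lambda>t. v3 x + t *\<^sub>R vector [0, 0, 1]" and ?w = "\<lambda>t. v4 x + t *\<^sub>R vector [1, 1, 1]"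
  obtain S where S: "open S" "x \<in> S" "\<And>y. y \<in> S \<Longrightarrow> y \<in> config_space \<Longrightarrow> y \<in> U"
    using assms(2) unfolding eventually_nhds by blast
  obtain r where r: "r > 0" "\<And>t. 0 < t \<Longrightarrow> t < r \<Longrightarrow> nonsing (?v t) (?w t)"
    using eventually_nonsing_toward_base[of "v3 x" "v4 x"] unfolding eventually_at_right_field by auto
  have gd: "distinct_pts (?v t) (?w t)" if "0 \<le> t" "t < r" for t
  proof (cases "t = 0")
    case True then show ?thesis using distinct_pts_rep[OF assms(1)] by simp
  next
    case False then show ?thesis using r(2)[of t] that nonsing_distinct_pts by auto
  qed
  have cont: "continuous_on {0..<r} (\<lambda>t. conf (?v t) (?w t))"
    using gd distinct_pts_nonzero by (intro continuous_on_conf continuous_intros) auto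
  have c0: "conf (?v 0) (?w 0) = x" using conf_rep[OF assms(1)] by simp
  have "((\<lambda>t. conf (?v t) (?w t)) \<longlongrightarrow> conf (?v 0) (?w 0)) (at 0 within {0..<r})"
    using cont r(1) unfolding continuous_on_def by (elim bspec) simp
  from topological_tendstoD[OF this S(1)] have "eventually (\<lambda>t. conf (?v t) (?w t) \<in> S) (at 0 within {0..<r})"
    using S(2) c0 by metis
  then obtain d where d: "d > 0" "\<And>t. t \<in> {0..<r} \<Longrightarrow> t \<noteq> 0 \<Longrightarrow> dist t 0 < d \<Longrightarrow> conf (?v t) (?w t) \<in> S"
    unfolding eventually_at by blast
  define e where "e = min (r/2) (d/2)"
  have e: "0 < e" "e < r" "e < d" using r(1) d(1) by (auto simp: e_def)
  have inU: "conf (?v t) (?w t) \<in> U" if "0 \<le> t" "t \<le> e" for t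
  proof (rule S(3))
    show "conf (?v t) (?w t) \<in> S"
      using d(2)[of t] that e S(2) c0 by (cases "t = 0") auto
    have "distinct_pts (?v t) (?w t)" using that e gd by simp
    then show "conf (?v t) (?w t) \<in> config_space" using distinct_pts_nonzero by (simp add: conf_in_config_space)
  qed
  let ?p = "\<lambda>s. conf (?v (e * (1 - s))) (?w (e * (1 - s)))"
  have im: "0 \<le> e * (1 - s)" "e * (1 - s) \<le> e" if "s \<in> {0..1}" for s :: real
    using that e(1) mult_left_le[of "1 - s" e] by auto
  have "continuous_on {0..1} ((\<lambda>t. conf (?v t) (?w t)) \<circ> (\<lambda>s. e * (1 - s)))"
  proof (rule continuous_on_compose)
    show "continuous_on ((\<lambda>s. e * (1 - s)) ` {0..1}) (\<lambda>t. conf (?v t) (?w t))"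
    proof (rule continuous_on_subset[OF cont], rule image_subsetI)
      fix s :: real assume "s \<in> {0..1}"
      from im[OF this] e show "e * (1 - s) \<in> {0..<r}" by (meson atLeastLessThan_iff le_less_trans)
    qed
  qed (intro continuous_intros)
  then have "path_in U (conf (?v e) (?w e)) x ?p"
    using inU im c0 by (auto simp: path_in_def path_def path_image_def pathstart_def pathfinish_def comp_def)
  moreover have "conf (?v e) (?w e) \<in> region nonsing"
    using conf_in_region[OF scale_inv_nonsing nonsing_distinct_pts] r(2)[of e] e by simp
  ultimately show thesis by (rule that[rotated])
qed

text \<open>The products of \<open>minor12\<close> with \<open>v$3\<close> and with
  \<open>w$3\<close> are combinations of the walls 1 and 2. If both of these vanish at distinct
  points, \<open>minor12\<close> does not, and the last coordinates must be zero. The remaining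
  pairs of walls follow directly from distinctness.\<close>

lemma two_walls:
  assumes g: "distinct_pts v w" and ij: "wall i v w = 0" "wall j v w = 0" "i \<noteq> j"
  shows "v$3 = 0 \<and> w$3 = 0"
proof -
  consider "wall 1 v w = 0" "wall 2 v w = 0" | "w$3 = 0" "wall 1 v w = 0 \<or> wall 2 v w = 0"
    | "v$3 = 0" "wall 1 v w = 0 \<or> wall 2 v w = 0" | "v$3 = 0" "w$3 = 0"
    using ij exhaust_4[of i] exhaust_4[of j] by auto
  then show ?thesis
  proof cases
    case 1
    then have e: "v$1 * w$3 = v$3 * w$1" "v$2 * w$3 = v$3 * w$2" "minor12 v w \<noteq> 0" using g by (auto simp: distinct_pts_def)
    have "minor12 v w * v$3 = v$1 * (v$3 * w$2) - v$2 * (v$3 * w$1)" by (simp add: minor12_def algebra_simps)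
    also have "\<dots> = 0" unfolding e(1,2)[symmetric] by simp
    finally have 3: "v$3 = 0" using e(3) by simp
    have "minor12 v w * w$3 = (v$1 * w$3) * w$2 - (v$2 * w$3) * w$1" by (simp add: minor12_def algebra_simps)
    also have "\<dots> = 0" unfolding e(1,2) by simp
    finally show ?thesis using e(3) 3 by simp
  qed (use g in \<open>auto simp: distinct_pts_def\<close>)
qed

lemma star_exists_at:
  assumes "\<And>j. j \<noteq> i \<Longrightarrow> wall j v w \<noteq> 0"
  shows "\<exists>u. star u i v w"
proof -
  define u where "u = (if i = 1 then (True, sB v w > 0) else if i = 2 then (sA v w > 0, True)
    else (sC v w > 0, True))"
  have "star u i v w"
    using assms by (cases "i = 1"; cases "i = 2") (auto simp: u_def star.simps)
  then show ?thesis by blast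
qed

lemma star_exists: "distinct_pts v w \<Longrightarrow> v$3 \<noteq> 0 \<or> w$3 \<noteq> 0 \<Longrightarrow> \<exists>u i. star u i v w"
  using two_walls[of v w] star_exists_at[of _ v w] by metis

lemma star_not_both:
  assumes "star u i v w" shows "v$3 \<noteq> 0 \<or> w$3 \<noteq> 0"
  using assms exhaust_4[of i] by (cases u) (auto simp: star_iff)

text \<open>The stars miss only configurations with both points on the line through
  \<open>x_1\<close> and \<open>x_2\<close>. There distinctness makes the two slopes finite, nonzero
  and different, which selects a cell.\<close>

lemma config_space_cover:
  assumes "x \<in> config_space"
  shows "(\<exists>v i. x \<in> region (star v i)) \<or> (\<exists>e. x \<in> region (cell e))"
proof -
  let ?v = "v3 x" and ?w = "v4 x"
  have g: "distinct_pts ?v ?w" by (rule distinct_pts_rep[OF assms])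
  show ?thesis
  proof (cases "?v$3 \<noteq> 0 \<or> ?w$3 \<noteq> 0")
    case True
    then show ?thesis using star_exists[OF g] assms unfolding region_def by blast
  next
    case False
    then have nz: "?v$1 \<noteq> 0" "?v$2 \<noteq> 0" "?w$1 \<noteq> 0" "?w$2 \<noteq> 0" "minor12 ?v ?w \<noteq> 0" using g by (auto simp: distinct_pts_def)
    have *: "(s, s') \<in> cell_slopes (s > 0, s' > 0, s' - s > 0)" if "s \<noteq> 0" "s' \<noteq> 0" "s' - s \<noteq> 0" for s s'
      using that by (auto simp: cell_slopes_def)
    have "?w$2/?w$1 - ?v$2/?v$1 \<noteq> 0" "?v$2/?v$1 \<noteq> 0" "?w$2/?w$1 \<noteq> 0" using nz by (auto simp: minor12_def field_simps)
    from *[OF this(2,3,1)] have "\<exists>e. cell e ?v ?w" using nz unfolding cell_def by blast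
    then show ?thesis using assms unfolding region_def by blast
  qed
qed

lemma cell_pt_distinct_pts: "(fst z) \<in> cell_slopes e \<Longrightarrow> distinct_pts (vector [1, fst (fst z), fst (snd z)]) (vector [1, snd (fst z), snd (snd z)])"
  by (rule cell_distinct_pts[of e]) (simp add: cell_vector)

lemma cell_pt_in_cell: "fst z \<in> cell_slopes e \<Longrightarrow> cell_pt z \<in> region (cell e)"
  unfolding cell_pt_def using cell_pt_distinct_pts conf_in_region[OF scale_inv_cell] by (simp add: cell_vector)

lemma conf_eqI:
  assumes "a \<noteq> 0" "b \<noteq> 0" "v = a *\<^sub>R v'" "w = b *\<^sub>R w'" "v' \<noteq> 0" "w' \<noteq> 0"
  shows "conf v w = conf v' w'"
  proof -
  have "rp2_point v = rp2_point v'" "rp2_point w = rp2_point w'"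
    unfolding assms(3,4) using assms by (simp_all add: rp2_point_scaleR)
  then show ?thesis by (simp only: conf_def)
qed

text \<open>In the chart of the cell the stars leave out only the pair of heights
  \<open>(0, 0)\<close>. A punctured plane times a convex set is still path connected: the omitted
  stratum has codimension two.\<close>

lemma cell_nonsingular_path_connected: "path_connected (region (cell e) \<inter> (\<Union>v i. region (star v i)))"
proof -
  have "region (cell e) \<inter> (\<Union>v i. region (star v i)) = cell_pt ` (cell_slopes e \<times> (UNIV - {0}))"
  proof (intro subset_antisym subsetI)
    fix x assume x: "x \<in> region (cell e) \<inter> (\<Union>v i. region (star v i))"
    then have "x \<in> region (cell e)" by blast
    then obtain v w where vw: "cell e v w" "x = conf v w" "v = v3 x" "w = v4 x" by (rule region_cases)
    have n3: "v$3 \<noteq> 0 \<or> w$3 \<noteq> 0" using x star_not_both vw(3,4) unfolding region_def by blast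
    note nz = wchD[OF vw(1)]
    let ?z = "((v$2/v$1, w$2/w$1), (v$3/v$1, w$3/w$1))"
    have "x = cell_pt ?z"
      unfolding vw(2) cell_pt_def
      by (rule conf_eqI[of "v$1" "w$1"]) (use nz in \<open>auto simp: vec_eq_iff forall_3\<close>)
    moreover have "?z \<in> cell_slopes e \<times> (UNIV - {0})" using nz n3 by (auto simp: zero_prod_def)
    ultimately show "x \<in> cell_pt ` (cell_slopes e \<times> (UNIV - {0}))" by blast
  next
    fix x assume "x \<in> cell_pt ` (cell_slopes e \<times> (UNIV - {0}))"
    then obtain z where "z \<in> cell_slopes e \<times> (UNIV - {0})" and zx: "x = cell_pt z" by blast
    then have z: "fst z \<in> cell_slopes e" "snd z \<noteq> 0" "x = cell_pt z" by (auto simp: mem_Times_iff)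
    then have "fst (snd z) \<noteq> 0 \<or> snd (snd z) \<noteq> 0" by (auto simp: prod_eq_iff)
    then obtain u i where "star u i (vector [1, fst (fst z), fst (snd z)]) (vector [1, snd (fst z), snd (snd z)])"
      using star_exists[OF cell_pt_distinct_pts[OF z(1)]] by auto
    then have "cell_pt z \<in> region (star u i)"
      unfolding cell_pt_def using conf_in_region[OF scale_inv_star cell_pt_distinct_pts[OF z(1)]] by blast
    then show "x \<in> region (cell e) \<inter> (\<Union>v i. region (star v i))"
      using cell_pt_in_cell[OF z(1)] unfolding z(3) by blast
  qed
  moreover have "path_connected (cell_pt ` (cell_slopes e \<times> (UNIV - {0})))"
  proof (rule path_connected_continuous_image)
    show "continuous_on (cell_slopes e \<times> (UNIV - {0})) cell_pt"
      unfolding cell_pt_def by (intro continuous_on_conf continuous_intros) (auto simp: vec3_eq_0)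
    show "path_connected (cell_slopes e \<times> (UNIV - {0 :: real \<times> real}))"
      by (rule path_connected_Times[OF convex_imp_path_connected[OF convex_cell_slopes]])
        (use path_connected_punctured_universe[of "0 :: real \<times> real"] in \<open>simp add: Compl_eq_Diff_UNIV\<close>)
  qed
  ultimately show ?thesis by simp
qed

section \<open>Words and classes of paths\<close>

text \<open>The equations encode negations: wall 1 changes the sign of \<open>sA\<close> only, wall
  2 that of \<open>sB\<close> only, and the walls 3 and 4, which enter both products, change
  both.\<close>

fun act :: "bool \<times> bool \<Rightarrow> 4 \<Rightarrow> bool \<times> bool" where
  "act (a, b) i = ((i = 2) = a, (i = 1) = b)"

lemma act_act [simp]: "act (act v i) i = v"
  by (cases v) auto

text \<open>The product of \<open>sA\<close> and \<open>sB\<close> is \<open>sC\<close> times a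
  square. This is why the stars of the walls 3 and 4, where \<open>sA\<close> and \<open>sB\<close>
  both change sign, are told apart by \<open>sC\<close>.\<close>

lemma sign_sAB:
  assumes "nonsing v w"
  shows "sC v w > 0 \<longleftrightarrow> (sA v w > 0 \<longleftrightarrow> sB v w > 0)"
proof -
  have "sA v w * sB v w = sC v w * (v$3 * w$3)\<^sup>2"
    by (simp add: sA_def sB_def sC_def power2_eq_square)
  moreover have "(v$3 * w$3)\<^sup>2 > 0" "sA v w \<noteq> 0" "sB v w \<noteq> 0"
    using assms by (auto simp: nonsing_def forall_4 sA_def sB_def)
  ultimately show ?thesis
    by (metis linorder_neqE_linordered_idom mult_less_0_iff not_less_iff_gr_or_eq zero_less_mult_iff)
qed

lemma star_act: "star (act v i) i = star v i"
proof -
  obtain a b where v: "v = (a, b)" by (cases v)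
  show ?thesis
    using exhaust_4[of i] by (auto simp: v fun_eq_iff star_iff)
qed

lemma chamber_star: "chamber v p q \<Longrightarrow> star v i p q"
  using sign_sAB[of p q] chamber_nonsing[of v p q] by (cases v) (auto simp: star.simps)

lemma star_nonsing:
  assumes "star v i p q" "nonsing p q"
  shows "chamber v p q \<or> chamber (act v i) p q"
proof -
  obtain a b where v: "v = (a, b)" by (cases v)
  show ?thesis
    using assms sign_sAB[OF assms(2)] exhaust_4[of i] by (auto simp: v star_iff nonsing_def)
qed

lemma nonsing_chamber: "nonsing p q \<Longrightarrow> chamber (sA p q > 0, sB p q > 0) p q"
  by (simp add: nonsing_def)

lemma chamber_unique: "chamber u p q \<Longrightarrow> chamber v p q \<Longrightarrow> u = v"
  by (cases u; cases v) auto

abbreviation "X \<equiv> config_space"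
abbreviation "Cc v \<equiv> region (chamber v)"
abbreviation "Ss v i \<equiv> region (star v i)"
abbreviation "Dd \<equiv> region nonsing"

lemma Cc_Ss: "Cc v \<subseteq> Ss v i" "Cc (act v i) \<subseteq> Ss v i" "Cc v \<subseteq> Dd"
proof -
  show "Cc v \<subseteq> Ss v i" for v using chamber_star unfolding region_def by blast
  from this[of "act v i"] show "Cc (act v i) \<subseteq> Ss v i" by (simp add: star_act)
  show "Cc v \<subseteq> Dd" using chamber_nonsing unfolding region_def by blast
qed

lemma Dd_Cc: "x \<in> Dd \<Longrightarrow> \<exists>v. x \<in> Cc v"
  using nonsing_chamber unfolding region_def by blast

lemma Cc_unique: "x \<in> Cc u \<Longrightarrow> x \<in> Cc v \<Longrightarrow> u = v"
  using chamber_unique unfolding region_def by blast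

lemma Ss_Dd: "x \<in> Ss v i \<Longrightarrow> x \<in> Dd \<Longrightarrow> x \<in> Cc v \<or> x \<in> Cc (act v i)"
  using star_nonsing unfolding region_def by blast

text \<open>A hub in each chamber: \<open>x_3\<close> is the affine origin and \<open>x_4\<close> a
  vertex of a square around it. The entry is -1 for a positive sign since \<open>sA\<close> and
  \<open>sB\<close> are the coordinates of \<open>x_3\<close> minus those of
  \<open>x_4\<close>.\<close>

definition chamber_pt :: "bool \<times> bool \<Rightarrow> rp2^4" where
  "chamber_pt v = conf (vector [0, 0, 1]) (vector [if fst v then -1 else 1, if snd v then -1 else 1, 1])"

lemma chamber_pt_in: "chamber_pt v \<in> Cc v"
proof (cases v)
  case (Pair a b)
  have c: "chamber v (vector [0, 0, 1]) (vector [if a then -1 else 1, if b then -1 else 1, 1])"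
    by (simp add: Pair forall_4 sA_def sB_def)
  show ?thesis
    using conf_in_region[OF scale_inv_chamber nonsing_distinct_pts[OF chamber_nonsing[OF c]]] c by (simp add: chamber_pt_def Pair)
qed

lemma chamber_pt_base: "chamber_pt (False, False) = base_config"
  by (simp add: chamber_pt_def base_config_def vec_eq_iff forall_4)

lemma Cc_sub: "Cc v \<subseteq> X" and Ss_sub: "Ss v i \<subseteq> X"
  by (rule region_subset)+

lemma chamber_pt_reachable: "\<exists>p. path_in X base_config (chamber_pt v) p"
proof -
  have st: "\<exists>p. path_in X (chamber_pt u) (chamber_pt (act u i)) p" for u i
  proof -
    have "chamber_pt u \<in> Ss u i" "chamber_pt (act u i) \<in> Ss u i" using chamber_pt_in Cc_Ss by blast+
    then obtain p where "path_in (Ss u i) (chamber_pt u) (chamber_pt (act u i)) p"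
      by (rule simple_conn_path_in[OF simple_conn_star])
    then show ?thesis using path_in_mono[OF _ Ss_sub] by blast
  qed
  obtain p where p: "path_in X (chamber_pt (False, False)) (chamber_pt (True, False)) p" using st[of "(False, False)" 1] by auto
  obtain q where q: "path_in X (chamber_pt (False, False)) (chamber_pt (False, True)) q" using st[of "(False, False)" 2] by auto
  obtain r where r: "path_in X (chamber_pt (False, False)) (chamber_pt (True, True)) r" using st[of "(False, False)" 3] by auto
  have "path_in X (chamber_pt (False, False)) (chamber_pt (False, False)) (\<lambda>_. chamber_pt (False, False))"
    using base_config_in_config_space by (intro path_in_const) (simp add: chamber_pt_base)
  with p q r show ?thesis unfolding chamber_pt_base[symmetric]
    by (cases v; cases "fst v"; cases "snd v") auto
qed

lemma reachable:
  assumes "x \<in> X" shows "\<exists>p. path_in X base_config x p"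
proof -
  have ev: "eventually (\<lambda>y. y \<in> X \<longrightarrow> y \<in> X) (nhds x)" by simp
  obtain y p where y: "y \<in> Dd" "path_in X y x p"
    by (rule nonsingular_nearby[OF assms ev])
  obtain v where v: "y \<in> Cc v" using Dd_Cc[OF y(1)] by blast
  obtain q where q: "path_in (Cc v) (chamber_pt v) y q" by (rule simple_conn_path_in[OF simple_conn_chamber chamber_pt_in v])
  obtain r where r: "path_in X base_config (chamber_pt v) r" using chamber_pt_reachable by blast
  from path_in_join[OF r path_in_join[OF path_in_mono[OF q Cc_sub] y(2)]] show ?thesis by blast
qed

section \<open>Classes of paths relative to the hubs of the chambers\<close>

definition delta :: "rp2^4 \<Rightarrow> real \<Rightarrow> rp2^4" where
  "delta x = (if x = base_config then (\<lambda>_. base_config) else SOME p. path_in X base_config x p)"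

interpretation PF: path_functor config_space base_config delta
proof
  show "path_in X base_config x (delta x)" if "x \<in> X" for x
  proof (cases "x = base_config")
    case True
    then show ?thesis using path_in_const[OF base_config_in_config_space] by (simp add: delta_def)
  next
    case False
    then show ?thesis using someI_ex[OF reachable[OF that]] by (simp add: delta_def)
  qed
  show "base_config \<in> X" by (rule base_config_in_config_space)
  show "delta base_config = (\<lambda>_. base_config)" by (simp add: delta_def)
qed

abbreviation "P \<equiv> fundamental_group config_space base_config"
abbreviation "F \<equiv> PF.F"
abbreviation multP (infixl "\<odot>" 70) where "multP x y \<equiv> x \<otimes>\<^bsub>P\<^esub> y"

definition chamber_of :: "rp2^4 \<Rightarrow> bool \<times> bool" where "chamber_of x = (THE v. x \<in> Cc v)"

lemma chamber_of: "x \<in> Cc v \<Longrightarrow> chamber_of x = v"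
  unfolding chamber_of_def using Cc_unique by blast

definition hub_path :: "rp2^4 \<Rightarrow> real \<Rightarrow> rp2^4" where
  "hub_path x = (SOME p. path_in (Cc (chamber_of x)) (chamber_pt (chamber_of x)) x p)"

lemma hub_path:
  assumes "x \<in> Cc v" shows "path_in (Cc v) (chamber_pt v) x (hub_path x)"
proof -
  obtain q where "path_in (Cc v) (chamber_pt v) x q" by (rule simple_conn_path_in[OF simple_conn_chamber chamber_pt_in assms])
  then show ?thesis unfolding hub_path_def chamber_of[OF assms] by (rule someI[of "path_in (Cc v) (chamber_pt v) x"])
qed

text \<open>
  \<open>Fhub\<close> is \<open>F\<close> with the connections to the base point changed such that paths inside a chamber
  become trivial, so that the class of a path only depends on the walls it crosses.
\<close>

definition hub_class where "hub_class x = F (hub_path x)"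

definition Fhub where "Fhub p = hub_class (pathstart p) \<odot> F p \<odot> inv\<^bsub>P\<^esub> hub_class (pathfinish p)"

lemma hub_class_carrier: "x \<in> Dd \<Longrightarrow> hub_class x \<in> carrier P"
  using Dd_Cc[of x] hub_path path_in_mono[OF _ Cc_sub] PF.F_carrier unfolding hub_class_def by metis

lemma Fhub_homotopic: "path_in X x y p \<Longrightarrow> homotopic_paths X p q \<Longrightarrow> Fhub p = Fhub q"
  using PF.F_homotopic[of p q x y] path_in_homotopic[of X p q x y] unfolding Fhub_def path_in_def by simp

lemma Fhub_join:
  assumes "x \<in> Dd" "y \<in> Dd" "z \<in> Dd" "path_in X x y p" "path_in X y z q"
  shows "Fhub (p +++ q) = Fhub p \<odot> Fhub q"
proof -
  have c: "hub_class x \<in> carrier P" "hub_class y \<in> carrier P" "hub_class z \<in> carrier P" "F p \<in> carrier P" "F q \<in> carrier P"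
    using assms hub_class_carrier PF.F_carrier by auto
  have "inv\<^bsub>P\<^esub> hub_class y \<odot> (hub_class y \<odot> (F q \<odot> inv\<^bsub>P\<^esub> hub_class z)) = F q \<odot> inv\<^bsub>P\<^esub> hub_class z"
    using c by (simp add: PF.P.m_assoc[symmetric])
  moreover have "Fhub p = hub_class x \<odot> F p \<odot> inv\<^bsub>P\<^esub> hub_class y" "Fhub q = hub_class y \<odot> F q \<odot> inv\<^bsub>P\<^esub> hub_class z"
    "Fhub (p +++ q) = hub_class x \<odot> (F p \<odot> F q) \<odot> inv\<^bsub>P\<^esub> hub_class z"
    using assms(4,5) PF.F_join[OF assms(4,5)] by (auto simp: Fhub_def path_in_def)
  ultimately show ?thesis using c by (simp add: PF.P.m_assoc)
qed

text \<open>Absorbing the hub paths exhibits \<open>Fhub p\<close> as \<open>F\<close> of a path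
  between two hubs, to which homotopy invariance in a simply connected set can be applied
  directly.\<close>

lemma Fhub_conj:
  assumes "x \<in> Cc u" "y \<in> Cc v" "path_in X x y p"
  shows "Fhub p = F (hub_path x +++ (p +++ reversepath (hub_path y)))"
proof -
  have k: "path_in X (chamber_pt u) x (hub_path x)" "path_in X (chamber_pt v) y (hub_path y)" "path_in X y (chamber_pt v) (reversepath (hub_path y))"
    using hub_path[OF assms(1)] hub_path[OF assms(2)] path_in_mono[OF _ Cc_sub] path_in_reverse by metis+
  note c = PF.F_carrier[OF k(1)] PF.F_carrier[OF k(2)] PF.F_carrier[OF k(3)] PF.F_carrier[OF assms(3)]
  have "inv\<^bsub>P\<^esub> F (hub_path y) = F (reversepath (hub_path y))"
    using PF.F_reverse(2)[OF k(2)] c PF.P.inv_equality by blast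
  then show ?thesis
    using assms(3) PF.F_join[OF k(1) path_in_join[OF assms(3) k(3)]] PF.F_join[OF assms(3) k(3)] c
    by (simp add: Fhub_def hub_class_def path_in_def PF.P.m_assoc)
qed

lemma Fhub_loop:
  assumes "path_in X base_config base_config p" shows "Fhub p = F p"
proof -
  have b: "base_config \<in> Cc (False, False)" using chamber_pt_in[of "(False, False)"] by (simp add: chamber_pt_base)
  have "hub_class base_config = \<one>\<^bsub>P\<^esub>"
    unfolding hub_class_def using hub_path[OF b] PF.F_trivial_loop[OF simple_conn_chamber Cc_sub] by (simp add: chamber_pt_base)
  then show ?thesis using assms PF.F_carrier[OF assms] by (simp add: Fhub_def path_in_def)
qed

lemma Fhub_loop_simple_conn:
  assumes "simple_conn U" "U \<subseteq> X" "path_in U x x p" "x \<in> Dd"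
  shows "Fhub p = \<one>\<^bsub>P\<^esub>"
  using PF.F_trivial_loop[OF assms(1-3)] hub_class_carrier[OF assms(4)] assms(3) by (simp add: Fhub_def path_in_def)

lemma hub_path_conj_path:
  assumes "x \<in> Cc u" "y \<in> Cc v" "Cc u \<subseteq> U" "Cc v \<subseteq> U" "path_in U x y p"
  shows "path_in U (chamber_pt u) (chamber_pt v) (hub_path x +++ (p +++ reversepath (hub_path y)))"
  by (rule path_in_join[OF path_in_mono[OF hub_path[OF assms(1)] assms(3)] path_in_join[OF assms(5)
        path_in_reverse[OF path_in_mono[OF hub_path[OF assms(2)] assms(4)]]]])

lemma Fhub_chamber_loop:
  assumes "x \<in> Cc v" "y \<in> Cc v" "Cc v \<subseteq> U" "U \<subseteq> X" "simple_conn U" "path_in U x y p"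
  shows "Fhub p = \<one>\<^bsub>P\<^esub>"
  unfolding Fhub_conj[OF assms(1,2) path_in_mono[OF assms(6,4)]]
  by (rule PF.F_trivial_loop[OF assms(5,4) hub_path_conj_path[OF assms(1,2,3,3,6)]])

definition star_path :: "bool \<times> bool \<Rightarrow> 4 \<Rightarrow> real \<Rightarrow> rp2^4" where
  "star_path v i = (SOME p. path_in (Ss v i) (chamber_pt v) (chamber_pt (act v i)) p)"

lemma star_path: "path_in (Ss v i) (chamber_pt v) (chamber_pt (act v i)) (star_path v i)"
proof -
  have "chamber_pt v \<in> Ss v i" "chamber_pt (act v i) \<in> Ss v i" using chamber_pt_in Cc_Ss by blast+
  then obtain p where "path_in (Ss v i) (chamber_pt v) (chamber_pt (act v i)) p"
    by (rule simple_conn_path_in[OF simple_conn_star])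
  then show ?thesis unfolding star_path_def by (rule someI[of "path_in (Ss v i) (chamber_pt v) (chamber_pt (act v i))"])
qed

definition edge where "edge v i = F (star_path v i)"

lemma edge_carrier: "edge v i \<in> carrier P"
  unfolding edge_def by (rule PF.F_carrier[OF path_in_mono[OF star_path Ss_sub]])

text \<open>Prolonged to the hubs, \<open>p\<close> and the chosen \<open>star_path\<close> join the
  same two points of a simply connected star, so the value depends only on the chamber left and the
  wall crossed.\<close>

lemma Fhub_star:
  assumes "x \<in> Cc v" "y \<in> Cc (act v i)" "path_in (Ss v i) x y p"
  shows "Fhub p = edge v i"
  unfolding Fhub_conj[OF assms(1,2) path_in_mono[OF assms(3) Ss_sub]] edge_def
  by (rule PF.F_simple_conn[OF simple_conn_star Ss_sub
        hub_path_conj_path[OF assms(1,2) Cc_Ss(1) Cc_Ss(2) assms(3)] star_path])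

lemma edge_edge: "edge v i \<odot> edge (act v i) i = \<one>\<^bsub>P\<^esub>"
proof -
  have p: "path_in (Ss v i) (chamber_pt (act v i)) (chamber_pt v) (star_path (act v i) i)"
    using star_path[of "act v i" i] by (simp add: star_act)
  show ?thesis
    unfolding edge_def PF.F_join[OF path_in_mono[OF star_path Ss_sub] path_in_mono[OF p Ss_sub], symmetric]
    by (rule PF.F_trivial_loop[OF simple_conn_star Ss_sub path_in_join[OF star_path p]])
qed

section \<open>Products of edge classes and the reading of paths\<close>

primrec act_word :: "bool \<times> bool \<Rightarrow> 4 list \<Rightarrow> bool \<times> bool" where
  "act_word v [] = v"
| "act_word v (i # is) = act_word (act v i) is"

primrec edge_word where
  "edge_word v [] = \<one>\<^bsub>P\<^esub>"
| "edge_word v (i # is) = edge v i \<odot> edge_word (act v i) is"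

lemma edge_word_carrier: "edge_word v is \<in> carrier P"
  by (induction "is" arbitrary: v) (auto simp: edge_carrier)

lemma act_word_append [simp]: "act_word v (is @ js) = act_word (act_word v is) js"
  by (induction "is" arbitrary: v) auto

lemma edge_word_append: "edge_word v (is @ js) = edge_word v is \<odot> edge_word (act_word v is) js"
  by (induction "is" arbitrary: v) (auto simp: edge_carrier edge_word_carrier PF.P.m_assoc)

text \<open>Only the existence of some word with the right class and the right final chamber is
  asked for. An arbitrary continuous path may meet the walls infinitely often and has no word of its
  own.\<close>

definition readable :: "(real \<Rightarrow> rp2^4) \<Rightarrow> bool" where
  "readable p \<longleftrightarrow> (\<exists>is. chamber_of (pathfinish p) = act_word (chamber_of (pathstart p)) is \<and> Fhub p = edge_word (chamber_of (pathstart p)) is)"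

lemma readable_homotopic: "path_in X x y p \<Longrightarrow> homotopic_paths X p q \<Longrightarrow> readable p \<Longrightarrow> readable q"
  using Fhub_homotopic[of x y p q] path_in_homotopic[of X p q x y] unfolding readable_def path_in_def by simp

lemma readable_join:
  assumes "x \<in> Dd" "y \<in> Dd" "z \<in> Dd" "path_in X x y p" "path_in X y z q" "readable p" "readable q"
  shows "readable (p +++ q)"
proof -
  obtain "is" js where "chamber_of y = act_word (chamber_of x) is" "Fhub p = edge_word (chamber_of x) is" "chamber_of z = act_word (chamber_of y) js" "Fhub q = edge_word (chamber_of y) js"
    using assms(4-7) unfolding readable_def path_in_def by auto
  then show ?thesis
    using Fhub_join[OF assms(1-5)] assms(4,5) unfolding readable_def path_in_def
    by (intro exI[of _ "is @ js"]) (simp add: edge_word_append)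
qed

lemma readable_star:
  assumes "x \<in> Dd" "y \<in> Dd" "path_in (Ss v i) x y p"
  shows "readable p"
proof -
  have "\<exists>u. Ss u i = Ss v i \<and> x \<in> Cc u"
    using Ss_Dd[OF path_in_start[OF assms(3)] assms(1)] star_act by metis
  then obtain u where u: "Ss u i = Ss v i" "x \<in> Cc u" by blast
  have y: "y \<in> Cc u \<or> y \<in> Cc (act u i)"
    using Ss_Dd[of y u i] path_in_finish[OF assms(3)] assms(2) u(1) by simp
  have p: "path_in (Ss u i) x y p" using assms(3) u(1) by simp
  have s: "pathstart p = x" "pathfinish p = y" using p by (auto simp: path_in_def)
  from y show ?thesis
  proof
    assume y: "y \<in> Cc u"
    have "Fhub p = \<one>\<^bsub>P\<^esub>" by (rule Fhub_chamber_loop[OF u(2) y Cc_Ss(1) Ss_sub simple_conn_star p])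
    then show ?thesis unfolding readable_def s chamber_of[OF u(2)] chamber_of[OF y] by (intro exI[of _ "[]"]) simp
  next
    assume y: "y \<in> Cc (act u i)"
    have "Fhub p = edge u i" by (rule Fhub_star[OF u(2) y p])
    then show ?thesis unfolding readable_def s chamber_of[OF u(2)] chamber_of[OF y]
      by (intro exI[of _ "[i]"]) (simp add: edge_carrier)
  qed
qed

lemma star_open: "x \<in> Ss v i \<Longrightarrow> eventually (\<lambda>y. y \<in> X \<longrightarrow> y \<in> Ss v i) (nhds x)"
  by (rule region_open[OF scale_inv_star eventually_star])

lemma cell_open: "x \<in> region (cell e) \<Longrightarrow> eventually (\<lambda>y. y \<in> X \<longrightarrow> y \<in> region (cell e)) (nhds x)"
  by (rule region_open[OF scale_inv_cell eventually_cell])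

lemma dense_open:
  assumes "x \<in> X" "eventually (\<lambda>y. y \<in> X \<longrightarrow> y \<in> U) (nhds x)" "eventually (\<lambda>y. y \<in> X \<longrightarrow> y \<in> V) (nhds x)"
  shows "\<exists>y\<in>Dd. \<exists>p. path_in (U \<inter> V) y x p"
proof -
  have "eventually (\<lambda>y. y \<in> X \<longrightarrow> y \<in> U \<inter> V) (nhds x)" using assms(2,3) by eventually_elim blast
  then obtain y p where "y \<in> Dd" "path_in (U \<inter> V) y x p" by (rule nonsingular_nearby[OF assms(1)])
  then show ?thesis by blast
qed

text \<open>Away from the collinear quadruples the stars form an open cover. Inside one star a path
  between nonsingular points stays in its chamber or passes to the other, contributing no letter or
  one.\<close>

lemma readable_X0:
  assumes "path_in (\<Union>v i. Ss v i) x y p" "x \<in> Dd" "y \<in> Dd"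
  shows "readable p"
proof (rule path_decomposition[where \<U> = "{Ss v i | v i. True}" and D = Dd, OF _ _ _ _ _ _ assms])
  let ?X0 = "\<Union>v i. Ss v i"
  have sub: "?X0 \<subseteq> X" using Ss_sub by blast
  show "?X0 = \<Union> {Ss v i | v i. True}" by blast
  fix U assume "U \<in> {Ss v i | v i. True}"
  then obtain v i where U: "U = Ss v i" by blast
  obtain T where "open T" "U = X \<inter> T"
    using open_in_config_space[OF Ss_sub star_open] unfolding U by blast
  then show "\<exists>T. open T \<and> U = ?X0 \<inter> T" using sub U by blast
  show "readable q" if "x \<in> Dd" "y \<in> Dd" "path_in U x y q" for x y q
    using readable_star that unfolding U by blast
next
  fix U V x assume "U \<in> {Ss v i | v i. True}" "V \<in> {Ss v i | v i. True}" "x \<in> U \<inter> V"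
  then obtain u i v j where "U = Ss u i" "V = Ss v j" "x \<in> Ss u i" "x \<in> Ss v j" by blast
  then show "\<exists>y\<in>Dd. \<exists>p. path_in (U \<inter> V) y x p"
    using dense_open[OF _ star_open star_open] Ss_sub by blast
next
  fix p q x y assume "x \<in> Dd" "y \<in> Dd" "path_in (\<Union>v i. Ss v i) x y p" "homotopic_paths (\<Union>v i. Ss v i) p q" "readable p"
  then show "readable q" using readable_homotopic[of x y p q] path_in_mono homotopic_paths_subset Ss_sub
    by (metis (no_types, lifting) UN_least)
next
  fix p q x y z assume *: "x \<in> Dd" "y \<in> Dd" "z \<in> Dd" "path_in (\<Union>v i. Ss v i) x y p"
    "path_in (\<Union>v i. Ss v i) y z q" "readable p" "readable q"
  have sub: "(\<Union>v i. Ss v i) \<subseteq> X" using Ss_sub by blast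
  show "readable (p +++ q)" by (rule readable_join[OF *(1-3) path_in_mono[OF *(4) sub] path_in_mono[OF *(5) sub] *(6,7)])
qed

lemma Dd_Ss: "Dd \<subseteq> (\<Union>v i. Ss v i)"
proof
  fix x assume "x \<in> Dd"
  then obtain v where "x \<in> Cc v" using Dd_Cc by blast
  then have "x \<in> Ss v 1" by (rule subsetD[OF Cc_Ss(1)])
  then show "x \<in> (\<Union>v i. Ss v i)" by (intro UN_I[of v] UN_I[of 1]) auto
qed

text \<open>The path may run through collinear quadruples, where no letter can be assigned. The cell
  is simply connected and remains path connected without them, so a homotopic path avoids
  them.\<close>

lemma readable_cell:
  assumes "x \<in> Dd" "y \<in> Dd" "path_in (region (cell e)) x y p"
  shows "readable p"
proof -
  let ?W0 = "region (cell e) \<inter> (\<Union>v i. Ss v i)"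
  have "x \<in> ?W0" "y \<in> ?W0"
    by (rule IntI[OF path_in_start[OF assms(3)] subsetD[OF Dd_Ss assms(1)]]
        IntI[OF path_in_finish[OF assms(3)] subsetD[OF Dd_Ss assms(2)]])+
  from cell_nonsingular_path_connected[of e, unfolded path_connected_def, rule_format, OF this]
  obtain q where "path q \<and> path_image q \<subseteq> ?W0 \<and> pathstart q = x \<and> pathfinish q = y" by (elim exE)
  then have q: "path_in ?W0 x y q" by (simp add: path_in_def)
  have "readable q" by (rule readable_X0[OF path_in_mono[OF q Int_lower2] assms(1,2)])
  moreover have qw: "path_in (region (cell e)) x y q" by (rule path_in_mono[OF q Int_lower1])
  have "homotopic_paths X q p"
    by (rule homotopic_paths_subset[OF simple_conn_homotopic[OF simple_conn_cell qw assms(3)] region_subset])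
  ultimately show ?thesis using readable_homotopic[OF path_in_mono[OF qw region_subset]] by blast
qed

lemma readable_X:
  assumes "path_in X x y p" "x \<in> Dd" "y \<in> Dd"
  shows "readable p"
proof (rule path_decomposition[where \<U> = "{Ss v i | v i. True} \<union> {region (cell e) | e. True}" and D = Dd, OF _ _ _ _ _ _ assms])
  let ?\<U> = "{Ss v i | v i. True} \<union> {region (cell e) | e. True}"
  have cov: "x \<in> \<Union>?\<U>" if "x \<in> X" for x using config_space_cover[OF that] by blast
  have sub: "U \<subseteq> X" if "U \<in> ?\<U>" for U using that region_subset by auto
  show "X = \<Union>?\<U>" using cov sub by blast
  have opn: "eventually (\<lambda>y. y \<in> X \<longrightarrow> y \<in> U) (nhds x)" if "U \<in> ?\<U>" "x \<in> U" for U x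
    using that star_open cell_open by auto
  show "\<exists>T. open T \<and> U = X \<inter> T" if "U \<in> ?\<U>" for U
    by (rule open_in_config_space[OF sub[OF that] opn[OF that]])
  show "\<exists>y\<in>Dd. \<exists>p. path_in (U \<inter> V) y x p" if "U \<in> ?\<U>" "V \<in> ?\<U>" "x \<in> U \<inter> V" for U V x
    using dense_open[OF _ opn[OF that(1)] opn[OF that(2)]] that(3) sub[OF that(1)] by blast
  show "readable p" if "U \<in> ?\<U>" "x \<in> Dd" "y \<in> Dd" "path_in U x y p" for U p x y
    using that readable_star readable_cell by auto
qed (use readable_homotopic readable_join in \<open>simp; metis\<close>)+

section \<open>Octagons and relators\<close>

abbreviation wv :: "real \<times> real \<Rightarrow> real \<times> real \<Rightarrow> real^3" where "wv \<sigma> c \<equiv> vector [1, fst \<sigma>, fst c]"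
abbreviation ww :: "real \<times> real \<Rightarrow> real \<times> real \<Rightarrow> real^3" where "ww \<sigma> c \<equiv> vector [1, snd \<sigma>, snd c]"

lemma star_sign_cong:
  assumes d: "\<And>j. j \<noteq> i \<Longrightarrow> wall j v w * wall j v' w' > 0" and st: "star u i v w"
  shows "star u i v' w'"
proof -
  obtain a b where u: "u = (a, b)" by (cases u)
  have same: "(x > 0) = (y > 0)" if "x * y > 0" for x y :: real
    using that by (auto simp: zero_less_mult_iff)
  have A: "(sA v w > 0) = (sA v' w' > 0)" if "i = 2"
  proof (rule same)
    have "sA v w * sA v' w' = (wall 1 v w * wall 1 v' w') * ((wall 4 v w * wall 4 v' w') * (wall 3 v w * wall 3 v' w'))"
      by (simp add: sA_def)
    also have "\<dots> > 0" by (rule mult_pos_pos[OF d mult_pos_pos[OF d d]]) (use that in simp_all)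
    finally show "sA v w * sA v' w' > 0" .
  qed
  have B: "(sB v w > 0) = (sB v' w' > 0)" if "i = 1"
  proof (rule same)
    have "sB v w * sB v' w' = (wall 2 v w * wall 2 v' w') * ((wall 4 v w * wall 4 v' w') * (wall 3 v w * wall 3 v' w'))"
      by (simp add: sB_def)
    also have "\<dots> > 0" by (rule mult_pos_pos[OF d mult_pos_pos[OF d d]]) (use that in simp_all)
    finally show "sB v w * sB v' w' > 0" .
  qed
  have C: "(sC v w > 0) = (sC v' w' > 0)" if "i \<noteq> 1" "i \<noteq> 2"
  proof (rule same)
    have "sC v w * sC v' w' = (wall 1 v w * wall 1 v' w') * (wall 2 v w * wall 2 v' w')"
      by (simp add: sC_def)
    also have "\<dots> > 0" by (rule mult_pos_pos[OF d d]) (use that in simp_all)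
    finally show "sC v w * sC v' w' > 0" .
  qed
  have "wall j v' w' \<noteq> 0" if "j \<noteq> i" for j using d[OF that] by auto
  then show ?thesis using st A B C unfolding u star.simps by (simp split: if_splits)
qed

text \<open>For fixed slopes \<open>\<sigma>\<close> the four walls are linear functions of the
  heights. Equal signs at both ends of a side therefore exclude every wall other than the one named.
  The list gives, side by side, the wall crossed and the next vertex.\<close>

fun octagon :: "real \<times> real \<Rightarrow> bool \<times> bool \<Rightarrow> real \<times> real \<Rightarrow> (4 \<times> real \<times> real) list \<Rightarrow> bool" where
  "octagon \<sigma> v c [] \<longleftrightarrow> chamber v (wv \<sigma> c) (ww \<sigma> c)"
| "octagon \<sigma> v c ((i, c') # zs) \<longleftrightarrow> chamber v (wv \<sigma> c) (ww \<sigma> c) \<and>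
     (\<forall>j. j \<noteq> i \<longrightarrow> wall j (wv \<sigma> c) (ww \<sigma> c) * wall j (wv \<sigma> c') (ww \<sigma> c') > 0) \<and> octagon \<sigma> (act v i) c' zs"

lemma cell_pt_Cc:
  assumes "\<sigma> \<in> cell_slopes e" "chamber v (wv \<sigma> c) (ww \<sigma> c)"
  shows "cell_pt (\<sigma>, c) \<in> Cc v"
  using conf_in_region[OF scale_inv_chamber cell_pt_distinct_pts[of "(\<sigma>, c)" e]] assms unfolding cell_pt_def by simp

lemma mult_pos_linear:
  fixes x y t :: real
  assumes "x * y > 0" "0 \<le> t" "t \<le> 1"
  shows "x * ((1 - t) * x + t * y) > 0"
proof -
  have "x * ((1 - t) * x + t * y) = (1 - t) * x\<^sup>2 + t * (x * y)"
    by (simp add: power2_eq_square algebra_simps)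
  moreover have "x\<^sup>2 > 0" using assms(1) by auto
  moreover have "(1 - t) * x\<^sup>2 \<ge> 0" "t * (x * y) \<ge> 0" using assms by auto
  ultimately show ?thesis using assms
    by (cases "t = 0") (auto intro: add_nonneg_pos)
qed

lemma wall_segment:
  "wall j (wv \<sigma> ((1 - t) *\<^sub>R c + t *\<^sub>R c')) (ww \<sigma> ((1 - t) *\<^sub>R c + t *\<^sub>R c')) =
     (1 - t) * wall j (wv \<sigma> c) (ww \<sigma> c) + t * wall j (wv \<sigma> c') (ww \<sigma> c')"
  using exhaust_4[of j] by (auto simp: algebra_simps)

lemma segment_path:
  assumes \<sigma>: "\<sigma> \<in> cell_slopes e" and c: "chamber v (wv \<sigma> c) (ww \<sigma> c)"
    and s: "\<And>j. j \<noteq> i \<Longrightarrow> wall j (wv \<sigma> c) (ww \<sigma> c) * wall j (wv \<sigma> c') (ww \<sigma> c') > 0"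
  obtains p where "path_in (region (cell e) \<inter> Ss v i) (cell_pt (\<sigma>, c)) (cell_pt (\<sigma>, c')) p"
proof -
  let ?p = "\<lambda>t. cell_pt (\<sigma>, (1 - t) *\<^sub>R c + t *\<^sub>R c')"
  have "continuous_on {0..1} ?p"
    unfolding cell_pt_def fst_conv snd_conv by (intro continuous_on_conf continuous_intros) (auto simp: vec3_eq_0)
  moreover have "?p t \<in> region (cell e) \<inter> Ss v i" if t: "t \<in> {0..1}" for t
  proof
    show "?p t \<in> region (cell e)" using \<sigma> by (intro cell_pt_in_cell) simp
    have "star v i (wv \<sigma> ((1 - t) *\<^sub>R c + t *\<^sub>R c')) (ww \<sigma> ((1 - t) *\<^sub>R c + t *\<^sub>R c'))"
      by (rule star_sign_cong[OF _ chamber_star[OF c]], unfold wall_segment, rule mult_pos_linear[OF s]) (use t in auto)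
    then show "?p t \<in> Ss v i"
      using conf_in_region[OF scale_inv_star cell_pt_distinct_pts[of "(\<sigma>, (1 - t) *\<^sub>R c + t *\<^sub>R c')" e]] \<sigma>
      unfolding cell_pt_def by simp
  qed
  ultimately have "path_in (region (cell e) \<inter> Ss v i) (cell_pt (\<sigma>, c)) (cell_pt (\<sigma>, c')) ?p"
    unfolding path_in_def path_def path_image_def pathstart_def pathfinish_def by auto
  then show thesis by (rule that)
qed

lemma octagon_path:
  assumes "\<sigma> \<in> cell_slopes e" "octagon \<sigma> v c zs"
  shows "\<exists>p. path_in (region (cell e)) (cell_pt (\<sigma>, c)) (cell_pt (\<sigma>, last (c # map snd zs))) p \<and>
     Fhub p = edge_word v (map fst zs) \<and> cell_pt (\<sigma>, last (c # map snd zs)) \<in> Cc (act_word v (map fst zs))"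
  using assms(2)
proof (induction zs arbitrary: v c)
  case Nil
  then have x: "cell_pt (\<sigma>, c) \<in> Cc v" using cell_pt_Cc[OF assms(1)] by simp
  have w: "cell_pt (\<sigma>, c) \<in> region (cell e)" using assms(1) by (intro cell_pt_in_cell) simp
  have "Fhub (\<lambda>_. cell_pt (\<sigma>, c)) = \<one>\<^bsub>P\<^esub>"
    by (rule Fhub_loop_simple_conn[OF simple_conn_cell region_subset path_in_const[OF w] subsetD[OF Cc_Ss(3) x]])
  then show ?case using x path_in_const[OF w] by auto
next
  case (Cons z zs)
  obtain i c' where z: "z = (i, c')" by (cases z)
  have o: "chamber v (wv \<sigma> c) (ww \<sigma> c)" "\<And>j. j \<noteq> i \<Longrightarrow> wall j (wv \<sigma> c) (ww \<sigma> c) * wall j (wv \<sigma> c') (ww \<sigma> c') > 0"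
    "octagon \<sigma> (act v i) c' zs" using Cons.prems by (auto simp: z simp del: wall_simps)
  obtain q where q: "path_in (region (cell e) \<inter> Ss v i) (cell_pt (\<sigma>, c)) (cell_pt (\<sigma>, c')) q"
    by (rule segment_path[OF assms(1) o(1,2)])
  let ?y = "cell_pt (\<sigma>, last (c' # map snd zs))"
  obtain p where p: "path_in (region (cell e)) (cell_pt (\<sigma>, c')) ?y p" "Fhub p = edge_word (act v i) (map fst zs)"
    "?y \<in> Cc (act_word (act v i) (map fst zs))"
    using Cons.IH[OF o(3)] by blast
  have "chamber (act v i) (wv \<sigma> c') (ww \<sigma> c')" using o(3) by (cases zs) auto
  then have x: "cell_pt (\<sigma>, c) \<in> Cc v" "cell_pt (\<sigma>, c') \<in> Cc (act v i)" using cell_pt_Cc[OF assms(1)] o(1) by auto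
  have q': "path_in (region (cell e)) (cell_pt (\<sigma>, c)) (cell_pt (\<sigma>, c')) q" "path_in (Ss v i) (cell_pt (\<sigma>, c)) (cell_pt (\<sigma>, c')) q"
    by (rule path_in_mono[OF q Int_lower1] path_in_mono[OF q Int_lower2])+
  have "Fhub (q +++ p) = Fhub q \<odot> Fhub p"
    by (rule Fhub_join[OF subsetD[OF Cc_Ss(3) x(1)] subsetD[OF Cc_Ss(3) x(2)] subsetD[OF Cc_Ss(3) p(3)]
          path_in_mono[OF q'(1) region_subset] path_in_mono[OF p(1) region_subset]])
  also have "Fhub q = edge v i" by (rule Fhub_star[OF x q'(2)])
  finally show ?case
    using path_in_join[OF q'(1) p(1)] p(2,3) by (intro exI[of _ "q +++ p"]) (simp add: z)
qed

text \<open>The closed polygon is contractible in its simply connected cell, while reading it side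
  by side gives the product of edge classes.\<close>

lemma octagon_trivial:
  assumes "\<sigma> \<in> cell_slopes e" "octagon \<sigma> v c zs" "last (c # map snd zs) = c"
  shows "edge_word v (map fst zs) = \<one>\<^bsub>P\<^esub> \<and> act_word v (map fst zs) = v"
proof -
  obtain p where p: "path_in (region (cell e)) (cell_pt (\<sigma>, c)) (cell_pt (\<sigma>, c)) p" "Fhub p = edge_word v (map fst zs)"
    "cell_pt (\<sigma>, c) \<in> Cc (act_word v (map fst zs))"
    using octagon_path[OF assms(1,2)] unfolding assms(3) by blast
  have "chamber v (wv \<sigma> c) (ww \<sigma> c)" using assms(2) by (cases zs) auto
  then have "cell_pt (\<sigma>, c) \<in> Cc v" by (rule cell_pt_Cc[OF assms(1)])
  then have "act_word v (map fst zs) = v" using p(3) Cc_unique by blast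
  moreover have "Fhub p = \<one>\<^bsub>P\<^esub>"
    by (rule Fhub_loop_simple_conn[OF simple_conn_cell region_subset p(1) subsetD[OF Cc_Ss(3) p(3)]])
  ultimately show ?thesis using p(2) by simp
qed

definition trivial_word :: "4 list \<Rightarrow> bool" where
  "trivial_word is \<longleftrightarrow> (\<forall>v. edge_word v is = \<one>\<^bsub>P\<^esub> \<and> act_word v is = v)"

text \<open>
  The octagons go once around the stratum where all four points are collinear. With
  \<open>x\<^sub>3 = (1 : s : p)\<close> and \<open>x\<^sub>4 = (1 : s' : q)\<close> the order of the four walls in the \<open>(p, q)\<close>-plane
  depends on the slope \<open>s' / s\<close>, which gives the three cyclic orders of the letters.
\<close>

lemma octagons:
  "trivial_word [3, 1, 2, 4, 3, 1, 2, 4]" "trivial_word [3, 2, 1, 4, 3, 2, 1, 4]" "trivial_word [3, 1, 4, 2, 3, 1, 4, 2]"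
proof -
  \<comment> \<open>The quotients \<open>s' / s\<close> are 2, 1/2 and -1, one for each order of the
    lines \<open>q = 0\<close>, \<open>q = p\<close>, \<open>s q = s' p\<close> and
    \<open>p = 0\<close>. Negating both slopes keeps the lines but reverses the sign of
    \<open>sB\<close>, which gives access to the other two chambers.\<close>
  have word_of: "(1, 2) \<in> cell_slopes (True, True, True)" "(-1, -2) \<in> cell_slopes (False, False, False)"
    "(2, 1) \<in> cell_slopes (True, True, False)" "(-2, -1) \<in> cell_slopes (False, False, True)"
    "(1, -1) \<in> cell_slopes (True, False, False)" "(-1, 1) \<in> cell_slopes (False, True, True)"
    by (auto simp: cell_slopes_def)
  \<comment> \<open>One vertex in each of the eight sectors. The primed list starts at the antipodal
    vertex, from which the same word is read beginning in another chamber.\<close>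
  let ?A = "[(3, 2, 1), (1, 2, 3), (2, 1, 3), (4, -1, 1), (3, -2, -1), (1, -2, -3), (2, -1, -3), (4, 1, -1)]"
  let ?A' = "[(3, -2, -1), (1, -2, -3), (2, -1, -3), (4, 1, -1), (3, 2, 1), (1, 2, 3), (2, 1, 3), (4, -1, 1)]"
  have A: "octagon (1, 2) (True, True) (1, -1) ?A" "octagon (1, 2) (False, False) (-1, 1) ?A'"
    "octagon (-1, -2) (True, False) (1, -1) ?A" "octagon (-1, -2) (False, True) (-1, 1) ?A'"
    by (simp_all add: all4_neq forall_4 sA_def sB_def)
  let ?B = "[(3, 4, 1), (2, 4, 3), (1, 1, 2), (4, -1, 1), (3, -4, -1), (2, -4, -3), (1, -1, -2), (4, 1, -1)]"
  let ?B' = "[(3, -4, -1), (2, -4, -3), (1, -1, -2), (4, 1, -1), (3, 4, 1), (2, 4, 3), (1, 1, 2), (4, -1, 1)]"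
  have B: "octagon (2, 1) (True, True) (1, -1) ?B" "octagon (2, 1) (False, False) (-1, 1) ?B'"
    "octagon (-2, -1) (True, False) (1, -1) ?B" "octagon (-2, -1) (False, True) (-1, 1) ?B'"
    by (simp_all add: all4_neq forall_4 sA_def sB_def)
  let ?C = "[(3, 2, 1), (1, 1, 2), (4, -1, 2), (2, -2, 1), (3, -2, -1), (1, -1, -2), (4, 1, -2), (2, 2, -1)]"
  let ?C' = "[(3, -2, -1), (1, -1, -2), (4, 1, -2), (2, 2, -1), (3, 2, 1), (1, 1, 2), (4, -1, 2), (2, -2, 1)]"
  have C: "octagon (-1, 1) (True, True) (2, -1) ?C" "octagon (-1, 1) (False, False) (-2, 1) ?C'"
    "octagon (1, -1) (True, False) (2, -1) ?C" "octagon (1, -1) (False, True) (-2, 1) ?C'"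
    by (simp_all add: all4_neq forall_4 sA_def sB_def)
  have all: "(\<forall>v. Q v) \<longleftrightarrow> Q (True, True) \<and> Q (False, False) \<and> Q (True, False) \<and> Q (False, True)" for Q
    by (metis (full_types) surj_pair)
  show "trivial_word [3, 1, 2, 4, 3, 1, 2, 4]" unfolding trivial_word_def all
    using octagon_trivial[OF word_of(1) A(1)] octagon_trivial[OF word_of(1) A(2)]
      octagon_trivial[OF word_of(2) A(3)] octagon_trivial[OF word_of(2) A(4)] by simp
  show "trivial_word [3, 2, 1, 4, 3, 2, 1, 4]" unfolding trivial_word_def all
    using octagon_trivial[OF word_of(3) B(1)] octagon_trivial[OF word_of(3) B(2)]
      octagon_trivial[OF word_of(4) B(3)] octagon_trivial[OF word_of(4) B(4)] by simp
  show "trivial_word [3, 1, 4, 2, 3, 1, 4, 2]" unfolding trivial_word_def all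
    using octagon_trivial[OF word_of(6) C(1)] octagon_trivial[OF word_of(6) C(2)]
      octagon_trivial[OF word_of(5) C(3)] octagon_trivial[OF word_of(5) C(4)] by simp
qed

lemma edge_word_rev: "edge_word v (is @ rev is) = \<one>\<^bsub>P\<^esub> \<and> act_word v (is @ rev is) = v"
proof (induction "is" arbitrary: v)
  case (Cons i "is")
  have *: "edge_word (act v i) is \<odot> edge_word (act_word (act v i) is) (rev is) = \<one>\<^bsub>P\<^esub>" "act_word (act_word (act v i) is) (rev is) = act v i"
    using Cons[of "act v i"] by (simp_all add: edge_word_append)
  let ?a = "edge_word (act v i) is" and ?b = "edge_word (act_word (act v i) is) (rev is)"
  have "edge_word v ((i # is) @ rev (i # is)) = edge v i \<odot> (?a \<odot> (?b \<odot> edge (act v i) i))"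
    using *(2) by (simp add: edge_word_append edge_carrier edge_word_carrier PF.P.m_assoc)
  also have "?a \<odot> (?b \<odot> edge (act v i) i) = ?a \<odot> ?b \<odot> edge (act v i) i"
    by (simp add: edge_carrier edge_word_carrier PF.P.m_assoc)
  finally show ?case using *(1,2) edge_edge[of v i] by (simp add: edge_carrier)
qed simp

lemma trivial_word_rev:
  assumes "trivial_word is" shows "trivial_word (rev is)"
  unfolding trivial_word_def
proof
  fix v
  have "edge_word v is = \<one>\<^bsub>P\<^esub>" "act_word v is = v" using assms unfolding trivial_word_def by blast+
  then show "edge_word v (rev is) = \<one>\<^bsub>P\<^esub> \<and> act_word v (rev is) = v"
    using edge_word_rev[of v "is"] by (simp add: edge_word_append edge_word_carrier)
qed

lemma trivial_word_rotate:
  assumes "trivial_word (i # is)" shows "trivial_word (is @ [i])"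
  unfolding trivial_word_def
proof
  fix v
  have *: "edge (act v i) i \<odot> edge_word v is = \<one>\<^bsub>P\<^esub>" "act_word v is = act v i"
    using assms[unfolded trivial_word_def, rule_format, of "act v i"] by auto
  have "edge_word v is \<odot> edge (act v i) i = \<one>\<^bsub>P\<^esub>"
    by (rule PF.P.inv_comm[OF *(1)]) (simp_all add: edge_carrier edge_word_carrier)
  then show "edge_word v (is @ [i]) = \<one>\<^bsub>P\<^esub> \<and> act_word v (is @ [i]) = v"
    using * by (simp add: edge_word_append edge_carrier)
qed

lemma trivial_word_square_rotate: "trivial_word ((i # is) @ (i # is)) \<Longrightarrow> trivial_word ((is @ [i]) @ (is @ [i]))"
  using trivial_word_rotate[of i "is @ i # is"] by simp

lemma trivial_word_square_rev: "trivial_word (is @ is) \<Longrightarrow> trivial_word (rev is @ rev is)"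
  using trivial_word_rev[of "is @ is"] by simp

text \<open>Rotation and reversal preserve triviality of the square. They divide the 24 orderings
  into three classes of eight, each containing the word of one octagon.\<close>

lemma trivial_word_ordering:
  assumes "distinct is" "set is = (UNIV :: 4 set)"
  shows "trivial_word (is @ is)"
proof -
  have r: "trivial_word ([a, b, c, d] @ [a, b, c, d]) \<Longrightarrow>
     trivial_word ([b, c, d, a] @ [b, c, d, a]) \<and> trivial_word ([c, d, a, b] @ [c, d, a, b]) \<and> trivial_word ([d, a, b, c] @ [d, a, b, c]) \<and>
     trivial_word ([a, d, c, b] @ [a, d, c, b]) \<and> trivial_word ([d, c, b, a] @ [d, c, b, a]) \<and>
     trivial_word ([c, b, a, d] @ [c, b, a, d]) \<and> trivial_word ([b, a, d, c] @ [b, a, d, c])" for a b c d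
  proof -
    assume 0: "trivial_word ([a, b, c, d] @ [a, b, c, d])"
    have 1: "trivial_word ([b, c, d, a] @ [b, c, d, a])" using trivial_word_square_rotate[of a "[b, c, d]"] 0 by simp
    have 2: "trivial_word ([c, d, a, b] @ [c, d, a, b])" using trivial_word_square_rotate[of b "[c, d, a]"] 1 by simp
    have 3: "trivial_word ([d, a, b, c] @ [d, a, b, c])" using trivial_word_square_rotate[of c "[d, a, b]"] 2 by simp
    show ?thesis
      using 1 2 3 trivial_word_square_rev[OF 0] trivial_word_square_rev[OF 1] trivial_word_square_rev[OF 2] trivial_word_square_rev[OF 3] by simp
  qed
  have o: "trivial_word ([3, 1, 2, 4] @ [3, 1, 2, 4])" "trivial_word ([3, 2, 1, 4] @ [3, 2, 1, 4])" "trivial_word ([3, 1, 4, 2] @ [3, 1, 4, 2])"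
    using octagons by simp_all
  have "length is = card (UNIV :: 4 set)" using assms distinct_card by metis
  then have "length is = 4" by simp
  then obtain a b c d where abcd: "is = [a, b, c, d]"
    by (auto simp: length_Suc_conv numeral_eq_Suc)
  have "distinct [a, b, c, d]" using assms(1) abcd by simp
  then show ?thesis
    using o r[OF o(1)] r[OF o(2)] r[OF o(3)] exhaust_4[of a] exhaust_4[of b] exhaust_4[of c] exhaust_4[of d]
    unfolding abcd by (elim disjE) simp_all
qed

section \<open>From crossings of walls to the presentation of the group\<close>

definition T :: "4 \<Rightarrow> 4 set" where "T i = - {i}"

definition letter :: "4 set \<Rightarrow> 4" where "letter m = (THE i. m = - {i})"

lemma T_inject [simp]: "T i = T j \<longleftrightarrow> i = j"
  by (auto simp: T_def)

lemma letter_T [simp]: "letter (T i) = i"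
  by (simp add: letter_def T_def)

lemma triples_T: "triples = range T"
proof -
  have "card m = 3 \<longleftrightarrow> card (- m) = 1" for m :: "4 set"
  proof -
    have "card m \<le> 4" using card_mono[of "UNIV :: 4 set" m] by simp
    moreover have "card (- m) = 4 - card m"
      unfolding Compl_eq_Diff_UNIV by (subst card_Diff_subset) simp_all
    ultimately show ?thesis by arith
  qed
  then show ?thesis
    unfolding triples_def T_def by (auto simp: card_1_singleton_iff)
qed

lemma T_triples [simp]: "T i \<in> triples"
  by (simp add: triples_T)

lemma T_letter: "m \<in> triples \<Longrightarrow> T (letter m) = m"
  by (auto simp: triples_T)

abbreviation "relG \<equiv> pres_rel triples G43_relators"

definition letters :: "4 set word \<Rightarrow> 4 list" where "letters w = map (letter \<circ> fst) w"

definition triples_word :: "4 list \<Rightarrow> 4 set word" where "triples_word is = positive_word (map T is)"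

lemma G43_relators_words: "G43_relators \<subseteq> words triples"
proof -
  have "positive_word ms \<in> words triples" if "set ms \<subseteq> triples" for ms
    using that by (auto simp: positive_word_def words_def)
  then show ?thesis unfolding G43_relators_def by fastforce
qed

lemma relG_equiv: "equiv (words triples) relG"
  by (rule equiv_pres_rel[OF G43_relators_words])

lemma letters_simps [simp]: "letters [] = []" "letters (x # w) = letter (fst x) # letters w" "letters (u @ w) = letters u @ letters w" "letters (triples_word is) = is"
  by (auto simp: letters_def triples_word_def positive_word_def comp_def)

lemma triples_word_words [simp]: "triples_word is \<in> words triples"
  by (auto simp: triples_word_def positive_word_def words_def)

lemma triples_word_append: "triples_word (is @ js) = triples_word is @ triples_word js"
  by (simp add: triples_word_def positive_word_def)

lemma trivial_word_insert:
  assumes "trivial_word is" shows "edge_word v (js @ is @ ks) = edge_word v (js @ ks)" "act_word v (js @ is @ ks) = act_word v (js @ ks)"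
proof -
  have "edge_word (act_word v js) is = \<one>\<^bsub>P\<^esub>" "act_word (act_word v js) is = act_word v js"
    using assms unfolding trivial_word_def by blast+
  then show "edge_word v (js @ is @ ks) = edge_word v (js @ ks)" "act_word v (js @ is @ ks) = act_word v (js @ ks)"
    by (simp_all add: edge_word_append edge_word_carrier)
qed

lemma trivial_word_pair: "trivial_word [i, i]"
  by (simp add: trivial_word_def edge_carrier edge_edge)

text \<open>This makes the map to the fundamental group well defined. Since \<open>letters\<close>
  forgets exponents, a free cancellation and a relator \<open>m m\<close> both become a repeated
  letter, that is, a wall crossed and crossed back.\<close>

lemma relG_invariant:
  assumes "(u, w) \<in> relG"
  shows "edge_word v (letters u) = edge_word v (letters w) \<and> act_word v (letters u) = act_word v (letters w)"
  using assms
proof (induction arbitrary: v)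
  case (cancel u w m b)
  then show ?case using trivial_word_insert[OF trivial_word_pair[of "letter m"], of v "letters u" "letters w"] by simp
next
  case (relator u w r)
  have "trivial_word (letters r)"
  proof -
    from relator(3) consider m where "m \<in> triples" "r = positive_word [m, m]"
      | ms where "distinct ms" "set ms = triples" "r = positive_word (ms @ ms)"
      unfolding G43_relators_def by blast
    then show ?thesis
    proof cases
      case 1 then show ?thesis using trivial_word_pair by (simp add: positive_word_def)
    next
      case 2
      have "map T (map letter ms) = ms" using 2(2) T_letter by (auto intro: map_idI)
      moreover have "distinct (map letter ms)" using 2(1,2) by (auto simp: distinct_map triples_T inj_on_def)
      moreover have "set (map letter ms) = UNIV" using 2(2) by (auto simp: triples_T image_image)
      ultimately show ?thesis
        using trivial_word_ordering[of "map letter ms"] 2(3) by (simp add: letters_def positive_word_def comp_def)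
    qed
  qed
  from trivial_word_insert[OF this] show ?case by simp
qed auto

text \<open>The relators \<open>m m\<close> make every generator its own inverse, so each formal
  inverse can be replaced by the generator.\<close>

lemma relG_positive:
  assumes "w \<in> words triples" shows "(w, triples_word (letters w)) \<in> relG"
  using assms
proof (induction w)
  case Nil
  then show ?case by (simp add: triples_word_def positive_word_def pres_rel.refl)
next
  case (Cons x w)
  obtain m b where x: "x = (m, b)" by (cases x)
  have m: "m \<in> triples" "w \<in> words triples" using Cons.prems by (auto simp: x)
  have "([(m, b)], [(m, True)]) \<in> relG"
  proof (cases b)
    case True
    then show ?thesis using m by (auto intro: pres_rel.refl)
  next
    case False
    have "positive_word [m, m] \<in> G43_relators" using m by (auto simp: G43_relators_def)
    from pres_rel.relator[OF _ words_Nil this, of "[(m, False)]"]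
    have "([(m, False), (m, True), (m, True)], [(m, False)]) \<in> relG"
      using m by (simp add: positive_word_def)
    moreover have "([(m, False), (m, True), (m, True)], [(m, True)]) \<in> relG"
      using pres_rel.cancel[of "[]" triples "[(m, True)]" m False G43_relators] m by simp
    ultimately show ?thesis using False by (auto intro: pres_rel.trans[OF pres_rel.sym])
  qed
  from pres_rel_append_right[OF G43_relators_words this m(2)]
  have 1: "((m, b) # w, (m, True) # w) \<in> relG" by simp
  have "([(m, True)] @ w, [(m, True)] @ triples_word (letters w)) \<in> relG"
    by (rule pres_rel_append_left[OF G43_relators_words Cons.IH[OF m(2)]]) (use m in simp)
  then have "((m, True) # w, triples_word (letters (x # w))) \<in> relG"
    using T_letter[OF m(1)] by (simp add: x triples_word_def positive_word_def)
  from pres_rel.trans[OF 1 this[unfolded x]] show ?case unfolding x .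
qed

definition cl :: "4 list \<Rightarrow> 4 set word set" where "cl is = relG `` {triples_word is}"

lemma cl_G43_element: "cl is = G43_element (map T is)"
  by (simp add: cl_def G43_element_def triples_word_def)

lemma G43_element_cl: "set ms \<subseteq> triples \<Longrightarrow> G43_element ms = cl (map letter ms)"
  unfolding cl_G43_element by (rule arg_cong[where f = G43_element]) (auto simp: T_letter intro!: map_idI[symmetric])

lemma G43_carrier: "A \<in> carrier G43 \<longleftrightarrow> (\<exists>is. A = cl is)"
proof
  assume "A \<in> carrier G43"
  then obtain w where w: "w \<in> words triples" "A = relG `` {w}"
    by (auto simp: G43_def presented_group_def elim: quotientE)
  then have "A = cl (letters w)"
    unfolding cl_def using equiv_class_eq[OF relG_equiv relG_positive] by blast
  then show "\<exists>is. A = cl is" ..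
qed (auto simp: G43_def presented_group_def cl_def intro: quotientI)

lemma cl_carrier [simp]: "cl is \<in> carrier G43"
  using G43_carrier by blast

lemma cl_mult: "cl is \<otimes>\<^bsub>G43\<^esub> cl js = cl (is @ js)"
  unfolding G43_def cl_def triples_word_append by (rule presented_group_mult[OF G43_relators_words]) simp_all

lemma cl_one: "\<one>\<^bsub>G43\<^esub> = cl []"
  by (simp add: G43_def presented_group_def cl_def triples_word_def positive_word_def)

lemma cl_eq_iff: "cl is = cl js \<longleftrightarrow> (triples_word is, triples_word js) \<in> relG"
  unfolding cl_def using eq_equiv_class_iff[OF relG_equiv] by simp

lemma cl_eq_invariant: "cl is = cl js \<Longrightarrow> edge_word v is = edge_word v js \<and> act_word v is = act_word v js"
  using relG_invariant[of "triples_word is" "triples_word js" v] by (simp add: cl_eq_iff)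

lemma cl_pair: "cl [i, i] = \<one>\<^bsub>G43\<^esub>"
proof -
  have "positive_word [T i, T i] \<in> G43_relators" by (auto simp: G43_relators_def)
  from pres_rel.relator[OF words_Nil words_Nil this] show ?thesis
    unfolding cl_one cl_eq_iff by (simp add: triples_word_def positive_word_def)
qed

lemma cl_ordering:
  assumes "distinct is" "set is = (UNIV :: 4 set)"
  shows "cl (is @ is) = \<one>\<^bsub>G43\<^esub>"
proof -
  have "set (map T is) = triples" "distinct (map T is)" using assms by (auto simp: triples_T distinct_map inj_on_def)
  then have "positive_word (map T is @ map T is) \<in> G43_relators" by (auto simp: G43_relators_def)
  from pres_rel.relator[OF words_Nil words_Nil this] show ?thesis
    unfolding cl_one cl_eq_iff by (simp add: triples_word_def positive_word_def)
qed

section \<open>The stabilizer of the base chamber\<close>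

abbreviation "v0 \<equiv> (False, False)"

definition base_stab :: "4 set word set set" where
  "base_stab = {cl is | is. act_word v0 is = v0}"

definition word_of :: "4 set word set \<Rightarrow> 4 list" where "word_of A = (SOME is. A = cl is)"

text \<open>Evaluated on a chosen word; \<open>word_of_cl\<close> shows that the choice does not
  affect the value.\<close>

definition Eg where "Eg A = edge_word v0 (word_of A)"
definition ag where "ag A = act_word v0 (word_of A)"

lemma word_of_cl: "edge_word v (word_of (cl is)) = edge_word v is" "act_word v (word_of (cl is)) = act_word v is"
proof -
  have "cl is = cl (word_of (cl is))" unfolding word_of_def by (rule someI) simp
  from cl_eq_invariant[OF this, of v] show "edge_word v (word_of (cl is)) = edge_word v is" "act_word v (word_of (cl is)) = act_word v is" by auto
qed

lemma base_stab_iff: "A \<in> base_stab \<longleftrightarrow> A \<in> carrier G43 \<and> ag A = v0"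
  unfolding base_stab_def G43_carrier ag_def using word_of_cl(2) by auto

lemma ag_cl: "ag (cl is) = act_word v0 is" and Eg_cl: "Eg (cl is) = edge_word v0 is"
  by (simp_all add: ag_def Eg_def word_of_cl)

lemma cl_inv: "inv\<^bsub>G43\<^esub> cl is = cl (rev is)"
proof -
  have "cl (rev is @ is) = \<one>\<^bsub>G43\<^esub>"
  proof (induction "is")
    case (Cons i "is")
    have "cl (rev (i # is) @ i # is) = cl (rev is) \<otimes>\<^bsub>G43\<^esub> cl [i, i] \<otimes>\<^bsub>G43\<^esub> cl is"
      by (simp add: cl_mult)
    then show ?case using Cons group.is_monoid[OF group_G43] by (simp add: cl_pair cl_mult monoid.r_one)
  qed (simp add: cl_one)
  then show ?thesis
    by (intro group.inv_equality[OF group_G43]) (simp_all add: cl_mult)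
qed

lemma act_word_rev: "act_word (act_word v is) (rev is) = v"
  using edge_word_rev[of v "is"] by simp

lemma subgroup_base_stab: "subgroup base_stab G43"
proof (rule group.subgroupI[OF group_G43])
  show "base_stab \<subseteq> carrier G43" using base_stab_iff by blast
  show "base_stab \<noteq> {}" unfolding base_stab_def by (auto intro: exI[of _ "[]"])
  fix A assume "A \<in> base_stab"
  then obtain "is" where A: "A = cl is" "act_word v0 is = v0" unfolding base_stab_def by blast
  then show "inv\<^bsub>G43\<^esub> A \<in> base_stab" using act_word_rev[of v0 "is"] unfolding base_stab_def by (auto simp: cl_inv)
  fix B assume "B \<in> base_stab"
  then obtain js where "B = cl js" "act_word v0 js = v0" unfolding base_stab_def by blast
  with A show "A \<otimes>\<^bsub>G43\<^esub> B \<in> base_stab" unfolding base_stab_def by (auto simp: cl_mult intro!: exI[of _ "is @ js"])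
qed

text \<open>Words act on chambers from the right: the left factor first returns to
  \<open>v0\<close>, after which the coset representative decides the chamber. The right cosets are
  therefore the fibres of \<open>ag\<close>.\<close>

lemma coset_base_stab:
  assumes "A \<in> carrier G43"
  shows "base_stab #>\<^bsub>G43\<^esub> A = {B \<in> carrier G43. ag B = ag A}"
proof -
  obtain "is" where A: "A = cl is" using assms G43_carrier by blast
  show ?thesis
  proof (intro subset_antisym subsetI)
    fix B assume "B \<in> base_stab #>\<^bsub>G43\<^esub> A"
    then obtain js where "act_word v0 js = v0" "B = cl (js @ is)"
      unfolding r_coset_def base_stab_def A by (auto simp: cl_mult)
    then show "B \<in> {B \<in> carrier G43. ag B = ag A}" by (simp add: A ag_cl)
  next
    fix B assume "B \<in> {B \<in> carrier G43. ag B = ag A}"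
    then obtain js where B: "B = cl js" "act_word v0 js = act_word v0 is" using G43_carrier A by (auto simp: ag_cl)
    have "cl (js @ rev is) \<in> base_stab" unfolding base_stab_def using B(2) act_word_rev[of v0 "is"] by auto
    moreover have "cl (js @ rev is) \<otimes>\<^bsub>G43\<^esub> A = B"
      unfolding A B(1) using group.inv_solve_right[OF group_G43] 
      by (simp add: cl_mult[symmetric] cl_inv[symmetric] group.inv_closed[OF group_G43] monoid.m_assoc[OF group.is_monoid[OF group_G43]]
          group.l_inv[OF group_G43] monoid.r_one[OF group.is_monoid[OF group_G43]])
    ultimately show "B \<in> base_stab #>\<^bsub>G43\<^esub> A" unfolding r_coset_def by blast
  qed
qed

lemma card_rcosets_base_stab: "card (rcosets\<^bsub>G43\<^esub> base_stab) = 4"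
proof -
  define K where "K v = {B \<in> carrier G43. ag B = v}" for v
  have ex: "\<exists>is. act_word v0 is = v" for v
  proof -
    have "act_word v0 [] = (False, False)" "act_word v0 [1] = (True, False)" "act_word v0 [2] = (False, True)" "act_word v0 [3] = (True, True)"
      by auto
    then show ?thesis by (metis (full_types) surj_pair)
  qed
  have "rcosets\<^bsub>G43\<^esub> base_stab = range K"
  proof -
    have "rcosets\<^bsub>G43\<^esub> base_stab = (\<lambda>A. base_stab #>\<^bsub>G43\<^esub> A) ` carrier G43" by (auto simp: RCOSETS_def)
    also have "\<dots> = (\<lambda>A. K (ag A)) ` carrier G43" using coset_base_stab by (intro image_cong) (auto simp: K_def)
    also have "\<dots> = K ` (ag ` carrier G43)" by (simp add: image_image)
    also have "ag ` carrier G43 = UNIV"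
    proof -
      have "v \<in> ag ` carrier G43" for v using ex[of v] ag_cl cl_carrier by (metis image_eqI)
      then show ?thesis by blast
    qed
    finally show ?thesis .
  qed
  moreover have "inj K"
  proof (rule injI)
    fix u v assume e: "K u = K v"
    obtain "is" where "act_word v0 is = u" using ex by blast
    then have "cl is \<in> K u" by (simp add: K_def ag_cl)
    then have "cl is \<in> K v" unfolding e .
    then have "ag (cl is) = v" by (simp add: K_def)
    then show "u = v" using \<open>act_word v0 is = u\<close> by (simp add: ag_cl)
  qed
  ultimately have "card (rcosets\<^bsub>G43\<^esub> base_stab) = card (UNIV :: (bool \<times> bool) set)" by (simp add: card_image)
  then show ?thesis by (simp add: card_prod)
qed

lemma Eg_hom: "Eg \<in> hom (G43\<lparr>carrier := base_stab\<rparr>) P"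
proof (rule homI)
  show "Eg A \<in> carrier P" for A by (simp add: Eg_def edge_word_carrier)
  fix A B assume "A \<in> carrier (G43\<lparr>carrier := base_stab\<rparr>)" "B \<in> carrier (G43\<lparr>carrier := base_stab\<rparr>)"
  then obtain "is" js where "A = cl is" "act_word v0 is = v0" "B = cl js" unfolding base_stab_def by auto
  then show "Eg (A \<otimes>\<^bsub>G43\<lparr>carrier := base_stab\<rparr>\<^esub> B) = Eg A \<odot> Eg B" by (simp add: cl_mult Eg_cl edge_word_append)
qed

lemma Eg_surj:
  assumes "x \<in> carrier P" shows "x \<in> Eg ` base_stab"
proof -
  obtain p where p: "p \<in> loops_at X base_config" "x = homotopy_rel X base_config `` {p}"
    using assms by (auto simp: fundamental_group_def elim: quotientE)
  then have pi: "path_in X base_config base_config p" by (simp add: loops_at_def path_in_def)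
  have b: "base_config \<in> Cc v0" using chamber_pt_in[of v0] by (simp add: chamber_pt_base)
  have "readable p" using readable_X[OF pi] subsetD[OF Cc_Ss(3) b] by blast
  then obtain "is" where "v0 = act_word v0 is" "Fhub p = edge_word v0 is"
    using pi chamber_of[OF b] unfolding readable_def path_in_def by auto
  moreover have "Fhub p = x" using Fhub_loop[OF pi] PF.F_loop[OF pi] p(2) by simp
  ultimately show ?thesis unfolding base_stab_def by (intro image_eqI[of _ _ "cl is"]) (auto simp: Eg_cl)
qed

section \<open>Monodromy\<close>

text \<open>The frame jumps by its letter across wall \<open>i\<close> and nowhere else. Points on
  the wall must be counted to one side, and the weak inequalities match those of
  \<open>cell_frame\<close>: near wall 3 the condition \<open>sA \<le> 0\<close> means that the
  height of \<open>x_4\<close> is nonnegative, near wall 4 that the height of \<open>x_3\<close> is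
  nonpositive.\<close>

definition star_frame :: "4 \<Rightarrow> rp2^4 \<Rightarrow> 4 set word set" where
  "star_frame i x = (if (if i = 1 then sA (v3 x) (v4 x) \<ge> 0 else if i = 2 then sB (v3 x) (v4 x) \<ge> 0
     else sA (v3 x) (v4 x) \<le> 0) then cl [i] else cl [])"

definition stars :: "4 \<Rightarrow> (rp2^4) set" where "stars i = (\<Union>v. Ss v i)"
definition cells :: "(rp2^4) set" where "cells = (\<Union>e. region (cell e))"

text \<open>The slopes and heights as functions of the configuration. Being quotients they do not
  depend on the representatives, and they are meaningful on the cells, where the first coordinates
  do not vanish.\<close>

definition fs where "fs x = v3 x $ 2 / v3 x $ 1"
definition fs' where "fs' x = v4 x $ 2 / v4 x $ 1"
definition fp where "fp x = v3 x $ 3 / v3 x $ 1"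
definition fq where "fq x = v4 x $ 3 / v4 x $ 1"

abbreviation bt :: "bool \<Rightarrow> 4 \<Rightarrow> 4 list" where "bt b i \<equiv> (if b then [i] else [])"

text \<open>
  The letters crossed on the way to a point of the \<open>(p, q)\<close>-plane from the sector below \<open>p > 0\<close>, \<open>q = 0\<close>,
  counterclockwise if \<open>Q\<close> and clockwise otherwise. The two readings agree opposite to the start
  because of the relator. \<open>r1\<close> and \<open>r2\<close> say whether the slope of the fourth wall is positive and whether it exceeds 1.
\<close>

definition sector_word :: "bool \<Rightarrow> bool \<Rightarrow> bool \<Rightarrow> bool \<Rightarrow> bool \<Rightarrow> bool \<Rightarrow> 4 list" where
  "sector_word r1 r2 Q A B N =
    (if r1 then if r2 then if Q then [3] @ bt A 1 @ bt B 2 @ bt N 4 else bt N 4 @ bt B 2 @ bt A 1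
       else if Q then [3] @ bt B 2 @ bt A 1 @ bt N 4 else bt N 4 @ bt A 1 @ bt B 2
     else if Q then [3] @ bt A 1 @ bt N 4 @ bt B 2 else bt B 2 @ bt N 4 @ bt A 1)"

definition fD where "fD x = fs x * fq x - fs' x * fp x"

text \<open>The inner condition on \<open>fD\<close> coincides with \<open>sB \<ge> 0\<close> near
  wall 2, so that points on this wall are counted as in \<open>star_frame\<close>; the comparison
  with \<open>fst e\<close> turns it into the side of the line as seen from the starting
  sector.\<close>

definition cell_frame :: "bool \<times> bool \<times> bool \<Rightarrow> rp2^4 \<Rightarrow> 4 set word set" where
  "cell_frame e x = cl (sector_word (fst e = fst (snd e)) (snd (snd e) = fst e) (fq x \<ge> 0) (fq x - fp x \<ge> 0)
     (fst e = (if fst e = fst (snd e) then fD x \<ge> 0 else fD x \<le> 0)) (fp x \<le> 0))"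

definition cells_frame where "cells_frame x = cell_frame (fs x > 0, fs' x > 0, fs' x - fs x > 0) x"

lemma cells_frame_cell_frame: "x \<in> region (cell e) \<Longrightarrow> cells_frame x = cell_frame e x"
  by (cases e) (auto simp: cells_frame_def region_def cell_def cell_slopes_def fs_def fs'_def split: if_splits)

definition \<F> where "\<F> = insert (cells, cells_frame) ((\<lambda>i. (stars i, star_frame i)) ` UNIV)"

lemma fx_tendsto:
  assumes "x \<in> region (cell e)"
  shows "(fp \<longlongrightarrow> fp x) (nhds x)" "(fq \<longlongrightarrow> fq x) (nhds x)" "(fD \<longlongrightarrow> fD x) (nhds x)"
    "((\<lambda>x. fq x - fp x) \<longlongrightarrow> fq x - fp x) (nhds x)"
proof -
  have nz: "v3 x $ 1 \<noteq> 0" "v4 x $ 1 \<noteq> 0" using assms by (auto simp: region_def cell_def)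
  have *: "((\<lambda>x. v3 x $ i / v3 x $ 1) \<longlongrightarrow> v3 x $ i / v3 x $ 1) (nhds x)"
    "((\<lambda>x. v4 x $ i / v4 x $ 1) \<longlongrightarrow> v4 x $ i / v4 x $ 1) (nhds x)" for i
  proof -
    have "isCont (\<lambda>u :: (real^3) \<times> (real^3). fst u$i/fst u$1) (v3 x, v4 x)"
      "isCont (\<lambda>u :: (real^3) \<times> (real^3). snd u$i/snd u$1) (v3 x, v4 x)"
      using nz by (auto intro!: continuous_intros)
    then have "((\<lambda>u :: (real^3) \<times> (real^3). fst u$i/fst u$1) \<longlongrightarrow> v3 x$i/v3 x$1) (nhds (v3 x, v4 x))"
      "((\<lambda>u :: (real^3) \<times> (real^3). snd u$i/snd u$1) \<longlongrightarrow> v4 x$i/v4 x$1) (nhds (v3 x, v4 x))"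
      by (auto dest!: tendsto_nhdsI)
    then show "((\<lambda>x. v3 x $ i / v3 x $ 1) \<longlongrightarrow> v3 x $ i / v3 x $ 1) (nhds x)"
      "((\<lambda>x. v4 x $ i / v4 x $ 1) \<longlongrightarrow> v4 x $ i / v4 x $ 1) (nhds x)"
      by (auto intro!: tendsto_rp2_lift[where F = "\<lambda>v w. v$i/v$1"] tendsto_rp2_lift[where F = "\<lambda>v w. w$i/w$1"]
          simp: scale_inv_def)
  qed
  show p: "(fp \<longlongrightarrow> fp x) (nhds x)" and q: "(fq \<longlongrightarrow> fq x) (nhds x)"
    using * unfolding fp_def fq_def by simp_all
  have s: "(fs \<longlongrightarrow> fs x) (nhds x)" "(fs' \<longlongrightarrow> fs' x) (nhds x)"
    using * unfolding fs_def fs'_def by simp_all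
  show "(fD \<longlongrightarrow> fD x) (nhds x)" "((\<lambda>x. fq x - fp x) \<longlongrightarrow> fq x - fp x) (nhds x)"
    unfolding fD_def by (intro tendsto_intros p q s)+
qed

lemma sgn_cases_eventually:
  fixes f :: "'a::topological_space \<Rightarrow> real"
  assumes "(f \<longlongrightarrow> f x) (nhds x)" "f x \<noteq> 0"
  shows "eventually (\<lambda>y. (f y \<ge> 0) = (f x \<ge> 0) \<and> (f y \<le> 0) = (f x \<le> 0) \<and> f y \<noteq> 0) (nhds x)"
  using eventually_pos_iff[OF assms] eventually_nonzero[OF assms]
  by eventually_elim (use assms(2) in auto)

lemma wall_chart:
  assumes "x \<in> region (cell e)"
  shows "v3 x $ 1 * v4 x $ 1 \<noteq> 0" "wall 1 (v3 x) (v4 x) = (v3 x $ 1 * v4 x $ 1) * (fq x - fp x)"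
    "wall 2 (v3 x) (v4 x) = (v3 x $ 1 * v4 x $ 1) * fD x"
    "v3 x $ 3 = v3 x $ 1 * fp x" "v4 x $ 3 = v4 x $ 1 * fq x"
proof -
  have nz: "v3 x $ 1 \<noteq> 0" "v4 x $ 1 \<noteq> 0" using assms by (auto simp: region_def cell_def)
  then show "v3 x $ 1 * v4 x $ 1 \<noteq> 0" "wall 1 (v3 x) (v4 x) = (v3 x $ 1 * v4 x $ 1) * (fq x - fp x)"
    "wall 2 (v3 x) (v4 x) = (v3 x $ 1 * v4 x $ 1) * fD x"
    "v3 x $ 3 = v3 x $ 1 * fp x" "v4 x $ 3 = v4 x $ 1 * fq x"
    by (auto simp: fp_def fq_def fD_def fs_def fs'_def field_simps)
qed

lemma wall_chart_zero:
  assumes "x \<in> region (cell e)"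
  shows "wall 1 (v3 x) (v4 x) = 0 \<longleftrightarrow> fq x - fp x = 0" "wall 2 (v3 x) (v4 x) = 0 \<longleftrightarrow> fD x = 0"
    "wall 3 (v3 x) (v4 x) = 0 \<longleftrightarrow> fq x = 0" "wall 4 (v3 x) (v4 x) = 0 \<longleftrightarrow> fp x = 0"
  using wall_chart[OF assms] by (simp_all del: wall_simps(1,2))

lemma sign_mult_pos:
  fixes k x :: real assumes "k > 0"
  shows "(0 \<le> x * k) = (0 \<le> x)" "(x * k \<le> 0) = (x \<le> 0)"
  using assms by (auto simp: zero_le_mult_iff mult_le_0_iff)

lemma sign_mult_neg:
  fixes k x :: real assumes "k < 0"
  shows "(0 \<le> x * k) = (x \<le> 0)" "(x * k \<le> 0) = (0 \<le> x)"
  using assms by (auto simp: zero_le_mult_iff mult_le_0_iff)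

lemma sign_of_quotient:
  fixes a b m n :: real
  assumes "a * n = b * m" "m > 0" "a \<noteq> 0" "b \<noteq> 0"
  shows "(n > 0) = ((a > 0) = (b > 0))"
proof -
  have "n = b * m / a" using assms(1,3) by (simp add: field_simps)
  then show ?thesis using assms(2-4) by (auto simp: zero_less_divide_iff zero_less_mult_iff mult_less_0_iff)
qed

lemma sAB_chart:
  assumes "x \<in> region (cell e)"
  shows "(sA (v3 x) (v4 x) \<ge> 0) = ((fq x - fp x) * (fp x * fq x) \<ge> 0)"
    "(sA (v3 x) (v4 x) \<le> 0) = ((fq x - fp x) * (fp x * fq x) \<le> 0)"
    "(sB (v3 x) (v4 x) \<ge> 0) = (fD x * (fp x * fq x) \<ge> 0)"
proof -
  note d = wall_chart[OF assms]
  have k: "(v3 x $ 1 * v4 x $ 1)\<^sup>2 > 0" using d(1) by simp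
  have "sA (v3 x) (v4 x) = ((fq x - fp x) * (fp x * fq x)) * (v3 x $ 1 * v4 x $ 1)\<^sup>2"
    "sB (v3 x) (v4 x) = (fD x * (fp x * fq x)) * (v3 x $ 1 * v4 x $ 1)\<^sup>2"
    unfolding sA_def sB_def d(2-) by (simp_all add: power2_eq_square algebra_simps)
  then show "(sA (v3 x) (v4 x) \<ge> 0) = ((fq x - fp x) * (fp x * fq x) \<ge> 0)"
    "(sA (v3 x) (v4 x) \<le> 0) = ((fq x - fp x) * (fp x * fq x) \<le> 0)"
    "(sB (v3 x) (v4 x) \<ge> 0) = (fD x * (fp x * fq x) \<ge> 0)"
    by (simp_all only: sign_mult_pos[OF k])
qed

text \<open>By the relator a product of the four generators is an involution, and the inverse of a
  word of involutions is the reversed word.\<close>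

lemma cl_reverse4:
  assumes "distinct [a, b, c, d]"
  shows "cl [a, b, c, d] = cl [d, c, b, a]"
proof -
  have "card {a, b, c, d} = 4" using assms by simp
  then have "set [a, b, c, d] = UNIV" by (intro card_subset_eq) simp_all
  from cl_ordering[OF assms this]
  have "cl [a, b, c, d] \<otimes>\<^bsub>G43\<^esub> cl [a, b, c, d] = \<one>\<^bsub>G43\<^esub>" by (simp add: cl_mult)
  then have "inv\<^bsub>G43\<^esub> cl [a, b, c, d] = cl [a, b, c, d]"
    by (intro group.inv_equality[OF group_G43]) simp_all
  then show ?thesis by (simp add: cl_inv)
qed

lemma cl_pair_right: "cl (is @ [i, i]) = cl is"
  using cl_mult[of "is" "[i, i]"] cl_pair[of i] group.is_monoid[OF group_G43] by (simp add: monoid.r_one)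

text \<open>Exchanging the two sides of a wall is again a left translation of the frame, because a
  letter squares to the unit and can be inserted in front.\<close>

lemma cl_flip:
  assumes "\<And>b. f b = cl (is @ bt b i)"
  shows "\<exists>js. \<forall>b. f (r = b) = cl (js @ bt b i)"
proof (cases r)
  case True
  then show ?thesis using assms by auto
next
  case False
  have "f (r = b) = cl ((is @ [i]) @ bt b i)" for b
    using assms cl_pair_right False by (cases b) simp_all
  then show ?thesis by blast
qed

text \<open>On one wall away from the origin the slopes and heights determine the bits of the other
  walls, and the letter of this wall comes last in the reading. The list \<open>js\<close> collects
  the letters before it. The next three lemmas treat the other walls alike.\<close>

lemma sector_word_wall1:
  assumes "(s, s') \<in> cell_slopes e" "q = p" "p \<noteq> (0::real)"
  shows "\<exists>js. \<forall>b. cl (sector_word (fst e = fst (snd e)) (snd (snd e) = fst e) (q \<ge> 0) b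
     (fst e = (if fst e = fst (snd e) then s * q - s' * p \<ge> 0 else s * q - s' * p \<le> 0)) (p \<le> 0)) = cl (js @ bt b 1)"
proof -
  have D: "s * q - s' * p = - ((s' - s) * p)" using assms(2) by (simp add: algebra_simps)
  obtain e1 e2 e3 where e: "e = (e1, e2, e3)" by (cases e)
  let ?js = "if p > 0 then if e1 = e2 \<and> e3 \<noteq> e1 then [3, 2] else [3]
     else if e1 = e2 then if e3 = e1 then [4, 2] else [4] else [2, 4]"
  have "\<forall>b. cl (sector_word (e1 = e2) (e3 = e1) (q \<ge> 0) b
     (e1 = (if e1 = e2 then - ((s' - s) * p) \<ge> 0 else - ((s' - s) * p) \<le> 0)) (p \<le> 0)) = cl (?js @ bt b 1)"
    using assms unfolding e cell_slopes_def sector_word_def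
    by (cases "p > 0"; cases e1; cases e2; cases e3)
      (auto simp: zero_le_mult_iff mult_le_0_iff)
  then show ?thesis unfolding D e fst_conv snd_conv by (rule exI)
qed

lemma sector_word_wall3:
  assumes "(s, s') \<in> cell_slopes e" "q = 0" "p \<noteq> (0::real)"
  shows "\<exists>js. \<forall>b. cl (sector_word (fst e = fst (snd e)) (snd (snd e) = fst e) b (q - p \<ge> 0)
     (fst e = (if fst e = fst (snd e) then s * q - s' * p \<ge> 0 else s * q - s' * p \<le> 0)) (p \<le> 0)) = cl (js @ bt b 3)"
proof -
  have D: "s * q - s' * p = - (s' * p)" using assms(2) by (simp add: algebra_simps)
  obtain e1 e2 e3 where e: "e = (e1, e2, e3)" by (cases e)
  let ?js = "if p > 0 then [] else if e1 = e2 then if e3 = e1 then [4, 2, 1] else [4, 1, 2] else [2, 4, 1]"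
  \<comment> \<open>For \<open>p < 0\<close> the bit of wall 3 switches from the clockwise reading
    with three letters to the counterclockwise one with four. Only the relator turns the latter into
    the former followed by 3.\<close>
  have r: "cl [3, 1, 2, 4] = cl [4, 2, 1, 3]" "cl [3, 2, 1, 4] = cl [4, 1, 2, 3]" "cl [3, 1, 4, 2] = cl [2, 4, 1, 3]"
    by (rule cl_reverse4, simp)+
  have "\<forall>b. cl (sector_word (e1 = e2) (e3 = e1) b (q - p \<ge> 0)
     (e1 = (if e1 = e2 then - (s' * p) \<ge> 0 else - (s' * p) \<le> 0)) (p \<le> 0)) = cl (?js @ bt b 3)"
    using assms r unfolding e cell_slopes_def sector_word_def
    by (cases "p > 0"; cases e1; cases e2; cases e3)
      (auto simp: zero_le_mult_iff mult_le_0_iff)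
  then show ?thesis unfolding D e fst_conv snd_conv by (rule exI)
qed

lemma sector_word_wall4:
  assumes "(s, s') \<in> cell_slopes e" "p = 0" "q \<noteq> (0::real)"
  shows "\<exists>js. \<forall>b. cl (sector_word (fst e = fst (snd e)) (snd (snd e) = fst e) (q \<ge> 0) (q - p \<ge> 0)
     (fst e = (if fst e = fst (snd e) then s * q - s' * p \<ge> 0 else s * q - s' * p \<le> 0)) b) = cl (js @ bt b 4)"
proof -
  have D: "s * q - s' * p = s * q" using assms(2) by (simp add: algebra_simps)
  obtain e1 e2 e3 where e: "e = (e1, e2, e3)" by (cases e)
  let ?js = "if q > 0 then if e1 = e2 then if e3 = e1 then [3, 1, 2] else [3, 2, 1] else [3, 1]
    else if e1 = e2 then [] else [2]"
  have "\<forall>b. cl (sector_word (e1 = e2) (e3 = e1) (q \<ge> 0) (q - p \<ge> 0)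
     (e1 = (if e1 = e2 then s * q \<ge> 0 else s * q \<le> 0)) b) = cl (?js @ bt b 4)"
    using assms unfolding e cell_slopes_def sector_word_def
    by (cases "q > 0"; cases e1; cases e2; cases e3)
      (auto simp: zero_le_mult_iff mult_le_0_iff)
  then show ?thesis unfolding D e fst_conv snd_conv by (rule exI)
qed

lemma sector_word_wall2:
  assumes "(s, s') \<in> cell_slopes e" "s * q - s' * p = 0" "p \<noteq> (0::real)"
  shows "\<exists>js. \<forall>b. cl (sector_word (fst e = fst (snd e)) (snd (snd e) = fst e) (q \<ge> 0) (q - p \<ge> 0) b (p \<le> 0)) = cl (js @ bt b 2)"
proof -
  obtain e1 e2 e3 where e: "e = (e1, e2, e3)" by (cases e)
  have s: "s \<noteq> 0" using assms(1) by (auto simp: cell_slopes_def split: if_splits)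
  have q: "q = (s' * p) / s" using assms(2) s by (simp add: field_simps)
  have qp: "q - p = ((s' - s) * p) / s" using s unfolding q by (simp add: field_simps)
  let ?js = "if e1 = e2 then if p > 0 then if e3 = e1 then [3, 1] else [3] else if e3 = e1 then [4] else [4, 1]
    else if p > 0 then [] else [3, 1, 4]"
  have "\<forall>b. cl (sector_word (e1 = e2) (e3 = e1) (q \<ge> 0) (q - p \<ge> 0) b (p \<le> 0)) = cl (?js @ bt b 2)"
    using assms(1,3) unfolding e cell_slopes_def sector_word_def qp unfolding q
    by (cases "p > 0"; cases e1; cases e2; cases e3)
      (auto simp: zero_le_divide_iff zero_le_mult_iff mult_le_0_iff)
  then show ?thesis unfolding e fst_conv snd_conv by (rule exI)
qed

lemma star_frame_bt: "star_frame i x = cl (bt (if i = 1 then sA (v3 x) (v4 x) \<ge> 0 else if i = 2 then sB (v3 x) (v4 x) \<ge> 0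
     else sA (v3 x) (v4 x) \<le> 0) i)"
  by (simp add: star_frame_def)

text \<open>Near \<open>x\<close> the bits of the other walls do not change. The remaining bit is
  the one that defines \<open>star_frame\<close>, on the wall as well as off it, so the two frames
  differ by the fixed prefix \<open>js\<close>.\<close>

lemma wall_compat:
  assumes x: "x \<in> region (cell e)" and i: "wall i (v3 x) (v4 x) = 0" "x \<in> stars i"
  shows "\<exists>js. eventually (\<lambda>y. y \<in> region (cell e) \<longrightarrow> cell_frame e y = cl js \<otimes>\<^bsub>G43\<^esub> star_frame i y) (nhds x)"
proof -
  obtain u where u: "star u i (v3 x) (v4 x)" using i(2) by (auto simp: stars_def region_def)
  then have nz: "wall j (v3 x) (v4 x) \<noteq> 0" if "j \<noteq> i" for j using that by (cases u) (auto simp: star.simps)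
  note k = wall_chart_zero[OF x]
  have word_of: "(fs x, fs' x) \<in> cell_slopes e" using x by (auto simp: region_def cell_def fs_def fs'_def)
  note t = fx_tendsto[OF x]
  note ev = sgn_cases_eventually[OF t(1)] sgn_cases_eventually[OF t(2)] sgn_cases_eventually[OF t(3)]
    sgn_cases_eventually[OF t(4)]
  have evm: "eventually (\<lambda>y. (fp y * fq y > 0) = (fp x * fq x > 0)) (nhds x)"
    "eventually (\<lambda>y. fp y * fq y \<noteq> 0) (nhds x)" if "fp x \<noteq> 0" "fq x \<noteq> 0"
    using eventually_pos_iff[OF tendsto_mult[OF t(1,2)]] eventually_nonzero[OF tendsto_mult[OF t(1,2)]] that by simp_all
  have sq: "fp x * fp x > 0" if "fp x \<noteq> 0" using that not_real_square_gt_zero by blast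
  have sq': "fq x * fq x > 0" if "fq x \<noteq> 0" using that not_real_square_gt_zero by blast
  let ?b = "\<lambda>D. fst e = (if fst e = fst (snd e) then D \<ge> (0::real) else D \<le> 0)"
  consider "i = 1" | "i = 2" | "i = 3" | "i = 4" using exhaust_4[of i] by blast
  then show ?thesis
  proof cases
    case 1
    have z: "fq x - fp x = 0" "fp x \<noteq> 0" "fq x \<noteq> 0" "fD x \<noteq> 0"
      using i(1) nz[of 2] nz[of 3] nz[of 4] unfolding 1 k by simp_all
    obtain js where js: "\<And>b. cl (sector_word (fst e = fst (snd e)) (snd (snd e) = fst e) (fq x \<ge> 0) b (?b (fD x)) (fp x \<le> 0)) = cl (js @ bt b 1)"
      using sector_word_wall1[OF word_of, of "fq x" "fp x"] z unfolding fD_def by auto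
    have pq: "fp x * fq x > 0" using z(1) sq[OF z(2)] by simp
    have "eventually (\<lambda>y. y \<in> region (cell e) \<longrightarrow> cell_frame e y = cl js \<otimes>\<^bsub>G43\<^esub> star_frame i y) (nhds x)"
      using ev(1)[OF z(2)] ev(2)[OF z(3)] ev(3)[OF z(4)] evm(1)[OF z(2,3)]
    proof eventually_elim
      case (elim y)
      have E: "(fq y \<ge> 0) = (fq x \<ge> 0)" "(fD y \<ge> 0) = (fD x \<ge> 0)" "(fD y \<le> 0) = (fD x \<le> 0)"
        "(fp y \<le> 0) = (fp x \<le> 0)" and pos: "fp y * fq y > 0" using elim pq by blast+
      show ?case
      proof
        assume y: "y \<in> region (cell e)"
        show "cell_frame e y = cl js \<otimes>\<^bsub>G43\<^esub> star_frame i y"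
          unfolding cell_frame_def E js star_frame_bt 1 sAB_chart[OF y] sign_mult_pos[OF pos] cl_mult by simp
      qed
    qed
    then show ?thesis by (rule exI)
  next
    case 2
    have z: "fD x = 0" "fp x \<noteq> 0" "fq x \<noteq> 0" "fq x - fp x \<noteq> 0"
      using i(1) nz[of 1] nz[of 3] nz[of 4] unfolding 2 k by simp_all
    obtain js0 where js0: "\<And>b. cl (sector_word (fst e = fst (snd e)) (snd (snd e) = fst e) (fq x \<ge> 0) (fq x - fp x \<ge> 0) b (fp x \<le> 0)) = cl (js0 @ bt b 2)"
      using sector_word_wall2[OF word_of, of "fq x" "fp x"] z unfolding fD_def by auto
    obtain js where js: "\<And>b. cl (sector_word (fst e = fst (snd e)) (snd (snd e) = fst e) (fq x \<ge> 0) (fq x - fp x \<ge> 0) (fst e = b) (fp x \<le> 0)) = cl (js @ bt b 2)"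
      using cl_flip[OF js0, of "fst e"] by blast
    have fs: "fs x \<noteq> 0" "fs' x \<noteq> 0" "(fs x > 0) = fst e" "(fs' x > 0) = fst (snd e)"
      using word_of by (auto simp: cell_slopes_def split: if_splits)
    \<comment> \<open>On wall 2 the quotient of the heights equals the quotient of the slopes, so
      the product of the heights is positive exactly when the slopes have equal signs.\<close>
    have "fs x * (fp x * fq x) = fs' x * (fp x * fp x)" using z(1) unfolding fD_def by (simp add: algebra_simps)
    then have pq: "(fp x * fq x > 0) = (fst e = fst (snd e))"
      unfolding fs(3,4)[symmetric] using sq[OF z(2)] fs(1,2) by (rule sign_of_quotient)
    have "eventually (\<lambda>y. y \<in> region (cell e) \<longrightarrow> cell_frame e y = cl js \<otimes>\<^bsub>G43\<^esub> star_frame i y) (nhds x)"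
      using ev(1)[OF z(2)] ev(2)[OF z(3)] ev(4)[OF z(4)] evm[OF z(2,3)]
    proof eventually_elim
      case (elim y)
      have E: "(fq y \<ge> 0) = (fq x \<ge> 0)" "(fq y - fp y \<ge> 0) = (fq x - fp x \<ge> 0)"
        "(fp y \<le> 0) = (fp x \<le> 0)" using elim by blast+
      have B: "(if fst e = fst (snd e) then fD y \<ge> 0 else fD y \<le> 0) = (fD y * (fp y * fq y) \<ge> 0)"
      proof (cases "fst e = fst (snd e)")
        case True
        then have "fp y * fq y > 0" using elim pq by blast
        then show ?thesis using True by (simp only: sign_mult_pos if_True simp_thms)
      next
        case False
        then have "\<not> fp y * fq y > 0" "fp y * fq y \<noteq> 0" using elim pq by blast+
        then have "fp y * fq y < 0" by linarith
        then show ?thesis using False by (simp only: sign_mult_neg if_False simp_thms)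
      qed
      show ?case
      proof
        assume y: "y \<in> region (cell e)"
        show "cell_frame e y = cl js \<otimes>\<^bsub>G43\<^esub> star_frame i y"
          unfolding cell_frame_def E B js star_frame_bt 2 sAB_chart[OF y]  cl_mult by simp
      qed
    qed
    then show ?thesis by (rule exI)
  next
    case 3
    have z: "fq x = 0" "fp x \<noteq> 0" "fD x \<noteq> 0" "fq x - fp x \<noteq> 0"
      using i(1) nz[of 1] nz[of 2] nz[of 4] unfolding 3 k by simp_all
    obtain js where js: "\<And>b. cl (sector_word (fst e = fst (snd e)) (snd (snd e) = fst e) b (fq x - fp x \<ge> 0) (?b (fD x)) (fp x \<le> 0)) = cl (js @ bt b 3)"
      using sector_word_wall3[OF word_of, of "fq x" "fp x"] z unfolding fD_def by auto
    have "(fq x - fp x) * fp x < 0" using z(1) sq[OF z(2)] by simp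
    moreover have "((\<lambda>y. (fq y - fp y) * fp y) \<longlongrightarrow> (fq x - fp x) * fp x) (nhds x)" by (intro tendsto_mult t)
    ultimately have "eventually (\<lambda>y. (fq y - fp y) * fp y < 0) (nhds x)" by (intro order_tendstoD)
    then have "eventually (\<lambda>y. y \<in> region (cell e) \<longrightarrow> cell_frame e y = cl js \<otimes>\<^bsub>G43\<^esub> star_frame i y) (nhds x)"
      using ev(1)[OF z(2)] ev(3)[OF z(3)] ev(4)[OF z(4)]
    proof eventually_elim
      case (elim y)
      have E: "(fD y \<ge> 0) = (fD x \<ge> 0)" "(fD y \<le> 0) = (fD x \<le> 0)" "(fp y \<le> 0) = (fp x \<le> 0)"
        "(fq y - fp y \<ge> 0) = (fq x - fp x \<ge> 0)" using elim by blast+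
      have m: "(fq y - fp y) * (fp y * fq y) = fq y * ((fq y - fp y) * fp y)" by simp
      have B: "((fq y - fp y) * (fp y * fq y) \<le> 0) = (fq y \<ge> 0)"
        unfolding m by (rule sign_mult_neg(2)[OF elim(1)])
      show ?case
      proof
        assume y: "y \<in> region (cell e)"
        show "cell_frame e y = cl js \<otimes>\<^bsub>G43\<^esub> star_frame i y"
          unfolding cell_frame_def E js star_frame_bt 3 sAB_chart[OF y] B cl_mult by simp
      qed
    qed
    then show ?thesis by (rule exI)
  next
    case 4
    have z: "fp x = 0" "fq x \<noteq> 0" "fD x \<noteq> 0" "fq x - fp x \<noteq> 0"
      using i(1) nz[of 1] nz[of 2] nz[of 3] unfolding 4 k by simp_all
    obtain js where js: "\<And>b. cl (sector_word (fst e = fst (snd e)) (snd (snd e) = fst e) (fq x \<ge> 0) (fq x - fp x \<ge> 0) (?b (fD x)) b) = cl (js @ bt b 4)"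
      using sector_word_wall4[OF word_of, of "fp x" "fq x"] z unfolding fD_def by auto
    have "(fq x - fp x) * fq x > 0" using z(1) sq'[OF z(2)] by simp
    moreover have "((\<lambda>y. (fq y - fp y) * fq y) \<longlongrightarrow> (fq x - fp x) * fq x) (nhds x)" by (intro tendsto_mult t)
    ultimately have "eventually (\<lambda>y. (fq y - fp y) * fq y > 0) (nhds x)" by (intro order_tendstoD)
    then have "eventually (\<lambda>y. y \<in> region (cell e) \<longrightarrow> cell_frame e y = cl js \<otimes>\<^bsub>G43\<^esub> star_frame i y) (nhds x)"
      using ev(2)[OF z(2)] ev(3)[OF z(3)] ev(4)[OF z(4)]
    proof eventually_elim
      case (elim y)
      have E: "(fD y \<ge> 0) = (fD x \<ge> 0)" "(fD y \<le> 0) = (fD x \<le> 0)" "(fq y \<ge> 0) = (fq x \<ge> 0)"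
        "(fq y - fp y \<ge> 0) = (fq x - fp x \<ge> 0)" using elim by blast+
      have m: "(fq y - fp y) * (fp y * fq y) = fp y * ((fq y - fp y) * fq y)" by simp
      have B: "((fq y - fp y) * (fp y * fq y) \<le> 0) = (fp y \<le> 0)"
        unfolding m by (rule sign_mult_pos(2)[OF elim(1)])
      show ?case
      proof
        assume y: "y \<in> region (cell e)"
        show "cell_frame e y = cl js \<otimes>\<^bsub>G43\<^esub> star_frame i y"
          unfolding cell_frame_def E js star_frame_bt 4 sAB_chart[OF y] B cl_mult by simp
      qed
    qed
    then show ?thesis by (rule exI)
  qed
qed

lemma cells_frame_locally_constant:
  assumes "x \<in> region (cell e)" "x \<in> Dd"
  shows "eventually (\<lambda>y. y \<in> region (cell e) \<longrightarrow> cell_frame e y = cell_frame e x) (nhds x)"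
proof -
  have n: "wall j (v3 x) (v4 x) \<noteq> 0" for j using assms(2) by (auto simp: region_def nonsing_def)
  have z: "fq x - fp x \<noteq> 0" "fD x \<noteq> 0" "fq x \<noteq> 0" "fp x \<noteq> 0" using n unfolding wall_chart_zero[OF assms(1), symmetric] by blast+
  note t = fx_tendsto[OF assms(1)]
  show ?thesis
    using sgn_cases_eventually[OF t(1) z(4)] sgn_cases_eventually[OF t(2) z(3)] sgn_cases_eventually[OF t(3) z(2)]
      sgn_cases_eventually[OF t(4) z(1)]
    by eventually_elim (simp only: cell_frame_def simp_thms if_True if_False)
qed

lemma chamber_eq_star: "chamber v p q \<longleftrightarrow> star v 1 p q \<and> star v 2 p q"
  by (cases v) (auto simp: star_iff forall_4)

lemma chamber_open: "x \<in> Cc v \<Longrightarrow> eventually (\<lambda>y. y \<in> X \<longrightarrow> y \<in> Cc v) (nhds x)"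
proof -
  have e: "Cc v = Ss v 1 \<inter> Ss v 2" by (auto simp: region_def chamber_eq_star)
  assume "x \<in> Cc v"
  then have "x \<in> Ss v 1" "x \<in> Ss v 2" unfolding e by auto
  from star_open[OF this(1)] star_open[OF this(2)] show ?thesis unfolding e by eventually_elim blast
qed

lemma star_frame_Cc:
  assumes "x \<in> Cc v"
  shows "star_frame i x = (if (if i = 1 then fst v else if i = 2 then snd v else \<not> fst v) then cl [i] else cl [])"
proof -
  obtain a b where v: "v = (a, b)" by (cases v)
  have c: "chamber v (v3 x) (v4 x)" using assms by (simp add: region_def)
  then have n: "sA (v3 x) (v4 x) \<noteq> 0" "sB (v3 x) (v4 x) \<noteq> 0" unfolding v by (auto simp: forall_4 sA_def sB_def)
  have "(sA (v3 x) (v4 x) > 0) = a" "(sB (v3 x) (v4 x) > 0) = b" using c unfolding v by auto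
  then have "(sA (v3 x) (v4 x) \<ge> 0) = a" "(sB (v3 x) (v4 x) \<ge> 0) = b" "(sA (v3 x) (v4 x) \<le> 0) = (\<not> a)"
    using n by auto
  then show ?thesis unfolding star_frame_def v by simp
qed

lemma star_frame_locally_constant:
  assumes "x \<in> Dd" shows "eventually (\<lambda>y. y \<in> X \<longrightarrow> star_frame i y = star_frame i x) (nhds x)"
proof -
  obtain v where v: "x \<in> Cc v" using Dd_Cc[OF assms] by blast
  from chamber_open[OF v] show ?thesis by eventually_elim (simp add: star_frame_Cc[OF v] star_frame_Cc)
qed

lemma stars_open: "x \<in> stars i \<Longrightarrow> eventually (\<lambda>y. y \<in> X \<longrightarrow> y \<in> stars i) (nhds x)"
proof -
  assume "x \<in> stars i"
  then obtain v where "x \<in> Ss v i" unfolding stars_def by blast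
  from star_open[OF this] show ?thesis unfolding stars_def by eventually_elim blast
qed

lemma cells_open: "x \<in> cells \<Longrightarrow> eventually (\<lambda>y. y \<in> X \<longrightarrow> y \<in> cells) (nhds x)"
proof -
  assume "x \<in> cells"
  then obtain e where "x \<in> region (cell e)" unfolding cells_def by blast
  from cell_open[OF this] show ?thesis unfolding cells_def by eventually_elim blast
qed

lemma G43_right_quotient: "A \<in> carrier G43 \<Longrightarrow> B \<in> carrier G43 \<Longrightarrow> \<exists>C\<in>carrier G43. B = C \<otimes>\<^bsub>G43\<^esub> A"
  using group.inv_solve_right[OF group_G43] 
  by (intro bexI[of _ "B \<otimes>\<^bsub>G43\<^esub> inv\<^bsub>G43\<^esub> A"])
    (simp_all add: group.inv_closed[OF group_G43] monoid.m_assoc[OF group.is_monoid[OF group_G43]]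
      monoid.m_closed[OF group.is_monoid[OF group_G43]]
          group.l_inv[OF group_G43] monoid.r_one[OF group.is_monoid[OF group_G43]])

lemma cells_frame_carrier [simp]: "cells_frame x \<in> carrier G43" and star_frame_carrier [simp]: "star_frame i x \<in> carrier G43"
  by (simp_all add: cells_frame_def cell_frame_def star_frame_def)

lemma \<F>_cases: "(U, w) \<in> \<F> \<Longrightarrow> (U = cells \<and> w = cells_frame) \<or> (\<exists>i. U = stars i \<and> w = star_frame i)"
  unfolding \<F>_def by blast

lemma \<F>_open:
  assumes "(U, w) \<in> \<F>" "x \<in> U"
  shows "eventually (\<lambda>y. y \<in> X \<longrightarrow> y \<in> U) (nhds x)"
  using \<F>_cases[OF assms(1)]
proof (elim disjE exE conjE)
  assume "U = cells" then show ?thesis using cells_open[of x] assms(2) by simp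
next
  fix i assume "U = stars i" then show ?thesis using stars_open[of x i] assms(2) by simp
qed

lemma Dd_compat:
  assumes "(U, w) \<in> \<F>" "x \<in> U" "x \<in> Dd"
  shows "eventually (\<lambda>y. y \<in> X \<longrightarrow> y \<in> U \<and> w y = w x) (nhds x)"
proof -
  from assms(1) consider "U = cells" "w = cells_frame" | i where "U = stars i" "w = star_frame i" by (auto simp: \<F>_def)
  then show ?thesis
  proof cases
    case 1
    then obtain e where e: "x \<in> region (cell e)" using assms(2) by (auto simp: cells_def)
    from cells_frame_locally_constant[OF e assms(3)] cell_open[OF e] show ?thesis
    proof eventually_elim
      case (elim y)
      show ?case
      proof
        assume "y \<in> X"
        with elim(2) have y: "y \<in> region (cell e)" by blast
        then have "y \<in> cells" unfolding cells_def by blast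
        moreover have "cells_frame y = cells_frame x" unfolding cells_frame_cell_frame[OF y] cells_frame_cell_frame[OF e] using elim(1) y by blast
        ultimately show "y \<in> U \<and> w y = w x" unfolding 1 by blast
      qed
    qed
  next
    case 2
    from stars_open[OF assms(2)[unfolded 2]] star_frame_locally_constant[OF assms(3), of i] show ?thesis
      unfolding 2 by eventually_elim blast
  qed
qed

lemma stars_cells_compat:
  assumes "x \<in> stars i" "x \<in> cells" "x \<notin> Dd"
  shows "\<exists>c\<in>carrier G43. eventually (\<lambda>y. y \<in> X \<longrightarrow> y \<in> cells \<and> y \<in> stars i \<and> cells_frame y = c \<otimes>\<^bsub>G43\<^esub> star_frame i y) (nhds x)"
proof -
  obtain e where e: "x \<in> region (cell e)" using assms(2) by (auto simp: cells_def)
  obtain v where v: "x \<in> Ss v i" using assms(1) by (auto simp: stars_def)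
  have "wall j (v3 x) (v4 x) \<noteq> 0" if "j \<noteq> i" for j
    using v that by (cases v) (auto simp: region_def star.simps)
  moreover have "\<exists>j. wall j (v3 x) (v4 x) = 0" using assms(3) e by (auto simp: region_def nonsing_def)
  ultimately have "wall i (v3 x) (v4 x) = 0" by metis
  from wall_compat[OF e this assms(1)] obtain js where
    js: "eventually (\<lambda>y. y \<in> region (cell e) \<longrightarrow> cell_frame e y = cl js \<otimes>\<^bsub>G43\<^esub> star_frame i y) (nhds x)" by blast
  have "eventually (\<lambda>y. y \<in> X \<longrightarrow> y \<in> cells \<and> y \<in> stars i \<and> cells_frame y = cl js \<otimes>\<^bsub>G43\<^esub> star_frame i y) (nhds x)"
    using js cell_open[OF e] stars_open[OF assms(1)]
  proof eventually_elim
    case (elim y)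
    show ?case
    proof
      assume "y \<in> X"
      with elim(2,3) have y: "y \<in> region (cell e)" "y \<in> stars i" by blast+
      then have "y \<in> cells" unfolding cells_def by blast
      then show "y \<in> cells \<and> y \<in> stars i \<and> cells_frame y = cl js \<otimes>\<^bsub>G43\<^esub> star_frame i y"
        unfolding cells_frame_cell_frame[OF y(1)] using elim(1) y by blast
    qed
  qed
  then show ?thesis by (intro bexI[of _ "cl js"]) simp_all
qed

lemma stars_stars_Dd: "x \<in> stars i \<Longrightarrow> x \<in> stars j \<Longrightarrow> i \<noteq> j \<Longrightarrow> x \<in> Dd"
proof -
  assume "x \<in> stars i" "x \<in> stars j" "i \<noteq> j"
  then obtain u v where uv: "x \<in> Ss u i" "x \<in> Ss v j" by (auto simp: stars_def)
  have "wall k (v3 x) (v4 x) \<noteq> 0" for k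
    using uv \<open>i \<noteq> j\<close> by (cases u; cases v; cases "k = i") (auto simp: region_def star.simps)
  then show ?thesis using uv(1) by (simp add: region_def nonsing_def)
qed

text \<open>At a nonsingular configuration all frames are locally constant and differ by some
  element. At a singular one two charts can meet only if they coincide or are the star of the
  vanishing wall and the cell chart, which is the case of \<open>wall_compat\<close>.\<close>

interpretation DV: developing G43 config_space \<F>
proof (unfold_locales)
  interpret g: group G43 by (rule group_G43)
  show "x \<otimes>\<^bsub>G43\<^esub> y \<in> carrier G43" if "x \<in> carrier G43" "y \<in> carrier G43" for x y using that by simp
  show "x \<otimes>\<^bsub>G43\<^esub> y \<otimes>\<^bsub>G43\<^esub> z = x \<otimes>\<^bsub>G43\<^esub> (y \<otimes>\<^bsub>G43\<^esub> z)"
    if "x \<in> carrier G43" "y \<in> carrier G43" "z \<in> carrier G43" for x y z using that by (simp add: g.m_assoc)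
  show "\<one>\<^bsub>G43\<^esub> \<in> carrier G43" by simp
  show "\<one>\<^bsub>G43\<^esub> \<otimes>\<^bsub>G43\<^esub> x = x" "x \<otimes>\<^bsub>G43\<^esub> \<one>\<^bsub>G43\<^esub> = x" if "x \<in> carrier G43" for x using that by simp_all
  show "carrier G43 \<subseteq> Units G43" by (simp add: g.Units_eq)
  show "w x \<in> carrier G43" if "(U, w) \<in> \<F>" for U w x using that by (auto simp: \<F>_def)
  show "\<exists>(U, w)\<in>\<F>. x \<in> U" if "x \<in> X" for x
  proof -
    from config_space_cover[OF that] consider v i where "x \<in> Ss v i" | e where "x \<in> region (cell e)" by blast
    then show ?thesis
    proof cases
      case (1 v i)
      then have "x \<in> stars i" unfolding stars_def by blast
      then show ?thesis by (intro bexI[of _ "(stars i, star_frame i)"]) (simp_all add: \<F>_def)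
    next
      case (2 e)
      then have "x \<in> cells" unfolding cells_def by blast
      then show ?thesis by (intro bexI[of _ "(cells, cells_frame)"]) (simp_all add: \<F>_def)
    qed
  qed
  fix U w U' w' x assume *: "(U, w) \<in> \<F>" "(U', w') \<in> \<F>" "x \<in> U" "x \<in> U'" "x \<in> X"
  have wc: "w y \<in> carrier G43" "w' y \<in> carrier G43" for y using *(1,2) by (auto simp: \<F>_def)
  show "\<exists>c\<in>carrier G43. eventually (\<lambda>y. y \<in> X \<longrightarrow> y \<in> U' \<and> w' y = c \<otimes>\<^bsub>G43\<^esub> w y) (nhds x)"
  proof (cases "x \<in> Dd")
    case True
    obtain c where c: "c \<in> carrier G43" "w' x = c \<otimes>\<^bsub>G43\<^esub> w x" using G43_right_quotient[OF wc] by blast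
    from Dd_compat[OF *(1,3) True] Dd_compat[OF *(2,4) True]
    have "eventually (\<lambda>y. y \<in> X \<longrightarrow> y \<in> U' \<and> w' y = c \<otimes>\<^bsub>G43\<^esub> w y) (nhds x)"
      by eventually_elim (simp add: c(2))
    with c(1) show ?thesis by blast
  next
    case False
    have same: ?thesis if "U = U'" "w = w'"
    proof -
      have "eventually (\<lambda>y. y \<in> X \<longrightarrow> y \<in> U') (nhds x)"
        by (rule \<F>_open[OF *(2,4)])
      then have "eventually (\<lambda>y. y \<in> X \<longrightarrow> y \<in> U' \<and> w' y = \<one>\<^bsub>G43\<^esub> \<otimes>\<^bsub>G43\<^esub> w y) (nhds x)"
        by eventually_elim (use wc that in simp)
      then show ?thesis by (intro bexI[of _ "\<one>\<^bsub>G43\<^esub>"]) simp_all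
    qed
    have two: ?thesis if "U = stars i" "w = star_frame i" "U' = stars j" "w' = star_frame j" for i j
    proof (cases "i = j")
      case True then show ?thesis using that by (intro same) simp_all
    next
      case ij: False
      have "x \<in> Dd" by (rule stars_stars_Dd[OF *(3)[unfolded that] *(4)[unfolded that] ij])
      then show ?thesis using False by simp
    qed
    have SW: ?thesis if eq: "U = stars i" "w = star_frame i" "U' = cells" "w' = cells_frame" for i
    proof -
      obtain c where c: "c \<in> carrier G43"
        "eventually (\<lambda>y. y \<in> X \<longrightarrow> y \<in> cells \<and> y \<in> stars i \<and> cells_frame y = c \<otimes>\<^bsub>G43\<^esub> star_frame i y) (nhds x)"
        using stars_cells_compat[OF *(3)[unfolded eq] *(4)[unfolded eq] False] by (elim bexE)
      from c(2) have "eventually (\<lambda>y. y \<in> X \<longrightarrow> y \<in> cells \<and> cells_frame y = c \<otimes>\<^bsub>G43\<^esub> star_frame i y) (nhds x)"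
        by eventually_elim blast
      with c(1) show ?thesis unfolding eq by (intro bexI[of _ c])
    qed
    have WS: ?thesis if eq: "U = cells" "w = cells_frame" "U' = stars i" "w' = star_frame i" for i
    proof -
      obtain c where c: "c \<in> carrier G43"
        "eventually (\<lambda>y. y \<in> X \<longrightarrow> y \<in> cells \<and> y \<in> stars i \<and> cells_frame y = c \<otimes>\<^bsub>G43\<^esub> star_frame i y) (nhds x)"
        using stars_cells_compat[OF *(4)[unfolded eq] *(3)[unfolded eq] False] by (elim bexE)
      have hub_class: "inv\<^bsub>G43\<^esub> c \<otimes>\<^bsub>G43\<^esub> (c \<otimes>\<^bsub>G43\<^esub> star_frame i y) = star_frame i y" for y
        using c(1) by (simp add: g.m_assoc[symmetric])
      from c(2) have "eventually (\<lambda>y. y \<in> X \<longrightarrow> y \<in> stars i \<and> star_frame i y = inv\<^bsub>G43\<^esub> c \<otimes>\<^bsub>G43\<^esub> cells_frame y) (nhds x)"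
        by eventually_elim (simp add: hub_class)
      with c(1) show ?thesis unfolding eq by (intro bexI[of _ "inv\<^bsub>G43\<^esub> c"]) simp_all
    qed
    from \<F>_cases[OF *(1)] \<F>_cases[OF *(2)] show ?thesis
      by (elim disjE exE conjE) (rule same two SW WS; simp)+
  qed
qed

text \<open>The frame is \<open>cl [i]\<close> on one side of the wall and trivial on the other. As
  \<open>cl [i]\<close> is an involution, crossing in either direction multiplies by it.\<close>

lemma tr_star_path:
  assumes "g \<in> carrier G43"
  shows "DV.tr (star_path v i) g (g \<otimes>\<^bsub>G43\<^esub> cl [i])"
proof -
  have "Ss v i \<subseteq> stars i" by (auto simp: stars_def)
  then have p: "path_in (stars i) (chamber_pt v) (chamber_pt (act v i)) (star_path v i)" by (rule path_in_mono[OF star_path])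
  have U: "stars i \<subseteq> X" using Ss_sub by (auto simp: stars_def)
  have F: "(stars i, star_frame i) \<in> \<F>" by (simp add: \<F>_def)
  have ci: "inv\<^bsub>G43\<^esub> cl [j] = cl [j]" "inv\<^bsub>G43\<^esub> cl [] = cl []" for j by (simp_all add: cl_inv)
  have "inv\<^bsub>G43\<^esub> star_frame i (chamber_pt v) \<otimes>\<^bsub>G43\<^esub> star_frame i (chamber_pt (act v i)) = cl [i]"
    unfolding star_frame_Cc[OF chamber_pt_in]
    by (cases v) (auto simp: ci cl_mult cl_pair cl_one)
  then show ?thesis using DV.tr_chart[OF p U F assms] assms
    by (simp add: DV.m_assoc)
qed

text \<open>A single path carries both invariants of a word, its class in the fundamental group and
  its transport in \<open>G43\<close>; this is what allows a trivial class to be turned into a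
  trivial element.\<close>

lemma edge_word_path:
  "\<exists>p. path_in X (chamber_pt v) (chamber_pt (act_word v is)) p \<and> F p = edge_word v is \<and>
     (\<forall>g\<in>carrier G43. DV.tr p g (g \<otimes>\<^bsub>G43\<^esub> cl is))"
proof (induction "is" arbitrary: v)
  case Nil
  have z: "chamber_pt v \<in> X" using chamber_pt_in Cc_sub by blast
  have "chamber_pt v \<in> Ss v 1" using chamber_pt_in Cc_Ss by blast
  then have c: "path_in (stars 1) (chamber_pt v) (chamber_pt v) (\<lambda>_. chamber_pt v)" by (intro path_in_const) (unfold stars_def, blast)
  have U: "stars 1 \<subseteq> X" using Ss_sub by (auto simp: stars_def)
  have F: "(stars 1, star_frame 1) \<in> \<F>" by (simp add: \<F>_def)
  have "DV.tr (\<lambda>_. chamber_pt v) g (g \<otimes>\<^bsub>G43\<^esub> cl [])" if "g \<in> carrier G43" for g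
    using DV.tr_chart[OF c U F that] that by (simp add: DV.m_assoc cl_one[symmetric])
  then show ?case using path_in_const[OF z] PF.F_const[OF z] by auto
next
  case (Cons i "is")
  obtain p where p: "path_in X (chamber_pt (act v i)) (chamber_pt (act_word (act v i) is)) p" "F p = edge_word (act v i) is"
    "\<And>g. g \<in> carrier G43 \<Longrightarrow> DV.tr p g (g \<otimes>\<^bsub>G43\<^esub> cl is)" using Cons by blast
  have e: "path_in X (chamber_pt v) (chamber_pt (act v i)) (star_path v i)" by (rule path_in_mono[OF star_path Ss_sub])
  have "DV.tr (star_path v i +++ p) g (g \<otimes>\<^bsub>G43\<^esub> cl (i # is))" if "g \<in> carrier G43" for g
  proof -
    have "DV.tr p (g \<otimes>\<^bsub>G43\<^esub> cl [i]) (g \<otimes>\<^bsub>G43\<^esub> cl [i] \<otimes>\<^bsub>G43\<^esub> cl is)" using that by (intro p(3)) simp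
    moreover have "g \<otimes>\<^bsub>G43\<^esub> cl [i] \<otimes>\<^bsub>G43\<^esub> cl is = g \<otimes>\<^bsub>G43\<^esub> cl (i # is)"
      using that by (simp add: DV.m_assoc cl_mult)
    ultimately show ?thesis using DV.tr_join[OF tr_star_path[OF that]] e p(1) by (simp add: path_in_def)
  qed
  moreover have "F (star_path v i +++ p) = edge_word v (i # is)"
    unfolding PF.F_join[OF e p(1)] by (simp add: edge_def p(2))
  ultimately show ?case using path_in_join[OF e p(1)] by auto
qed

lemma edge_word_trivial_imp:
  assumes "edge_word v0 is = \<one>\<^bsub>P\<^esub>" "act_word v0 is = v0"
  shows "cl is = \<one>\<^bsub>G43\<^esub>"
proof -
  obtain p where p: "path_in X base_config base_config p" "F p = \<one>\<^bsub>P\<^esub>"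
    "\<And>g. g \<in> carrier G43 \<Longrightarrow> DV.tr p g (g \<otimes>\<^bsub>G43\<^esub> cl is)"
    using edge_word_path[of v0 "is"] assms by (auto simp: chamber_pt_base)
  have b: "base_config \<in> X" by (rule base_config_in_config_space)
  have "homotopy_rel X base_config `` {p} = homotopy_rel X base_config `` {\<lambda>_. base_config}"
    using p(2) PF.F_loop[OF p(1)] by (simp add: fundamental_group_def)
  then have "(p, \<lambda>_. base_config) \<in> homotopy_rel X base_config"
    using eq_equiv_class_iff[OF equiv_homotopy_rel, of p X base_config "\<lambda>_. base_config"] p(1) path_in_const[OF b]
    by (simp add: loops_at_def path_in_def)
  then have h: "homotopic_paths X p (\<lambda>_. base_config)" by (simp add: homotopy_rel_def)
  have "DV.tr (\<lambda>_. base_config) \<one>\<^bsub>G43\<^esub> (\<one>\<^bsub>G43\<^esub> \<otimes>\<^bsub>G43\<^esub> cl is)"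
    by (rule DV.tr_homotopic[OF h p(3)]) simp
  \<comment> \<open>The path of the empty word is also homotopic to the constant loop and supplies
    the transport of the latter, with which uniqueness compares.\<close>
  moreover obtain q where q: "path_in X base_config base_config q"
    "\<And>g. g \<in> carrier G43 \<Longrightarrow> DV.tr q g (g \<otimes>\<^bsub>G43\<^esub> cl [])" "F q = \<one>\<^bsub>P\<^esub>"
    using edge_word_path[of v0 "[]"] by (auto simp: chamber_pt_base)
  have "DV.tr (\<lambda>_. base_config) \<one>\<^bsub>G43\<^esub> (\<one>\<^bsub>G43\<^esub> \<otimes>\<^bsub>G43\<^esub> cl [])"
  proof -
    have "homotopy_rel X base_config `` {q} = homotopy_rel X base_config `` {\<lambda>_. base_config}"
      using q(3) PF.F_loop[OF q(1)] by (simp add: fundamental_group_def)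
    then have "(q, \<lambda>_. base_config) \<in> homotopy_rel X base_config"
      using eq_equiv_class_iff[OF equiv_homotopy_rel, of q X base_config "\<lambda>_. base_config"] q(1) path_in_const[OF b]
      by (simp add: loops_at_def path_in_def)
    then have h: "homotopic_paths X q (\<lambda>_. base_config)" by (simp add: homotopy_rel_def)
    show ?thesis by (rule DV.tr_homotopic[OF h q(2)]) simp
  qed
  ultimately have "\<one>\<^bsub>G43\<^esub> \<otimes>\<^bsub>G43\<^esub> cl is = \<one>\<^bsub>G43\<^esub> \<otimes>\<^bsub>G43\<^esub> cl []" by (rule DV.tr_unique)
  then show ?thesis by (simp add: cl_one)
qed

lemma base_stab_iso: "G43\<lparr>carrier := base_stab\<rparr> \<cong> P"
proof -
  interpret S: subgroup base_stab G43 by (rule subgroup_base_stab)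
  have gH: "group (G43\<lparr>carrier := base_stab\<rparr>)" by (rule S.subgroup_is_group[OF group_G43])
  interpret h: group_hom "G43\<lparr>carrier := base_stab\<rparr>" P Eg
    by (rule group_hom.intro[OF gH PF.P.is_group]) (simp add: group_hom_axioms_def Eg_hom)
  have "inj_on Eg base_stab"
  proof -
    have "A = \<one>\<^bsub>G43\<^esub>" if "A \<in> base_stab" "Eg A = \<one>\<^bsub>P\<^esub>" for A
      using that edge_word_trivial_imp unfolding base_stab_def by (auto simp: Eg_cl)
    then show ?thesis using h.inj_on_one_iff by auto
  qed
  moreover have "Eg ` base_stab = carrier P"
    using Eg_surj Eg_hom by (auto simp: hom_def)
  ultimately have "Eg \<in> iso (G43\<lparr>carrier := base_stab\<rparr>) P"
    using Eg_hom by (simp add: iso_def bij_betw_def)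
  then show ?thesis unfolding is_iso_def by blast
qed

section \<open>Words of stable loops\<close>

lemma rp2_point_in_line:
  assumes "u \<noteq> 0" shows "rp2_point u \<in> rp2_line n \<longleftrightarrow> n \<bullet> u = 0"
proof
  assume "rp2_point u \<in> rp2_line n"
  then obtain v where v: "v \<noteq> 0" "n \<bullet> v = 0" "rp2_point u = rp2_point v" by (auto simp: rp2_line_def)
  then obtain c where "u = c *\<^sub>R v" using assms by (auto simp: rp2_point_eq_iff)
  then show "n \<bullet> u = 0" using v by simp
qed (use assms in \<open>auto simp: rp2_line_def\<close>)

lemma inner_vec3: "(n :: real^3) \<bullet> u = n$1 * u$1 + n$2 * u$2 + n$3 * u$3"
  by (simp add: inner_vec_def sum_3)

lemma collinear_conf:
  assumes "distinct_pts v w"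
  shows "rp2_collinear ((\<lambda>i. conf v w $ i) ` T i) \<longleftrightarrow> wall i v w = 0"
proof -
  have nz: "v \<noteq> 0" "w \<noteq> 0" using distinct_pts_nonzero[OF assms] by auto
  have e: "(vector [1, 0, 0] :: real^3) \<noteq> 0" "(vector [0, 1, 0] :: real^3) \<noteq> 0" by (auto simp: vec3_eq_0)
  note l = rp2_point_in_line[OF e(1)] rp2_point_in_line[OF e(2)] rp2_point_in_line[OF nz(1)] rp2_point_in_line[OF nz(2)]
  have U: "T 1 = {2, 3, 4}" "T 2 = {1, 3, 4}" "T 3 = {1, 2, 4}" "T 4 = {1, 2, 3}"
    unfolding T_def by (auto simp: set_eq_iff forall_4)
  have ex: "(\<exists>n. n \<noteq> 0 \<and> Q n) \<longleftrightarrow> (\<exists>a b c. (a \<noteq> 0 \<or> b \<noteq> 0 \<or> c \<noteq> (0::real)) \<and> Q (vector [a, b, c] :: real^3))" for Q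
  proof
    assume "\<exists>n. n \<noteq> 0 \<and> Q n"
    then obtain n where n: "n \<noteq> 0" "Q n" by blast
    have "n = vector [n$1, n$2, n$3]" by (simp add: vec_eq_iff forall_3)
    then show "\<exists>a b c. (a \<noteq> 0 \<or> b \<noteq> 0 \<or> c \<noteq> (0::real)) \<and> Q (vector [a, b, c] :: real^3)"
      using n vec3_eq_0[of n] by (intro exI[of _ "n$1"] exI[of _ "n$2"] exI[of _ "n$3"]) auto
  next
    assume "\<exists>a b c. (a \<noteq> 0 \<or> b \<noteq> 0 \<or> c \<noteq> (0::real)) \<and> Q (vector [a, b, c] :: real^3)"
    then obtain a b c where n: "a \<noteq> 0 \<or> b \<noteq> 0 \<or> c \<noteq> (0::real)" "Q (vector [a, b, c] :: real^3)" by blast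
    then show "\<exists>n. n \<noteq> 0 \<and> Q n"
      using vec3_eq_0[of "vector [a, b, c]"] by (intro exI[of _ "vector [a, b, c]"]) simp
  qed
  consider "i = 1" | "i = 2" | "i = 3" | "i = 4" using exhaust_4[of i] by blast
  then show ?thesis
  proof cases
    case 1
    have "rp2_collinear ((\<lambda>i. conf v w $ i) ` T i) \<longleftrightarrow>
      (\<exists>a b c. (a \<noteq> 0 \<or> b \<noteq> 0 \<or> c \<noteq> 0) \<and> b = 0 \<and> a * v$1 + b * v$2 + c * v$3 = 0 \<and> a * w$1 + b * w$2 + c * w$3 = 0)"
      unfolding rp2_collinear_def ex 1 U by (simp add: l inner_vec3)
    also have "\<dots> \<longleftrightarrow> wall 1 v w = 0"
    proof
      assume "\<exists>a b c. (a \<noteq> 0 \<or> b \<noteq> 0 \<or> c \<noteq> 0) \<and> b = 0 \<and> a * v$1 + b * v$2 + c * v$3 = 0 \<and> a * w$1 + b * w$2 + c * w$3 = 0"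
      then obtain a c where ac: "a \<noteq> 0 \<or> c \<noteq> 0" "a * v$1 + c * v$3 = 0" "a * w$1 + c * w$3 = 0" by auto
      have "a * wall 1 v w = (a * v$1 + c * v$3) * w$3 - v$3 * (a * w$1 + c * w$3)"
        "c * wall 1 v w = (a * w$1 + c * w$3) * v$1 - (a * v$1 + c * v$3) * w$1" by (simp_all add: algebra_simps)
      then show "wall 1 v w = 0" using ac by auto
    next
      \<comment> \<open>The witness is the normal vector of the line through \<open>x_2\<close> and
        \<open>x_3\<close>; it is nonzero because these points differ.\<close>
      assume "wall 1 v w = 0"
      then show "\<exists>a b c. (a \<noteq> 0 \<or> b \<noteq> 0 \<or> c \<noteq> 0) \<and> b = 0 \<and> a * v$1 + b * v$2 + c * v$3 = 0 \<and> a * w$1 + b * w$2 + c * w$3 = 0"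
        using assms by (intro exI[of _ "v$3"] exI[of _ 0] exI[of _ "- v$1"]) (auto simp: distinct_pts_def algebra_simps)
    qed
    finally show ?thesis unfolding 1 .
  next
    case 2
    have "rp2_collinear ((\<lambda>i. conf v w $ i) ` T i) \<longleftrightarrow>
      (\<exists>a b c. (a \<noteq> 0 \<or> b \<noteq> 0 \<or> c \<noteq> 0) \<and> a = 0 \<and> a * v$1 + b * v$2 + c * v$3 = 0 \<and> a * w$1 + b * w$2 + c * w$3 = 0)"
      unfolding rp2_collinear_def ex 2 U by (simp add: l inner_vec3)
    also have "\<dots> \<longleftrightarrow> wall 2 v w = 0"
    proof
      assume "\<exists>a b c. (a \<noteq> 0 \<or> b \<noteq> 0 \<or> c \<noteq> 0) \<and> a = 0 \<and> a * v$1 + b * v$2 + c * v$3 = 0 \<and> a * w$1 + b * w$2 + c * w$3 = 0"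
      then obtain a c where ac: "a \<noteq> 0 \<or> c \<noteq> 0" "a * v$2 + c * v$3 = 0" "a * w$2 + c * w$3 = 0" by auto
      have "a * wall 2 v w = (a * v$2 + c * v$3) * w$3 - v$3 * (a * w$2 + c * w$3)"
        "c * wall 2 v w = (a * w$2 + c * w$3) * v$2 - (a * v$2 + c * v$3) * w$2" by (simp_all add: algebra_simps)
      then show "wall 2 v w = 0" using ac by auto
    next
      assume "wall 2 v w = 0"
      then show "\<exists>a b c. (a \<noteq> 0 \<or> b \<noteq> 0 \<or> c \<noteq> 0) \<and> a = 0 \<and> a * v$1 + b * v$2 + c * v$3 = 0 \<and> a * w$1 + b * w$2 + c * w$3 = 0"
        using assms by (intro exI[of _ 0] exI[of _ "v$3"] exI[of _ "- v$2"]) (auto simp: distinct_pts_def algebra_simps)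
    qed
    finally show ?thesis unfolding 2 .
  next
    case 3
    then show ?thesis unfolding rp2_collinear_def ex 3 U by (simp add: l inner_vec3) (auto intro: exI[of _ 1])
  next
    case 4
    then show ?thesis unfolding rp2_collinear_def ex 4 U by (simp add: l inner_vec3) (auto intro: exI[of _ 1])
  qed
qed

lemma config_coords:
  assumes "x \<in> X" "v \<noteq> 0" "w \<noteq> 0" "x $ 3 = rp2_point v" "x $ 4 = rp2_point w"
  shows "x = conf v w" "distinct_pts v w" "T i \<in> collinear_triples x \<longleftrightarrow> wall i v w = 0"
proof -
  show x: "x = conf v w" using assms by (simp add: config_space_def vec_eq_iff forall_4)
  show g: "distinct_pts v w" using conf_in_config_space[OF assms(2,3)] assms(1) x by simp
  show "T i \<in> collinear_triples x \<longleftrightarrow> wall i v w = 0"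
    using collinear_conf[OF g] unfolding x collinear_triples_def by simp
qed

lemma smooth_coords_config:
  assumes "smooth_coords V \<gamma>" "\<gamma> ` {0..1} \<subseteq> X" "t \<in> {0..1}"
  shows "\<gamma> t = conf (V t $ 3) (V t $ 4)" "distinct_pts (V t $ 3) (V t $ 4)"
    "T i \<in> collinear_triples (\<gamma> t) \<longleftrightarrow> wall i (V t $ 3) (V t $ 4) = 0"
  using assms config_coords[of "\<gamma> t" "V t $ 3" "V t $ 4"] unfolding smooth_coords_def by blast+

section \<open>Smooth coordinates and their perturbations\<close>

lemma smooth_on_derivative:
  fixes f :: "real \<Rightarrow> 'a::euclidean_space"
  assumes "smooth_on {0..1} f"
  shows "\<And>t. t \<in> {0..1} \<Longrightarrow> (f has_vector_derivative vector_derivative f (at t within {0..1})) (at t within {0..1})"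
    "continuous_on {0..1} (\<lambda>t. vector_derivative f (at t within {0..1}))"
proof -
  obtain D where D: "\<And>t. t \<in> {0..1} \<Longrightarrow> D (0::nat) t = f t"
    "\<And>n t. t \<in> {0..1} \<Longrightarrow> (D n has_vector_derivative D (Suc n) t) (at t within {0..1})"
    using assms unfolding smooth_on_def by blast
  have d: "(f has_vector_derivative D 1 t) (at t within {0..1})" if "t \<in> {0..1}" for t
    using has_vector_derivative_transform[OF that _ D(2)[OF that, of 0], of f] D(1) by auto
  then have e: "vector_derivative f (at t within {0..1}) = D 1 t" if "t \<in> {0..1}" for t
    using that by (intro vector_derivative_within_closed_interval) simp_all
  show "(f has_vector_derivative vector_derivative f (at t within {0..1})) (at t within {0..1})" if "t \<in> {0..1}" for t
    using d[OF that] e[OF that] by simp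
  have "continuous_on {0..1} (D 1)"
    unfolding continuous_on_eq_continuous_within by (intro ballI has_vector_derivative_continuous[OF D(2)])
  then show "continuous_on {0..1} (\<lambda>t. vector_derivative f (at t within {0..1}))"
    by (subst continuous_on_cong[OF HOL.refl e]) auto
qed

lemma smooth_on_continuous:
  fixes f :: "real \<Rightarrow> 'a::euclidean_space"
  assumes "smooth_on {0..1} f" shows "continuous_on {0..1} f"
  unfolding continuous_on_eq_continuous_within
  by (intro ballI has_vector_derivative_continuous[OF smooth_on_derivative(1)[OF assms]])

lemma C1_close_add_const:
  fixes V :: "real \<Rightarrow> 'a::euclidean_space"
  assumes "norm K < \<epsilon>" "smooth_on {0..1} V"
  shows "C1_close \<epsilon> V (\<lambda>t. V t + K)"
  unfolding C1_close_def
proof (intro ballI conjI)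
  fix t :: real assume t: "t \<in> {0..1}"
  show "norm (V t + K - V t) < \<epsilon>" using assms(1) by simp
  have "((\<lambda>t. V t + K) has_vector_derivative vector_derivative V (at t within {0..1}) + 0) (at t within {0..1})"
    by (intro derivative_intros smooth_on_derivative(1)[OF assms(2) t])
  then have "vector_derivative (\<lambda>t. V t + K) (at t within {0..1}) = vector_derivative V (at t within {0..1})"
    using t by (intro vector_derivative_within_closed_interval) simp_all
  then show "norm (vector_derivative (\<lambda>t. V t + K) (at t within {0..1}) - vector_derivative V (at t within {0..1})) < \<epsilon>"
    using le_less_trans[OF norm_ge_zero assms(1)] by simp
qed

lemma smooth_on_add_const:
  fixes V :: "real \<Rightarrow> 'a::real_normed_vector"
  assumes "smooth_on S V" shows "smooth_on S (\<lambda>t. V t + K)"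
proof -
  obtain D where D: "\<And>t. t \<in> S \<Longrightarrow> D (0::nat) t = V t"
    "\<And>n t. t \<in> S \<Longrightarrow> (D n has_vector_derivative D (Suc n) t) (at t within S)"
    using assms unfolding smooth_on_def by blast
  define D' where "D' n = (if n = 0 then \<lambda>t. D 0 t + K else D n)" for n
  have "(D' n has_vector_derivative D' (Suc n) t) (at t within S)" if "t \<in> S" for n t
  proof (cases "n = 0")
    case True
    have "((\<lambda>t. D 0 t + K) has_vector_derivative D (Suc 0) t + 0) (at t within S)"
      by (intro derivative_intros D that)
    then show ?thesis by (simp add: D'_def True)
  qed (use D that in \<open>simp add: D'_def\<close>)
  then show ?thesis unfolding smooth_on_def by (intro exI[of _ D']) (auto simp: D'_def D)
qed

lemma eventually_distinct_pts:
  assumes "distinct_pts v w"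
  shows "eventually (\<lambda>u. distinct_pts (fst u) (snd u)) (nhds (v, w))"
proof -
  \<comment> \<open>Each disjunction of nonvanishing coordinates becomes a sum of squares, so that
    distinctness is the nonvanishing of one continuous function.\<close>
  define h where "h u = ((fst u$2)\<^sup>2 + (fst u$3)\<^sup>2) * ((fst u$1)\<^sup>2 + (fst u$3)\<^sup>2) * ((snd u$2)\<^sup>2 + (snd u$3)\<^sup>2) *
    ((snd u$1)\<^sup>2 + (snd u$3)\<^sup>2) * ((wall 1 (fst u) (snd u))\<^sup>2 + (wall 2 (fst u) (snd u))\<^sup>2 + (minor12 (fst u) (snd u))\<^sup>2)"
    for u :: "(real^3) \<times> (real^3)"
  have h: "h u \<noteq> 0 \<longleftrightarrow> distinct_pts (fst u) (snd u)" for u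
    unfolding h_def distinct_pts_def by (simp add: sum_power2_eq_zero_iff add_nonneg_eq_0_iff del: wall_simps)
  have "isCont h (v, w)" unfolding h_def wall_simps minor12_def by (intro continuous_intros)
  from eventually_nonzero[OF tendsto_nhdsI[OF this]] assms show ?thesis by (simp add: h)
qed

text \<open>Each parameter has a neighbourhood with its own bound on \<open>\<eta>\<close>;
  compactness of the interval, in the form of subdivision, gives one bound for the whole
  path.\<close>

lemma distinct_pts_perturbation:
  fixes v w :: "real \<Rightarrow> real^3"
  assumes V: "continuous_on {0..1} v" "continuous_on {0..1} w" and g: "\<And>t. t \<in> {0..1} \<Longrightarrow> distinct_pts (v t) (w t)"
  shows "\<exists>h>0. \<forall>\<eta> t. \<bar>\<eta>\<bar> < h \<longrightarrow> t \<in> {0..1} \<longrightarrow> distinct_pts (v t + \<eta> *\<^sub>R m) (w t + \<eta> *\<^sub>R m')"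
proof -
  define Q where "Q a b \<longleftrightarrow> (\<exists>h>0. \<forall>\<eta> t. \<bar>\<eta>\<bar> < h \<longrightarrow> t \<in> {0..1} \<longrightarrow> a \<le> t \<longrightarrow> t \<le> b \<longrightarrow>
    distinct_pts (v t + \<eta> *\<^sub>R m) (w t + \<eta> *\<^sub>R m'))" for a b :: real
  have "(0::real) \<le> 1" by simp
  then have "Q 0 1"
  proof (induction rule: Bolzano)
    case (trans a b c)
    obtain h1 where 1: "h1 > 0" "\<And>\<eta> t. \<bar>\<eta>\<bar> < h1 \<Longrightarrow> t \<in> {0..1} \<Longrightarrow> a \<le> t \<Longrightarrow> t \<le> b \<Longrightarrow>
      distinct_pts (v t + \<eta> *\<^sub>R m) (w t + \<eta> *\<^sub>R m')" using trans(1) unfolding Q_def by blast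
    obtain h2 where 2: "h2 > 0" "\<And>\<eta> t. \<bar>\<eta>\<bar> < h2 \<Longrightarrow> t \<in> {0..1} \<Longrightarrow> b \<le> t \<Longrightarrow> t \<le> c \<Longrightarrow>
      distinct_pts (v t + \<eta> *\<^sub>R m) (w t + \<eta> *\<^sub>R m')" using trans(2) unfolding Q_def by blast
    have "distinct_pts (v t + \<eta> *\<^sub>R m) (w t + \<eta> *\<^sub>R m')" if "\<bar>\<eta>\<bar> < min h1 h2" "t \<in> {0..1}" "a \<le> t" "t \<le> c" for \<eta> t
      using 1(2)[of \<eta> t] 2(2)[of \<eta> t] that by (cases "t \<le> b") auto
    then show ?case unfolding Q_def using 1(1) 2(1) by (intro exI[of _ "min h1 h2"]) auto
  next
    case (local x)
    then have x: "x \<in> {0..1}" by simp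
    obtain S where S: "open S" "(v x, w x) \<in> S" "\<And>u. u \<in> S \<Longrightarrow> distinct_pts (fst u) (snd u)"
      using eventually_distinct_pts[OF g[OF x]] unfolding eventually_nhds by blast
    let ?f = "\<lambda>z. (v (fst z) + snd z *\<^sub>R m, w (fst z) + snd z *\<^sub>R m')"
    have "continuous_on ({0..1} \<times> (UNIV :: real set)) ?f"
      by (intro continuous_intros continuous_on_compose2[OF V(1)] continuous_on_compose2[OF V(2)]) auto
    then have "(?f \<longlongrightarrow> ?f (x, 0)) (at (x, 0) within {0..1} \<times> UNIV)"
      using x unfolding continuous_on_def by (elim bspec) simp
    from topological_tendstoD[OF this S(1)] have "eventually (\<lambda>z. ?f z \<in> S) (at (x, 0) within {0..1} \<times> UNIV)"
      using S(2) by simp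
    then obtain d where d: "d > 0" "\<And>z. z \<in> {0..1} \<times> UNIV \<Longrightarrow> z \<noteq> (x, 0) \<Longrightarrow> dist z (x, 0) < d \<Longrightarrow> ?f z \<in> S"
      unfolding eventually_at by blast
    have small: "distinct_pts (v t + \<eta> *\<^sub>R m) (w t + \<eta> *\<^sub>R m')" if *: "\<bar>\<eta>\<bar> < d/2" "t \<in> {0..1}" "\<bar>t - x\<bar> < d/2" for \<eta> t
    proof -
      have "dist (t, \<eta>) (x, 0) \<le> \<bar>t - x\<bar> + \<bar>\<eta>\<bar>"
        using sqrt_sum_squares_le_sum_abs[of "\<bar>t - x\<bar>" "\<bar>\<eta>\<bar>"] by (simp add: dist_Pair_Pair dist_real_def)
      then have "dist (t, \<eta>) (x, 0) < d" using * by linarith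
      then have "?f (t, \<eta>) \<in> S" using d(2)[of "(t, \<eta>)"] *(2) S(2) by (cases "(t, \<eta>) = (x, 0)") auto
      from S(3)[OF this] show ?thesis by simp
    qed
    have "Q a b" if "a \<le> x \<and> x \<le> b \<and> b - a < d/2" for a b
      unfolding Q_def
    proof (intro exI[of _ "d/2"] conjI allI impI)
      fix \<eta> t :: real
      assume *: "\<bar>\<eta>\<bar> < d/2" "t \<in> {0..1}" "a \<le> t" "t \<le> b"
      then have "\<bar>t - x\<bar> < d/2" using that by linarith
      with * show "distinct_pts (v t + \<eta> *\<^sub>R m) (w t + \<eta> *\<^sub>R m')" by (intro small)
    qed (use d(1) in simp)
    then show ?case using d(1) by (intro exI[of _ "d/2"]) auto
  qed
  then show ?thesis unfolding Q_def by auto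
qed

text \<open>For the walls 1 and 2 this is the gradient of the wall with respect to \<open>v\<close>,
  so \<open>move_gain\<close> at \<open>w\<close> itself is a sum of two squares. Wall 4 is changed
  by lifting \<open>x_3\<close>, and wall 3 by lifting \<open>x_4\<close> with
  \<open>move4\<close>.\<close>

definition move3 :: "4 \<Rightarrow> real^3 \<Rightarrow> real^3" where
  "move3 i w = (if i = 1 then vector [w$3, 0, - w$1] else if i = 2 then vector [0, w$3, - w$2]
     else if i = 3 then 0 else vector [0, 0, 1])"

definition move4 :: "4 \<Rightarrow> real^3" where "move4 i = (if i = 3 then vector [0, 0, 1] else 0)"

definition move_gain :: "4 \<Rightarrow> real^3 \<Rightarrow> real^3 \<Rightarrow> real" where
  "move_gain i w u = (if i = 1 then w$3 * u$3 + w$1 * u$1 else if i = 2 then w$3 * u$3 + w$2 * u$2 else 1)"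

lemma wall_move: "wall i (v + \<eta> *\<^sub>R move3 i w0) (w + \<eta> *\<^sub>R move4 i) = wall i v w + \<eta> * move_gain i w0 w"
  using exhaust_4[of i] by (auto simp: move3_def move4_def move_gain_def algebra_simps)

lemma move_gain_pos:
  assumes "distinct_pts v w" shows "move_gain i w w > 0"
proof -
  have "w$3 * w$3 + w$1 * w$1 > 0" "w$3 * w$3 + w$2 * w$2 > 0"
    using assms unfolding distinct_pts_def
    by (auto simp: add_pos_nonneg add_nonneg_pos not_real_square_gt_zero[symmetric] simp del: not_real_square_gt_zero)
  then show ?thesis by (simp add: move_gain_def)
qed

text \<open>
  A zero of the determinant without change of sign is removed by moving one of the points
  by a small constant vector, hence it is not stable.
\<close>

lemma stable_changes_sign:
  assumes sm: "smooth_path \<gamma>" and st: "stable \<gamma> t0 (T i)" and t0: "0 < t0" "t0 < 1"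
  obtains V where "smooth_coords V \<gamma>"
    "\<And>\<epsilon> \<delta>. \<epsilon> \<in> {1, -1} \<Longrightarrow> \<delta> > 0 \<Longrightarrow> \<exists>t\<in>{0..1}. \<bar>t - t0\<bar> < \<delta> \<and> \<epsilon> * wall i (V t $ 3) (V t $ 4) < 0"
proof -
  obtain V where V: "smooth_coords V \<gamma>" and ev: "\<forall>\<^sub>F \<delta> in at_right 0. \<exists>\<epsilon>>0. \<forall>\<gamma>' V'.
          smooth_path \<gamma>' \<and> smooth_coords V' \<gamma>' \<and> C1_close \<epsilon> V V' \<longrightarrow>
          (\<exists>!t'. t' \<in> {0..1} \<and> \<bar>t' - t0\<bar> < \<delta> \<and> T i \<in> collinear_triples (\<gamma>' t'))"
    using st unfolding stable_def by blast
  have gX: "\<gamma> ` {0..1} \<subseteq> X" using sm by (simp add: smooth_path_def)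
  have smV: "smooth_on {0..1} V" using V by (simp add: smooth_coords_def)
  have cV: "continuous_on {0..1} (\<lambda>t. V t $ j)" for j
    using smooth_on_continuous[OF smV] by (intro continuous_intros)
  have gd: "distinct_pts (V t $ 3) (V t $ 4)" if "t \<in> {0..1}" for t using smooth_coords_config(2)[OF V gX that] .
  have False if e: "\<epsilon> \<in> {1, -1}" and d: "\<delta>0 > 0"
    and nn: "\<And>t. t \<in> {0..1} \<Longrightarrow> \<bar>t - t0\<bar> < \<delta>0 \<Longrightarrow> \<epsilon> * wall i (V t $ 3) (V t $ 4) \<ge> 0" for \<epsilon> \<delta>0
  proof -
    have t0': "t0 \<in> {0..1}" using t0 by simp
    let ?w0 = "V t0 $ 4"
    let ?m = "move3 i ?w0" and ?m' = "move4 i"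
    \<comment> \<open>The direction is frozen at parameter \<open>t0\<close> to keep the
      displacement constant in time; by continuity it still increases the wall at nearby
      parameters.\<close>
    have "continuous_on {0..1} (\<lambda>t. move_gain i ?w0 (V t $ 4))"
      unfolding move_gain_def using exhaust_4[of i] by (auto intro!: continuous_intros cV)
    then have "((\<lambda>t. move_gain i ?w0 (V t $ 4)) \<longlongrightarrow> move_gain i ?w0 ?w0) (at t0 within {0..1})"
      using t0' unfolding continuous_on_def by blast
    then have "eventually (\<lambda>t. move_gain i ?w0 (V t $ 4) > 0) (at t0 within {0..1})"
      using move_gain_pos[OF gd[OF t0']] by (rule order_tendstoD)
    then obtain \<delta>1 where d1: "\<delta>1 > 0" "\<And>t. t \<in> {0..1} \<Longrightarrow> t \<noteq> t0 \<Longrightarrow> dist t t0 < \<delta>1 \<Longrightarrow> move_gain i ?w0 (V t $ 4) > 0"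
      unfolding eventually_at by blast
    have lp: "move_gain i ?w0 (V t $ 4) > 0" if "t \<in> {0..1}" "\<bar>t - t0\<bar> < \<delta>1" for t
      using d1(2)[of t] move_gain_pos[OF gd[OF t0']] that by (cases "t = t0") (auto simp: dist_real_def)
    obtain b where b: "b > 0" "\<And>\<delta>. 0 < \<delta> \<Longrightarrow> \<delta> < b \<Longrightarrow> \<exists>\<epsilon>>0. \<forall>\<gamma>' V'.
          smooth_path \<gamma>' \<and> smooth_coords V' \<gamma>' \<and> C1_close \<epsilon> V V' \<longrightarrow>
          (\<exists>!t'. t' \<in> {0..1} \<and> \<bar>t' - t0\<bar> < \<delta> \<and> T i \<in> collinear_triples (\<gamma>' t'))"
      using ev unfolding eventually_at_right_field by auto
    define \<delta> where "\<delta> = min (b/2) (min \<delta>0 \<delta>1)"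
    have wall: "0 < \<delta>" "\<delta> < b" "\<delta> \<le> \<delta>0" "\<delta> \<le> \<delta>1" using b(1) d d1(1) by (auto simp: \<delta>_def)
    obtain r where r: "r > 0" "\<And>\<gamma>' V'. smooth_path \<gamma>' \<Longrightarrow> smooth_coords V' \<gamma>' \<Longrightarrow> C1_close r V V' \<Longrightarrow>
          (\<exists>!t'. t' \<in> {0..1} \<and> \<bar>t' - t0\<bar> < \<delta> \<and> T i \<in> collinear_triples (\<gamma>' t'))"
      using b(2)[OF wall(1,2)] by blast
    obtain h where h: "h > 0" "\<And>\<eta> t. \<bar>\<eta>\<bar> < h \<Longrightarrow> t \<in> {0..1} \<Longrightarrow> distinct_pts (V t $ 3 + \<eta> *\<^sub>R ?m) (V t $ 4 + \<eta> *\<^sub>R ?m')"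
      using distinct_pts_perturbation[OF cV cV gd, of ?m ?m'] by blast
    define K :: "real^3^4" where "K = (\<chi> j. if j = 3 then ?m else if j = 4 then ?m' else 0)"
    \<comment> \<open>Half of one bound keeps the points distinct; the other bound keeps the
      displacement within \<open>C1_close\<close>. The added 1 makes the quotient well defined
      whatever the norm of \<open>K\<close>.\<close>
    define s where "s = min (h/2) (r / (2 * (norm K + 1)))"
    have s: "0 < s" "s < h" using h(1) r(1) by (auto simp: s_def add_nonneg_pos)
    have "s * norm K \<le> r / (2 * (norm K + 1)) * norm K" by (intro mult_right_mono) (auto simp: s_def)
    also have "\<dots> < r" using r(1) norm_ge_zero[of K] by (simp add: divide_simps add_nonneg_pos)
    finally have sK: "s * norm K < r" .
    \<comment> \<open>The displacement pushes the wall further in the direction in which it already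
      does not change sign, so no zero near \<open>t0\<close> survives.\<close>
    define \<eta> where "\<eta> = \<epsilon> * s"
    have eta: "\<bar>\<eta>\<bar> = s" "\<epsilon> * \<eta> = s" using e s(1) by (auto simp: \<eta>_def abs_mult)
    define V' where "V' t = V t + \<eta> *\<^sub>R K" for t
    have V'n: "V' t $ 1 = V t $ 1" "V' t $ 2 = V t $ 2" "V' t $ 3 = V t $ 3 + \<eta> *\<^sub>R ?m" "V' t $ 4 = V t $ 4 + \<eta> *\<^sub>R ?m'" for t
      by (simp_all add: V'_def K_def)
    define \<gamma>' where "\<gamma>' t = conf (V' t $ 3) (V' t $ 4)" for t
    have gd': "distinct_pts (V' t $ 3) (V' t $ 4)" if "t \<in> {0..1}" for t
      unfolding V'n using h(2)[of \<eta> t] eta s that by simp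
    have e12: "\<gamma> t $ 1 = rp2_point (vector [1, 0, 0])" "\<gamma> t $ 2 = rp2_point (vector [0, 1, 0])" if "t \<in> {0..1}" for t
      using subsetD[OF gX imageI[OF that]] by (simp_all add: config_space_def)
    have sc: "smooth_coords V' \<gamma>'"
      unfolding smooth_coords_def
    proof (intro conjI ballI)
      show "smooth_on {0..1} V'" unfolding V'_def by (rule smooth_on_add_const[OF smV])
      fix t :: real assume t: "t \<in> {0..1}"
      have "V t $ j \<noteq> 0 \<and> \<gamma> t $ j = rp2_point (V t $ j)" for j using V t by (simp add: smooth_coords_def)
      then show "\<forall>j. V' t $ j \<noteq> 0 \<and> \<gamma>' t $ j = rp2_point (V' t $ j)"
        using gd'[OF t, THEN distinct_pts_nonzero] e12[OF t] unfolding forall_4 by (auto simp: \<gamma>'_def V'n(1,2))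
    qed
    have sp: "\<gamma>' ` {0..1} \<subseteq> X"
      using gd' distinct_pts_nonzero conf_in_config_space unfolding \<gamma>'_def by blast
    have "smooth_path \<gamma>'" using sc sp unfolding smooth_path_def by blast
    moreover have "C1_close r V V'"
      unfolding V'_def using sK eta s(1) by (intro C1_close_add_const smV) simp
    ultimately obtain t' where t': "t' \<in> {0..1}" "\<bar>t' - t0\<bar> < \<delta>" "T i \<in> collinear_triples (\<gamma>' t')"
      using r(2) sc by blast
    then have "wall i (V' t' $ 3) (V' t' $ 4) = 0" using smooth_coords_config(3)[OF sc sp] by blast
    then have "wall i (V t' $ 3) (V t' $ 4) + \<eta> * move_gain i ?w0 (V t' $ 4) = 0" unfolding V'n wall_move .
    then have "\<epsilon> * (wall i (V t' $ 3) (V t' $ 4) + \<eta> * move_gain i ?w0 (V t' $ 4)) = 0" by simp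
    then have "\<epsilon> * wall i (V t' $ 3) (V t' $ 4) + s * move_gain i ?w0 (V t' $ 4) = 0"
      by (simp add: distrib_left mult.assoc[symmetric] eta(2))
    moreover have "\<epsilon> * wall i (V t' $ 3) (V t' $ 4) \<ge> 0" using nn t' wall by auto
    moreover have "s * move_gain i ?w0 (V t' $ 4) > 0" using lp[of t'] t' wall s(1) by auto
    ultimately show False by linarith
  qed
  then have "\<exists>t\<in>{0..1}. \<bar>t - t0\<bar> < \<delta> \<and> \<epsilon> * wall i (V t $ 3) (V t $ 4) < 0" if "\<epsilon> \<in> {1, -1}" "\<delta> > 0" for \<epsilon> \<delta>
    using that by (meson not_le)
  with V show thesis by (rule that)
qed

text \<open>A chamber fixes the signs of \<open>sA\<close> and \<open>sB\<close>, each a product of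
  three walls. Every wall occurs in one of them, so the signs of the other three walls determine its
  own.\<close>

lemma chamber_same_side:
  assumes u: "chamber u v w" "chamber u v' w'" and pos: "\<And>j. j \<noteq> i \<Longrightarrow> wall j v w * wall j v' w' > 0"
  shows "wall i v w * wall i v' w' > 0"
proof -
  obtain a b where ab: "u = (a, b)" by (cases u)
  have "sA v w \<noteq> 0" "sA v' w' \<noteq> 0" "sB v w \<noteq> 0" "sB v' w' \<noteq> 0" "sA v w > 0 \<longleftrightarrow> sA v' w' > 0" "sB v w > 0 \<longleftrightarrow> sB v' w' > 0"
    using u unfolding ab chamber.simps forall_4 sA_def sB_def by auto
  then have "sA v w * sA v' w' > 0" "sB v w * sB v' w' > 0"
    by (metis linorder_neqE_linordered_idom mult_neg_neg mult_pos_pos)+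
  then have A: "(wall 1 v w * wall 1 v' w') * ((wall 4 v w * wall 4 v' w') * (wall 3 v w * wall 3 v' w')) > 0"
    and B: "(wall 2 v w * wall 2 v' w') * ((wall 4 v w * wall 4 v' w') * (wall 3 v w * wall 3 v' w')) > 0"
    unfolding sA_def sB_def by (simp_all add: mult_ac)
  have h: "x > 0" if "x * (y * z) > 0" "y > 0" "z > 0" for x y z :: real
    using that by (meson mult_pos_pos zero_less_mult_pos2)
  have h': "y > 0" "z > 0" if "x * (y * z) > 0" "x > 0" "y > 0 \<or> z > 0" for x y z :: real
    using zero_less_mult_pos[OF that(1,2)] that(3) by (auto simp: zero_less_mult_iff)
  consider "i = 1" | "i = 2" | "i = 3" | "i = 4" using exhaust_4[of i] by blast
  then show ?thesis
  proof cases
    case 1 show ?thesis unfolding 1 using A by (rule h) (use 1 pos[of 3] pos[of 4] in auto)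
  next
    case 2 show ?thesis unfolding 2 using B by (rule h) (use 2 pos[of 3] pos[of 4] in auto)
  next
    case 3 show ?thesis unfolding 3 using h'(2)[OF A pos disjI1[OF pos]] unfolding 3 by simp
  next
    case 4 show ?thesis unfolding 4 using h'(1)[OF A pos disjI2[OF pos]] unfolding 4 by simp
  qed
qed

section \<open>Chambers along a good and stable path\<close>

lemma smooth_path_continuous:
  assumes "smooth_path \<gamma>" shows "continuous_on {0..1} \<gamma>"
proof -
  obtain V where V: "smooth_coords V \<gamma>" "\<gamma> ` {0..1} \<subseteq> X" using assms unfolding smooth_path_def by blast
  have "continuous_on {0..1} V" using V(1) smooth_on_continuous unfolding smooth_coords_def by blast
  then have "continuous_on {0..1} (\<lambda>t. conf (V t $ 3) (V t $ 4))"
    using V(1) by (intro continuous_on_conf continuous_intros) (auto simp: smooth_coords_def)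
  then show ?thesis using smooth_coords_config(1)[OF V] by (subst continuous_on_cong[OF HOL.refl]) auto
qed

lemma not_singular_iff:
  assumes "x \<in> X" shows "\<not> singular x \<longleftrightarrow> x \<in> Dd"
proof -
  have "T i \<in> collinear_triples x \<longleftrightarrow> wall i (v3 x) (v4 x) = 0" for i
    using config_coords(3)[OF assms, of "v3 x" "v4 x"] distinct_pts_rep[OF assms, THEN distinct_pts_nonzero] by simp
  moreover have "collinear_triples x \<subseteq> T ` UNIV" unfolding collinear_triples_def triples_T by auto
  ultimately show ?thesis using assms unfolding singular_def region_def nonsing_def by fastforce
qed

text \<open>Near \<open>t0\<close> the path stays in the star of wall \<open>i\<close>, which
  contains just two chambers, so the path either crosses or returns. Returning is excluded by the
  change of sign that stability forces.\<close>

lemma crossing: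
  assumes sp: "smooth_path \<gamma>" and t0: "0 < t0" "t0 < 1" and ty: "has_type \<gamma> t0 (T i)" and st: "stable \<gamma> t0 (T i)"
    and a: "a < t0" "\<And>t. t \<in> {0..1} \<Longrightarrow> a \<le> t \<Longrightarrow> t < t0 \<Longrightarrow> \<gamma> t \<in> Cc u"
    and b: "t0 < b" "\<And>t. t \<in> {0..1} \<Longrightarrow> t0 < t \<Longrightarrow> t \<le> b \<Longrightarrow> \<gamma> t \<in> Cc u'"
  shows "u' = act u i"
proof -
  have gX: "\<gamma> ` {0..1} \<subseteq> X" using sp unfolding smooth_path_def by blast
  obtain V where V: "smooth_coords V \<gamma>"
    and chg: "\<And>\<epsilon> \<delta>. \<epsilon> \<in> {1, -1} \<Longrightarrow> \<delta> > 0 \<Longrightarrow> \<exists>t\<in>{0..1}. \<bar>t - t0\<bar> < \<delta> \<and> \<epsilon> * wall i (V t $ 3) (V t $ 4) < 0"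
    using stable_changes_sign[OF sp st t0] by metis
  have t0': "t0 \<in> {0..1}" using t0 by simp
  note sc = smooth_coords_config[OF V gX]
  let ?d = "\<lambda>j t. wall j (V t $ 3) (V t $ 4)"
  have inj: "T j = T i \<longleftrightarrow> j = i" for j by (auto simp: T_def)
  have d0: "?d j t0 = 0 \<longleftrightarrow> j = i" for j
    using sc(3)[OF t0', of j] ty inj[of j] unfolding has_type_def by simp
  obtain v where v: "star v i (V t0 $ 3) (V t0 $ 4)" using star_exists_at[of i "V t0 $ 3" "V t0 $ 4"] d0 by blast
  then have "\<gamma> t0 \<in> Ss v i" using conf_in_region[OF scale_inv_star sc(2)[OF t0']] sc(1)[OF t0'] by simp
  from eventually_nhds_continuous_on[OF smooth_path_continuous[OF sp] t0' star_open[OF this]]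
  have nS: "eventually (\<lambda>t. t \<in> {0..1} \<longrightarrow> \<gamma> t \<in> Ss v i) (nhds t0)"
    by eventually_elim (use gX in blast)
  have cV: "continuous_on {0..1} (\<lambda>t. V t $ j)" for j
    using V smooth_on_continuous unfolding smooth_coords_def by (intro continuous_intros) blast
  have "eventually (\<lambda>t. t \<in> {0..1} \<longrightarrow> j \<noteq> i \<longrightarrow> ?d j t * ?d j t0 > 0) (nhds t0)" for j
  proof (cases "j = i")
    case False
    have "continuous_on {0..1} (\<lambda>t. ?d j t * ?d j t0)"
      using exhaust_4[of j] by (auto intro!: continuous_intros cV)
    moreover have "eventually (\<lambda>x::real. x > 0) (nhds (?d j t0 * ?d j t0))"
      using d0[of j] False by (intro eventually_nhds_in_open[of "{0<..}", simplified]) (auto simp: zero_less_mult_iff simp del: wall_simps)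
    ultimately have "eventually (\<lambda>t. t \<in> {0..1} \<longrightarrow> ?d j t * ?d j t0 > 0) (nhds t0)"
      by (rule eventually_nhds_continuous_on[OF _ t0'])
    then show ?thesis by eventually_elim simp
  qed simp
  then have "eventually (\<lambda>t. \<forall>j. t \<in> {0..1} \<longrightarrow> j \<noteq> i \<longrightarrow> ?d j t * ?d j t0 > 0) (nhds t0)"
    by (rule eventually_all_finite)
  with nS have "eventually (\<lambda>t. t \<in> {0..1} \<longrightarrow> \<gamma> t \<in> Ss v i \<and> (\<forall>j. j \<noteq> i \<longrightarrow> ?d j t * ?d j t0 > 0)) (nhds t0)"
    by eventually_elim simp
  then obtain d where d: "d > 0" "\<And>t. \<bar>t - t0\<bar> < d \<Longrightarrow> t \<in> {0..1} \<Longrightarrow> \<gamma> t \<in> Ss v i"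
    "\<And>t j. \<bar>t - t0\<bar> < d \<Longrightarrow> t \<in> {0..1} \<Longrightarrow> j \<noteq> i \<Longrightarrow> ?d j t * ?d j t0 > 0"
    unfolding eventually_nhds_metric dist_real_def by blast
  define e where "e = min (d / 2) (min (min t0 (1 - t0)) (min (t0 - a) (b - t0)))"
  have e: "e > 0" "e < d" "e \<le> t0" "e \<le> 1 - t0" "e \<le> t0 - a" "e \<le> b - t0"
    using d(1) t0 a(1) b(1) by (auto simp: e_def)
  have l: "\<gamma> (t0 - e) \<in> Cc u" "\<gamma> (t0 - e) \<in> Ss v i" and r: "\<gamma> (t0 + e) \<in> Cc u'" "\<gamma> (t0 + e) \<in> Ss v i"
    using e a(2)[of "t0 - e"] b(2)[of "t0 + e"] d(2)[of "t0 - e"] d(2)[of "t0 + e"] by auto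
  have "u = v \<or> u = act v i" "u' = v \<or> u' = act v i"
    using Ss_Dd[OF l(2) subsetD[OF Cc_Ss(3) l(1)]] Cc_unique[OF l(1)] Ss_Dd[OF r(2) subsetD[OF Cc_Ss(3) r(1)]] Cc_unique[OF r(1)] by blast+
  moreover have "u \<noteq> u'"
  proof
    \<comment> \<open>If the chamber is the same on both sides, wall \<open>i\<close> has one sign
      at all nearby parameters other than \<open>t0\<close>, since the other walls keep
      theirs.\<close>
    assume uu: "u = u'"
    have ch: "chamber u (V t $ 3) (V t $ 4)" if "t \<in> {0..1}" "\<bar>t - t0\<bar> \<le> e" "t \<noteq> t0" for t
    proof -
      have "\<gamma> t \<in> Cc u" using a(2)[OF that(1)] b(2)[OF that(1)] that e uu by (cases "t < t0") auto
      then show ?thesis using conf_in_region[OF scale_inv_chamber sc(2)[OF that(1)]] sc(1)[OF that(1)] by simp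
    qed
    let ?s = "t0 - e"
    have s: "?s \<in> {0..1}" "\<bar>?s - t0\<bar> \<le> e" "?s \<noteq> t0" using e by auto
    have pos: "?d i t * ?d i ?s > 0" if "t \<in> {0..1}" "\<bar>t - t0\<bar> \<le> e" "t \<noteq> t0" for t
    proof (rule chamber_same_side[OF ch[OF that] ch[OF s]])
      fix j assume "j \<noteq> i"
      then have "?d j t * ?d j t0 > 0" "?d j ?s * ?d j t0 > 0" using that s e by (auto intro!: d(3) simp del: wall_simps)
      then show "?d j t * ?d j ?s > 0" by (auto simp: zero_less_mult_iff simp del: wall_simps)
    qed
    define \<epsilon> where "\<epsilon> = sgn (?d i ?s)"
    have eps: "\<epsilon> \<in> {1, -1}" using pos[OF s] by (auto simp: \<epsilon>_def sgn_if simp del: wall_simps)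
    obtain t where t: "t \<in> {0..1}" "\<bar>t - t0\<bar> < e" "\<epsilon> * ?d i t < 0" using chg[OF eps e(1)] by blast
    show False
    proof (cases "t = t0")
      case True then show ?thesis using t(3) d0[of i] by (simp del: wall_simps)
    next
      case False
      then have "?d i t * ?d i ?s > 0" using t pos by simp
      then show False using t(3) by (auto simp: \<epsilon>_def sgn_if zero_less_mult_iff simp del: wall_simps split: if_splits)
    qed
  qed
  ultimately show ?thesis by (elim disjE) simp_all
qed

lemma nonsingular_constant:
  assumes sp: "smooth_path \<gamma>" and K: "connected K" "K \<subseteq> {0..1}" "K \<inter> singular_values \<gamma> = {}" and k: "k \<in> K" "l \<in> K"
  shows "\<gamma> l \<in> Cc (chamber_of (\<gamma> k))"
proof -
  have gX: "\<gamma> ` {0..1} \<subseteq> X" using sp unfolding smooth_path_def by blast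
  have Dd: "\<gamma> s \<in> Cc (chamber_of (\<gamma> s))" if "s \<in> K" for s
  proof -
    have "s \<in> {0..1}" "s \<notin> singular_values \<gamma>" using that K by blast+
    then have "\<gamma> s \<in> Dd" using not_singular_iff[OF subsetD[OF gX imageI]] unfolding singular_values_def by blast
    then obtain v where "\<gamma> s \<in> Cc v" using Dd_Cc by blast
    then show ?thesis using chamber_of by metis
  qed
  have "chamber_of (\<gamma> k) = chamber_of (\<gamma> l)"
  proof (rule constant_on_connected[OF K(1) _ k])
    fix s assume s: "s \<in> K"
    then have "eventually (\<lambda>y. y \<in> {0..1} \<longrightarrow> \<gamma> y \<in> X \<longrightarrow> \<gamma> y \<in> Cc (chamber_of (\<gamma> s))) (nhds s)"
      using K by (intro eventually_nhds_continuous_on[OF smooth_path_continuous[OF sp]] chamber_open Dd) auto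
    then show "eventually (\<lambda>y. y \<in> K \<longrightarrow> chamber_of (\<gamma> y) = chamber_of (\<gamma> s)) (nhds s)"
      by eventually_elim (use gX K(2) chamber_of in blast)
  qed
  with Dd[OF k(2)] show ?thesis by simp
qed

lemma good_stableD:
  assumes "good_stable \<gamma>"
  shows "smooth_path \<gamma>" "\<not> singular (\<gamma> 0)" "\<not> singular (\<gamma> 1)" "finite (singular_values \<gamma>)"
    "\<And>t. t \<in> singular_values \<gamma> \<Longrightarrow> \<exists>m. has_type \<gamma> t m \<and> stable \<gamma> t m"
proof -
  note gs = assms[unfolded good_stable_def]
  show "smooth_path \<gamma>" by (rule conjunct1[OF gs])
  note gs = conjunct2[OF gs]
  show "\<not> singular (\<gamma> 0)" by (rule conjunct1[OF gs])
  note gs = conjunct2[OF gs]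
  show "\<not> singular (\<gamma> 1)" by (rule conjunct1[OF gs])
  note gs = conjunct2[OF gs]
  show "finite (singular_values \<gamma>)" by (rule conjunct1[OF gs])
  show "\<exists>m. has_type \<gamma> t m \<and> stable \<gamma> t m" if "t \<in> singular_values \<gamma>" for t
    by (rule bspec[OF conjunct2[OF gs] that])
qed

lemma path_walk:
  assumes gs: "good_stable \<gamma>"
  shows "sorted_wrt (<) ts \<Longrightarrow> 0 \<le> a \<Longrightarrow> a \<le> b \<Longrightarrow> b \<le> 1 \<Longrightarrow> singular_values \<gamma> \<inter> {a..b} = set ts \<Longrightarrow>
     a \<notin> set ts \<Longrightarrow> b \<notin> set ts \<Longrightarrow>
     chamber_of (\<gamma> b) = act_word (chamber_of (\<gamma> a)) (map (\<lambda>t. letter (THE m. has_type \<gamma> t m)) ts)"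
proof (induction ts arbitrary: a)
  case Nil
  have "\<gamma> b \<in> Cc (chamber_of (\<gamma> a))"
    using Nil by (intro nonsingular_constant[OF good_stableD(1)[OF gs], of "{a..b}"]) auto
  then show ?case by (simp add: chamber_of)
next
  case (Cons t ts)
  have sp: "smooth_path \<gamma>" by (rule good_stableD(1)[OF gs])
  have t: "t \<in> singular_values \<gamma>" "a < t" "t < b"
  proof -
    have "t \<in> singular_values \<gamma> \<inter> {a..b}" unfolding Cons.prems(5) by simp
    then show "t \<in> singular_values \<gamma>" "a < t" "t < b" using Cons.prems(6,7) by (auto simp: less_le)
  qed
  obtain m where m: "has_type \<gamma> t m" "stable \<gamma> t m" using good_stableD(5)[OF gs t(1)] by blast
  then have "m \<in> triples" by (auto simp: has_type_def collinear_triples_def)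
  then obtain i where i: "m = T i" using triples_T by blast
  have the: "(THE m. has_type \<gamma> t m) = T i" using m(1) unfolding has_type_def i by simp
  \<comment> \<open>The midpoint between \<open>t\<close> and the next singular value, or the end
    \<open>b\<close> after the last one. The interval from \<open>t\<close> to \<open>c\<close> then
    contains no further singular value.\<close>
  define c where "c = (t + (if ts = [] then b else hd ts)) / 2"
  have ts: "t < s" "s < b" if "s \<in> set ts" for s
  proof -
    have "s \<in> singular_values \<gamma> \<inter> {a..b}" unfolding Cons.prems(5) using that by simp
    then show "s < b" using Cons.prems(7) that by (auto simp: less_le)
    show "t < s" using Cons.prems(1) that by simp
  qed
  have "t < (if ts = [] then b else hd ts)" "(if ts = [] then b else hd ts) \<le> b"
    using t ts[of "hd ts"] by (auto simp: less_imp_le)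
  then have c: "t < c" "c < b" "c < (if ts = [] then b else hd ts)" unfolding c_def by (auto simp: field_simps)
  have cs: "c < s" if "s \<in> set ts" for s
  proof -
    have "hd ts \<le> s" using that Cons.prems(1) by (cases ts) auto
    then show ?thesis using c(3) that by (cases "ts = []") auto
  qed
  have S: "s \<in> singular_values \<gamma> \<longleftrightarrow> s = t \<or> s \<in> set ts" if "a \<le> s" "s \<le> b" for s
    using eqset_imp_iff[OF Cons.prems(5), of s] that by simp
  have right: "\<gamma> s \<in> Cc (chamber_of (\<gamma> c))" if "t < s" "s \<le> c" for s
  proof (rule nonsingular_constant[OF sp, of "{t<..c}"])
    have False if "x \<in> singular_values \<gamma>" "t < x" "x \<le> c" for x
    proof -
      have "a \<le> x" "x \<le> b" "x \<noteq> t" using that t c by linarith+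
      then have "x \<in> set ts" using S[of x] that(1) by blast
      from cs[OF this] that(3) show False by linarith
    qed
    then show "{t<..c} \<inter> singular_values \<gamma> = {}" by auto
    show "connected {t<..c}" by (rule convex_connected) (rule convex_real_interval)
  qed (use that c t Cons.prems in auto)
  have left: "\<gamma> s \<in> Cc (chamber_of (\<gamma> a))" if "a \<le> s" "s < t" for s
  proof (rule nonsingular_constant[OF sp, of "{a..<t}"])
    have False if "x \<in> singular_values \<gamma>" "a \<le> x" "x < t" for x
      using S[of x] that t ts(1)[of x] by auto
    then show "{a..<t} \<inter> singular_values \<gamma> = {}" by auto
    show "connected {a..<t}" by (rule convex_connected) (rule convex_real_interval)
  qed (use that c t Cons.prems in auto)
  have "chamber_of (\<gamma> c) = act (chamber_of (\<gamma> a)) i"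
    using Cons.prems t c left right m unfolding i
    by (intro crossing[OF sp, of t i a "chamber_of (\<gamma> a)" c]) auto
  moreover have "chamber_of (\<gamma> b) = act_word (chamber_of (\<gamma> c)) (map (\<lambda>t. letter (THE m. has_type \<gamma> t m)) ts)"
  proof (rule Cons.IH)
    show "singular_values \<gamma> \<inter> {c..b} = set ts"
    proof (intro subset_antisym subsetI)
      fix s assume "s \<in> singular_values \<gamma> \<inter> {c..b}"
      then show "s \<in> set ts" using S[of s] t c by auto
    next
      fix s assume s: "s \<in> set ts"
      then show "s \<in> singular_values \<gamma> \<inter> {c..b}" using S[of s] ts[OF s] cs[OF s] t by auto
    qed
    show "c \<notin> set ts" using cs by blast
  qed (use Cons.prems c t in auto)
  ultimately show ?case by (simp add: the letter_T)
qed

lemma G43_tilde_subset: "G43_tilde \<subseteq> base_stab"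
proof
  fix x assume "x \<in> G43_tilde"
  then obtain \<gamma> where x: "x = G43_element (path_word \<gamma>)" and gs: "good_stable \<gamma>" and b: "\<gamma> 0 = base_config" "\<gamma> 1 = base_config"
    unfolding G43_tilde_def by blast
  let ?ts = "sorted_list_of_set (singular_values \<gamma>)"
  have fin: "finite (singular_values \<gamma>)" by (rule good_stableD(4)[OF gs])
  have "(THE m. has_type \<gamma> t m) \<in> triples" if t: "t \<in> set ?ts" for t
  proof -
    obtain m where "has_type \<gamma> t m" using good_stableD(5)[OF gs, of t] t fin by auto
    then show ?thesis unfolding has_type_def collinear_triples_def by auto
  qed
  then have "set (path_word \<gamma>) \<subseteq> triples" unfolding path_word_def by auto
  then have "x = cl (map letter (path_word \<gamma>))" using x G43_element_cl by simp
  moreover have "chamber_of (\<gamma> 1) = act_word (chamber_of (\<gamma> 0)) (map (\<lambda>t. letter (THE m. has_type \<gamma> t m)) ?ts)"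
  proof (rule path_walk[OF gs])
    show "singular_values \<gamma> \<inter> {0..1} = set ?ts" using fin by (auto simp: singular_values_def)
    show "0 \<notin> set ?ts" "1 \<notin> set ?ts" using fin good_stableD(2,3)[OF gs] by (auto simp: singular_values_def)
  qed simp_all
  moreover have "chamber_of base_config = v0"
    using chamber_pt_in[of v0] unfolding chamber_pt_base by (rule chamber_of)
  moreover have "map letter (path_word \<gamma>) = map (\<lambda>t. letter (THE m. has_type \<gamma> t m)) ?ts"
    by (simp add: path_word_def comp_def)
  ultimately have "act_word v0 (map letter (path_word \<gamma>)) = v0" "x = cl (map letter (path_word \<gamma>))"
    using b by simp_all
  then show "x \<in> base_stab" unfolding base_stab_def by (intro CollectI exI conjI)
qed

section \<open>Loops with a given word\<close>

lemma has_vector_derivative_vec: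
  fixes f :: "real \<Rightarrow> ('a::real_normed_vector)^'n"
  assumes "\<And>i. ((\<lambda>t. f t $ i) has_vector_derivative f' $ i) (at x within S)"
  shows "(f has_vector_derivative f') (at x within S)"
  unfolding has_vector_derivative_def has_derivative_within
proof (intro conjI bounded_linear_scaleR_left vec_tendstoI)
  fix i
  show "((\<lambda>y. ((1 / norm (y - x)) *\<^sub>R (f y - (f x + (y - x) *\<^sub>R f'))) $ i) \<longlongrightarrow> 0 $ i) (at x within S)"
    using assms[of i] unfolding has_vector_derivative_def has_derivative_within by simp
qed

lemma smooth_on_poly_curve:
  fixes P :: "real poly ^ 'm ^ 'n"
  shows "smooth_on S (\<lambda>t. (\<chi> j k. poly (P $ j $ k) t) :: real^'m^'n)"
  unfolding smooth_on_def
proof (intro exI[of _ "\<lambda>n t. \<chi> j k. poly ((pderiv ^^ n) (P $ j $ k)) t"] conjI ballI allI)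
  fix n t
  have "((\<lambda>t. poly ((pderiv ^^ n) (P $ j $ k)) t) has_vector_derivative poly ((pderiv ^^ Suc n) (P $ j $ k)) t) (at t within S)" for j k
    unfolding has_real_derivative_iff_has_vector_derivative[symmetric] using has_field_derivative_at_within[OF poly_DERIV] by simp
  then show "((\<lambda>t. (\<chi> j k. poly ((pderiv ^^ n) (P $ j $ k)) t) :: real^'m^'n) has_vector_derivative
      (\<chi> j k. poly ((pderiv ^^ Suc n) (P $ j $ k)) t)) (at t within S)"
    by (intro has_vector_derivative_vec) simp
qed simp

definition wall_deriv :: "4 \<Rightarrow> real^3^4 \<Rightarrow> real^3^4 \<Rightarrow> real" where
  "wall_deriv i V U = (if i = 1 then U$3$1 * V$4$3 + V$3$1 * U$4$3 - (U$3$3 * V$4$1 + V$3$3 * U$4$1)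
     else if i = 2 then U$3$2 * V$4$3 + V$3$2 * U$4$3 - (U$3$3 * V$4$2 + V$3$3 * U$4$2)
     else if i = 3 then U$4$3 else U$3$3)"

lemma wall_has_derivative:
  assumes "(W has_vector_derivative U) (at t within S)"
  shows "((\<lambda>t. wall i (W t $ 3) (W t $ 4)) has_real_derivative wall_deriv i (W t) U) (at t within S)"
proof -
  have c [derivative_intros]: "((\<lambda>t. W t $ j $ k) has_real_derivative U $ j $ k) (at t within S)" for j k
    unfolding has_real_derivative_iff_has_vector_derivative
    by (rule bounded_linear.has_vector_derivative[OF bounded_linear_vec_nth
          bounded_linear.has_vector_derivative[OF bounded_linear_vec_nth assms]])
  show ?thesis unfolding wall_def wall_deriv_def
    by (cases "i = 1"; cases "i = 2"; cases "i = 3") (auto intro!: derivative_eq_intros)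
qed

lemma isCont_wall_deriv: "isCont (\<lambda>z. wall_deriv i (fst z) (snd z)) z"
  unfolding wall_deriv_def by (cases "i = 1"; cases "i = 2"; cases "i = 3") (auto intro!: continuous_intros)

text \<open>For a C1-small perturbation the derivative of the wall keeps its sign on a fixed
  interval around \<open>t0\<close>, so there is at most one zero; the values on either side of
  \<open>t0\<close> keep opposite signs, so there is one by the intermediate value theorem.\<close>

lemma stableI:
  assumes gX: "\<gamma> ` {0..1} \<subseteq> X" and V: "smooth_coords V \<gamma>" and t0: "0 < t0" "t0 < 1"
    and z: "wall i (V t0 $ 3) (V t0 $ 4) = 0"
    and der: "((\<lambda>t. wall i (V t $ 3) (V t $ 4)) has_real_derivative c) (at t0)" "c \<noteq> 0"
  shows "stable \<gamma> t0 (T i)"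
proof -
  let ?d = "\<lambda>W t. wall i (W t $ 3) (W t $ 4)"
  let ?D = "\<lambda>W t. vector_derivative W (at t within {0..1})"
  have smV: "smooth_on {0..1} V" using V by (simp add: smooth_coords_def)
  have within: "at t within {0..1} = at t" if "0 < t" "t < 1" for t :: real
    by (rule at_within_interior) (use that in simp)
  have t0': "t0 \<in> {0..1}" using t0 by simp
  have "(?d V has_real_derivative wall_deriv i (V t0) (?D V t0)) (at t0)"
    using wall_has_derivative[OF smooth_on_derivative(1)[OF smV t0'], of i] within[OF t0] by simp
  then have c: "c = wall_deriv i (V t0) (?D V t0)" by (rule DERIV_unique[OF der(1)])
  define \<sigma> where "\<sigma> = sgn c"
  have "((\<lambda>z. \<sigma> * wall_deriv i (fst z) (snd z)) \<longlongrightarrow> \<sigma> * wall_deriv i (fst (V t0, ?D V t0)) (snd (V t0, ?D V t0))) (nhds (V t0, ?D V t0))"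
    by (intro tendsto_nhdsI continuous_intros isCont_wall_deriv)
  moreover have "\<sigma> * c > 0" using der(2) by (simp add: \<sigma>_def sgn_if)
  ultimately have "eventually (\<lambda>z. \<sigma> * wall_deriv i (fst z) (snd z) > 0) (nhds (V t0, ?D V t0))"
    using order_tendstoD(1)[of _ _ _ 0] unfolding c by simp
  \<comment> \<open>Below, \<open>r\<close> is split into quarters: values and derivatives each
    deviate once by the perturbation and once by moving the parameter away from
    \<open>t0\<close>.\<close>
  then obtain r where r: "r > 0" "\<And>z. dist z (V t0, ?D V t0) < r \<Longrightarrow> \<sigma> * wall_deriv i (fst z) (snd z) > 0"
    unfolding eventually_nhds_metric by blast
  have "eventually (\<lambda>t. t \<in> {0..1} \<longrightarrow> dist (V t) (V t0) < r/4) (nhds t0)"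
    "eventually (\<lambda>t. t \<in> {0..1} \<longrightarrow> dist (?D V t) (?D V t0) < r/4) (nhds t0)"
    using r(1) by (intro eventually_nhds_continuous_on[OF smooth_on_continuous[OF smV] t0', where P = "\<lambda>x. dist x (V t0) < r/4"]
        eventually_nhds_continuous_on[OF smooth_on_derivative(2)[OF smV] t0', where P = "\<lambda>x. dist x (?D V t0) < r/4"];
        intro eventually_nhds_metric[THEN iffD2] exI[of _ "r/4"]; simp)+
  then have "eventually (\<lambda>t. t \<in> {0..1} \<longrightarrow> dist (V t) (V t0) < r/4 \<and> dist (?D V t) (?D V t0) < r/4) (nhds t0)"
    by eventually_elim simp
  then obtain d where d: "d > 0" "\<And>t. \<bar>t - t0\<bar> < d \<Longrightarrow> t \<in> {0..1} \<Longrightarrow> dist (V t) (V t0) < r/4 \<and> dist (?D V t) (?D V t0) < r/4"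
    unfolding eventually_nhds_metric dist_real_def by blast
  \<comment> \<open>This keeps all parameters in the open unit interval, where derivatives within
    the closed interval are ordinary ones.\<close>
  define \<delta>0 where "\<delta>0 = min d (min t0 (1 - t0))"
  have d0: "\<delta>0 > 0" "\<delta>0 \<le> d" "\<delta>0 \<le> t0" "\<delta>0 \<le> 1 - t0" using d(1) t0 by (auto simp: \<delta>0_def)
  have mono: "\<sigma> * ?d W a < \<sigma> * ?d W b"
    if W: "smooth_on {0..1} W" "C1_close \<epsilon> V W" "\<epsilon> \<le> r/4" and ab: "t0 - \<delta>0 < a" "a < b" "b < t0 + \<delta>0" for W \<epsilon> a b
  proof (rule DERIV_pos_imp_increasing[OF ab(2)])
    fix t assume t: "a \<le> t" "t \<le> b"
    then have tt: "0 < t" "t < 1" "\<bar>t - t0\<bar> < d" using ab d0 by auto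
    then have ti: "t \<in> {0..1}" by simp
    have "(?d W has_real_derivative wall_deriv i (W t) (?D W t)) (at t)"
      using wall_has_derivative[OF smooth_on_derivative(1)[OF W(1) ti], of i] within[OF tt(1,2)] by simp
    then have "((\<lambda>t. \<sigma> * ?d W t) has_real_derivative \<sigma> * wall_deriv i (W t) (?D W t)) (at t)"
      by (rule DERIV_cmult)
    moreover have "dist (W t, ?D W t) (V t0, ?D V t0) < r"
    proof -
      have "dist (W t) (V t) < r/4" "dist (?D W t) (?D V t) < r/4"
        using W(2,3) ti unfolding C1_close_def dist_norm by force+
      moreover have "dist (V t) (V t0) < r/4" "dist (?D V t) (?D V t0) < r/4" using d(2)[OF tt(3) ti] by auto
      ultimately have "dist (W t) (V t0) + dist (?D W t) (?D V t0) < r"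
        using dist_triangle[of "W t" "V t0" "V t"] dist_triangle[of "?D W t" "?D V t0" "?D V t"] by linarith
      moreover have "dist (W t, ?D W t) (V t0, ?D V t0) \<le> dist (W t) (V t0) + dist (?D W t) (?D V t0)"
        unfolding dist_Pair_Pair by (rule sqrt_sum_squares_le_sum) simp_all
      ultimately show ?thesis by linarith
    qed
    ultimately show "\<exists>y. ((\<lambda>t. \<sigma> * ?d W t) has_real_derivative y) (at t) \<and> y > 0"
      using r(2)[of "(W t, ?D W t)"] by auto
  qed
  have "\<exists>\<epsilon>>0. \<forall>\<gamma>' V'. smooth_path \<gamma>' \<and> smooth_coords V' \<gamma>' \<and> C1_close \<epsilon> V V' \<longrightarrow>
      (\<exists>!t'. t' \<in> {0..1} \<and> \<bar>t' - t0\<bar> < \<delta> \<and> T i \<in> collinear_triples (\<gamma>' t'))" if wall: "0 < \<delta>" "\<delta> < \<delta>0" for \<delta>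
  proof -
    have close: "C1_close (r/4) V V" using r(1) by (simp add: C1_close_def)
    let ?a = "t0 - \<delta>/2" and ?b = "t0 + \<delta>/2"
    have sg: "\<sigma> * ?d V ?a < 0" "\<sigma> * ?d V ?b > 0"
      using mono[OF smV close, of ?a t0] mono[OF smV close, of t0 ?b] wall z by auto
    have ct: "((\<lambda>x. \<sigma> * wall i (x $ 3) (x $ 4)) \<longlongrightarrow> \<sigma> * wall i (y $ 3) (y $ 4)) (nhds y)" for y :: "real^3^4"
    proof (rule tendsto_nhdsI)
      show "isCont (\<lambda>x. \<sigma> * wall i (x $ 3) (x $ 4)) y" using exhaust_4[of i] by (auto intro!: continuous_intros)
    qed
    obtain r1 where r1: "r1 > 0" "\<And>x. dist x (V ?a) < r1 \<Longrightarrow> \<sigma> * wall i (x $ 3) (x $ 4) < 0"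
      using order_tendstoD(2)[OF ct sg(1)] unfolding eventually_nhds_metric by blast
    obtain r2 where r2: "r2 > 0" "\<And>x. dist x (V ?b) < r2 \<Longrightarrow> \<sigma> * wall i (x $ 3) (x $ 4) > 0"
      using order_tendstoD(1)[OF ct sg(2)] unfolding eventually_nhds_metric by blast
    \<comment> \<open>The bound \<open>r/4\<close> preserves monotonicity; \<open>r1\<close> and
      \<open>r2\<close> preserve the signs at the distance \<open>\<delta>/2\<close> from
      \<open>t0\<close>.\<close>
    define \<epsilon> where "\<epsilon> = min (r/4) (min r1 r2)"
    have e: "\<epsilon> > 0" "\<epsilon> \<le> r/4" "\<epsilon> \<le> r1" "\<epsilon> \<le> r2" using r(1) r1(1) r2(1) by (auto simp: \<epsilon>_def)
    have "\<exists>!t'. t' \<in> {0..1} \<and> \<bar>t' - t0\<bar> < \<delta> \<and> T i \<in> collinear_triples (\<gamma>' t')"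
      if sp: "smooth_path \<gamma>'" and W: "smooth_coords W \<gamma>'" and cl: "C1_close \<epsilon> V W" for \<gamma>' W
    proof -
      have smW: "smooth_on {0..1} W" using W by (simp add: smooth_coords_def)
      have X': "\<gamma>' ` {0..1} \<subseteq> X" using sp by (simp add: smooth_path_def)
      have ab: "?a \<in> {0..1}" "?b \<in> {0..1}" "?a \<le> ?b" using wall d0 by auto
      have "dist (W ?a) (V ?a) < r1" "dist (W ?b) (V ?b) < r2"
        using bspec[OF cl[unfolded C1_close_def] ab(1)] bspec[OF cl[unfolded C1_close_def] ab(2)] e(3,4)
        unfolding dist_norm by linarith+
      then have s: "\<sigma> * ?d W ?a \<le> 0" "0 \<le> \<sigma> * ?d W ?b" using r1(2) r2(2) by (auto intro: less_imp_le)
      have cW: "continuous_on {?a..?b} (\<lambda>t. W t $ j)" for j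
        using ab by (intro continuous_intros continuous_on_subset[OF smooth_on_continuous[OF smW]]) auto
      have "continuous_on {?a..?b} (\<lambda>t. \<sigma> * ?d W t)"
        using exhaust_4[of i] by (auto intro!: continuous_intros cW)
      from IVT'[OF s ab(3) this] obtain t where t: "?a \<le> t" "t \<le> ?b" "\<sigma> * ?d W t = 0" by blast
      have s0: "\<sigma> \<noteq> 0" using der(2) by (simp add: \<sigma>_def sgn_if)
      note iff = smooth_coords_config(3)[OF W X', of _ i]
      show ?thesis
      proof (rule ex1I[of _ t])
        show "t \<in> {0..1} \<and> \<bar>t - t0\<bar> < \<delta> \<and> T i \<in> collinear_triples (\<gamma>' t)"
          using t s0 ab wall iff[of t] by (auto simp del: wall_simps)
        fix u assume u: "u \<in> {0..1} \<and> \<bar>u - t0\<bar> < \<delta> \<and> T i \<in> collinear_triples (\<gamma>' u)"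
        then have u0: "\<sigma> * ?d W u = 0" using iff[of u] by simp
        have "\<not> u < t" "\<not> t < u"
          using mono[OF smW cl e(2), of u t] mono[OF smW cl e(2), of t u] u0 t u wall by (auto simp del: wall_simps simp: abs_less_iff)
        then show "u = t" by simp
      qed
    qed
    with e(1) show ?thesis by blast
  qed
  then have "\<forall>\<^sub>F \<delta> in at_right 0. \<exists>\<epsilon>>0. \<forall>\<gamma>' V'. smooth_path \<gamma>' \<and> smooth_coords V' \<gamma>' \<and> C1_close \<epsilon> V V' \<longrightarrow>
      (\<exists>!t'. t' \<in> {0..1} \<and> \<bar>t' - t0\<bar> < \<delta> \<and> T i \<in> collinear_triples (\<gamma>' t'))"
    unfolding eventually_at_right_field using d0(1) by blast
  with V show ?thesis unfolding stable_def by blast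
qed

text \<open>A monic polynomial with a linear factor for each occurrence of the letter
  \<open>i\<close>, at the time assigned to that occurrence.\<close>

fun wall_poly :: "4 \<Rightarrow> (4 \<times> real) list \<Rightarrow> real poly" where
  "wall_poly i [] = 1"
| "wall_poly i ((j, t) # zs) = (if j = i then [:- t, 1:] else 1) * wall_poly i zs"

lemma wall_poly_eq_0: "poly (wall_poly i zs) t = 0 \<longleftrightarrow> (i, t) \<in> set zs"
  by (induction i zs rule: wall_poly.induct) (auto simp: algebra_simps)

text \<open>The zeros are simple because the assigned times are pairwise different: in the product
  rule exactly one term survives at each zero.\<close>

lemma wall_poly_simple:
  "distinct (map snd zs) \<Longrightarrow> (i, t) \<in> set zs \<Longrightarrow> poly (pderiv (wall_poly i zs)) t \<noteq> 0"
proof (induction i zs rule: wall_poly.induct)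
  case (2 i j s zs)
  show ?case
  proof (cases "j = i")
    case True
    have d: "poly (pderiv (wall_poly i ((j, s) # zs))) t = (t - s) * poly (pderiv (wall_poly i zs)) t + poly (wall_poly i zs) t"
      unfolding wall_poly.simps pderiv_mult using True by (simp add: pderiv_pCons algebra_simps)
    show ?thesis
    proof (cases "t = s")
      case True
      then have "(i, t) \<notin> set zs" using 2(2) by force
      then show ?thesis unfolding d using True wall_poly_eq_0[of i zs t] by simp
    next
      case False
      then have "(i, t) \<in> set zs" using 2(3) by auto
      then show ?thesis unfolding d using False 2 wall_poly_eq_0[of i zs t] by simp
    qed
  qed (use 2 in auto)
qed simp

lemma wall_poly_1: "\<forall>z\<in>set zs. snd z < 1 \<Longrightarrow> poly (wall_poly i zs) 1 > 0"
  by (induction i zs rule: wall_poly.induct) auto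

text \<open>Each occurrence of a letter contributes the negative factor \<open>- t\<close> at 0. The
  letters entering the first product are 1, 3 and 4, just those that flip the first component of the
  chamber; likewise 2, 3 and 4 for the second.\<close>

lemma wall_poly_0:
  assumes "\<forall>z\<in>set zs. 0 < snd z"
  shows "poly (wall_poly 3 zs) 0 * poly (wall_poly 4 zs) 0 * poly (wall_poly 1 zs) 0 > 0
       \<longleftrightarrow> fst (act_word v (map fst zs)) = fst v" (is "?A v zs")
    "poly (wall_poly 3 zs) 0 * poly (wall_poly 4 zs) 0 * poly (wall_poly 2 zs) 0 > 0
       \<longleftrightarrow> snd (act_word v (map fst zs)) = snd v" (is "?B v zs")
proof -
  have "?A v zs \<and> ?B v zs" using assms
  proof (induction zs arbitrary: v)
    case (Cons z zs)
    obtain j t where z: "z = (j, t)" by (cases z)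
    have t: "t > 0" using Cons.prems by (simp add: z)
    have nz: "poly (wall_poly i zs) 0 \<noteq> 0" for i using wall_poly_eq_0[of i zs 0] Cons.prems by force
    let ?Q = "\<lambda>i. poly (wall_poly i zs) 0"
    have neg: "- (t * x) > 0 \<longleftrightarrow> \<not> x > 0" if "x \<noteq> 0" for x
      using t that by (auto simp: zero_less_mult_iff mult_less_0_iff)
    have AB: "?Q 3 * ?Q 4 * ?Q 1 \<noteq> 0" "?Q 3 * ?Q 4 * ?Q 2 \<noteq> 0" using nz by simp_all
    have IH: "?A (act v j) zs" "?B (act v j) zs" using Cons.IH[of "act v j"] Cons.prems by simp_all
    obtain a b where v: "v = (a, b)" by (cases v)
    have f: "fst (act v j) = (if j = 2 then fst v else \<not> fst v)" "snd (act v j) = (if j = 1 then snd v else \<not> snd v)"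
      by (auto simp: v)
    have e: "poly (wall_poly 3 (z # zs)) 0 * poly (wall_poly 4 (z # zs)) 0 * poly (wall_poly 1 (z # zs)) 0 =
        (if j = 2 then ?Q 3 * ?Q 4 * ?Q 1 else - (t * (?Q 3 * ?Q 4 * ?Q 1)))"
      "poly (wall_poly 3 (z # zs)) 0 * poly (wall_poly 4 (z # zs)) 0 * poly (wall_poly 2 (z # zs)) 0 =
        (if j = 1 then ?Q 3 * ?Q 4 * ?Q 2 else - (t * (?Q 3 * ?Q 4 * ?Q 2)))"
      using exhaust_4[of j] by (auto simp: z)
    show ?case unfolding e using IH neg[OF AB(1)] neg[OF AB(2)] f by (auto simp: z)
  qed simp
  then show "?A v zs" "?B v zs" by blast+
qed

lemma affine_negative:
  fixes a b t :: real
  assumes "a < 0" "b < 0" "0 \<le> t" "t \<le> 1" shows "a + t * (b - a) < 0"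
proof -
  have "a + t * (b - a) = (1 - t) * a + t * b" by (simp add: algebra_simps)
  moreover have "(1 - t) * a + t * b < 0"
  proof (cases "t = 1")
    case False
    then have "(1 - t) * a < 0" "t * b \<le> 0" using assms by (auto simp: mult_less_0_iff mult_le_0_iff)
    then show ?thesis by simp
  qed (use assms in simp)
  ultimately show ?thesis by simp
qed

lemma distinct_pts_at_most_one_wall:
  assumes "\<And>i j. wall i v w = 0 \<Longrightarrow> wall j v w = 0 \<Longrightarrow> i = j" shows "distinct_pts v w"
proof -
  have "\<exists>i. \<forall>j. j \<noteq> i \<longrightarrow> wall j v w \<noteq> 0" using assms by blast
  then show ?thesis using star_exists_at star_distinct_pts by blast
qed

text \<open>The third coordinates of the two points are prescribed by the walls 3 and 4. The walls 1
  and 2 are then linear equations for the other coordinates, solved over polynomials after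
  multiplication with the positive sum of squares \<open>N\<close>.\<close>

lemma polynomial_path:
  fixes zs :: "(4 \<times> real) list"
  assumes srt: "sorted_wrt (<) (map snd zs)" and tm: "\<And>i t. (i, t) \<in> set zs \<Longrightarrow> 0 < t \<and> t < 1"
    and cl: "act_word v0 (map fst zs) = v0"
  shows "\<exists>\<gamma>. good_stable \<gamma> \<and> \<gamma> 0 = base_config \<and> \<gamma> 1 = base_config \<and> path_word \<gamma> = map (\<lambda>z. T (fst z)) zs"
proof -
  have dist: "distinct (map snd zs)" using srt by (simp add: strict_sorted_iff)
  define Q where "Q i = wall_poly i zs" for i
  have Q0: "poly (Q i) t = 0 \<longleftrightarrow> (i, t) \<in> set zs" for i t unfolding Q_def by (rule wall_poly_eq_0)
  have uniq: "i = j" if "(i, t) \<in> set zs" "(j, t) \<in> set zs" for i j t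
    using eq_key_imp_eq_value[of "map (\<lambda>z. (snd z, fst z)) zs" t i j] dist that by (force simp: comp_def)
  \<comment> \<open>The letters 3 and 4 never occur at the same time, so \<open>Q 3\<close> and
    \<open>Q 4\<close> have no common zero and \<open>N\<close> is positive everywhere.\<close>
  define N where "N = Q 4 * Q 4 + Q 3 * Q 3"
  have N: "poly N t > 0" for t
  proof -
    have "poly (Q 4) t \<noteq> 0 \<or> poly (Q 3) t \<noteq> 0" using uniq[of 4 t 3] Q0[of _ t] by auto
    then have "(poly (Q 4) t)\<^sup>2 + (poly (Q 3) t)\<^sup>2 > 0" by (simp add: sum_power2_gt_zero_iff)
    then show ?thesis by (simp add: N_def power2_eq_square)
  qed
  have Qne: "poly (Q i) 0 \<noteq> 0" "poly (Q i) 1 \<noteq> 0" for i unfolding Q0 using tm by force+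
  \<comment> \<open>This factor makes the walls 1 and 2 stand in the ratio to the product of the
    walls 3 and 4 required at the base configuration; \<open>\<kappa>\<close> interpolates it
    linearly between the times 0 and 1.\<close>
  define k where "k i t = - (poly (Q 4) t * poly (Q 3) t / poly (Q i) t)" for i t
  define \<kappa> where "\<kappa> i = [: k i 0, k i 1 - k i 0 :]" for i
  have Q1: "poly (Q i) 1 > 0" for i unfolding Q_def using tm by (intro wall_poly_1) auto
  \<comment> \<open>At time 1 all \<open>Q i\<close> are positive. At time 0 the sign is right
    because the word fixes \<open>v0\<close>; equal signs at both ends keep \<open>\<kappa>\<close>
    from adding zeros to the walls.\<close>
  have kneg: "k i 1 < 0" "k i 0 < 0" if i: "i = 1 \<or> i = 2" for i
  proof -
    show "k i 1 < 0" using Q1 by (simp add: k_def)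
    have "\<forall>z\<in>set zs. 0 < snd z" using tm by auto
    from wall_poly_0[OF this, of v0] cl have "poly (Q 3) 0 * poly (Q 4) 0 * poly (Q i) 0 > 0"
      using i by (auto simp: Q_def)
    then have "poly (Q 4) 0 * poly (Q 3) 0 / poly (Q i) 0 > 0"
      by (simp add: zero_less_divide_iff zero_less_mult_iff mult_less_0_iff) blast
    then show "k i 0 < 0" by (simp add: k_def)
  qed
  have kap: "poly (\<kappa> i) t < 0" if "i = 1 \<or> i = 2" "t \<in> {0..1}" for i t
    using affine_negative[OF kneg(2,1)[OF that(1)], of t] that(2) by (simp add: \<kappa>_def)
  \<comment> \<open>Adding a multiple of the third coordinates \<open>(N * Q 4, N * Q 3)\<close> to
    the first or second ones changes no wall. The multiplier \<open>h\<close> uses this freedom to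
    put \<open>x_3\<close> at the origin at both end times.\<close>
  define hh where "hh t = poly (Q 3) t * poly (Q 3) t / poly N t" for t
  define h where "h = [: hh 0, hh 1 - hh 0 :]"
  define R where "R i = \<kappa> i * Q i" for i
  define PP :: "real poly ^ 3 ^ 4" where "PP = (\<chi> j. if j = 1 then vector [1, 0, 0] else if j = 2 then vector [0, 1, 0]
    else if j = 3 then vector [R 1 * Q 3 + h * N * Q 4, R 2 * Q 3 + h * N * Q 4, N * Q 4]
    else vector [h * N * Q 3 - R 1 * Q 4, h * N * Q 3 - R 2 * Q 4, N * Q 3])"
  define V :: "real \<Rightarrow> real^3^4" where "V t = (\<chi> j k. poly (PP $ j $ k) t)" for t
  define \<gamma> where "\<gamma> t = conf (V t $ 3) (V t $ 4)" for t
  have smV: "smooth_on {0..1} V" unfolding V_def by (rule smooth_on_poly_curve)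
  have V12: "V t $ 1 = vector [1, 0, 0]" "V t $ 2 = vector [0, 1, 0]" for t
    by (simp_all add: V_def PP_def vec_eq_iff forall_3)
  \<comment> \<open>The walls of the curve are the prescribed polynomials up to these factors, which
    have no zeros in the unit interval and so preserve simple zeros.\<close>
  define C where "C i = (if i = 1 then N * N * \<kappa> 1 else if i = 2 then N * N * \<kappa> 2 else N)" for i :: 4
  have dlV: "wall i (V t $ 3) (V t $ 4) = poly (C i * Q i) t" for i t
    using exhaust_4[of i] by (auto simp: V_def PP_def C_def R_def N_def algebra_simps)
  have C: "poly (C i) t \<noteq> 0" if "t \<in> {0..1}" for i t
    using N[of t] kap[of 1 t] kap[of 2 t] that by (auto simp: C_def)
  have dl0: "wall i (V t $ 3) (V t $ 4) = 0 \<longleftrightarrow> (i, t) \<in> set zs" if "t \<in> {0..1}" for i t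
    unfolding dlV using C[OF that] Q0 by simp
  have gd: "distinct_pts (V t $ 3) (V t $ 4)" if "t \<in> {0..1}" for t
    by (rule distinct_pts_at_most_one_wall) (use dl0[OF that] uniq in blast)
  have gX: "\<gamma> ` {0..1} \<subseteq> X"
    using gd distinct_pts_nonzero conf_in_config_space unfolding \<gamma>_def by blast
  have sc: "smooth_coords V \<gamma>"
    unfolding smooth_coords_def
  proof (intro conjI ballI smV)
    fix t :: real assume t: "t \<in> {0..1}"
    have "vector [1, 0, 0] \<noteq> (0 :: real^3)" "vector [0, 1, 0] \<noteq> (0 :: real^3)" by (simp_all add: vec3_eq_0)
    then show "\<forall>j. V t $ j \<noteq> 0 \<and> \<gamma> t $ j = rp2_point (V t $ j)"
      using gd[OF t, THEN distinct_pts_nonzero] unfolding forall_4 V12 by (auto simp: \<gamma>_def)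
  qed
  have sp: "smooth_path \<gamma>" using sc gX unfolding smooth_path_def by blast
  have col: "T i \<in> collinear_triples (\<gamma> t) \<longleftrightarrow> (i, t) \<in> set zs" if "t \<in> {0..1}" for i t
    using smooth_coords_config(3)[OF sc gX that] dl0[OF that] by simp
  have tri: "collinear_triples x \<subseteq> range T" for x unfolding collinear_triples_def triples_T by blast
  have ty: "has_type \<gamma> t (T i)" if it: "(i, t) \<in> set zs" for i t
    unfolding has_type_def
  proof (intro subset_antisym subsetI)
    have t: "t \<in> {0..1}" using tm[OF it] by simp
    fix m assume m: "m \<in> collinear_triples (\<gamma> t)"
    then obtain j where j: "m = T j" using tri by blast
    have "(j, t) \<in> set zs" using m col[OF t] unfolding j by blast
    then show "m \<in> {T i}" using uniq[OF it] j by simp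
  next
    fix m assume "m \<in> {T i}"
    then show "m \<in> collinear_triples (\<gamma> t)" using col[of t i] tm[OF it] it by simp
  qed
  have sv: "singular_values \<gamma> = set (map snd zs)"
  proof (intro subset_antisym subsetI)
    fix t assume "t \<in> singular_values \<gamma>"
    then have t: "t \<in> {0..1}" and "collinear_triples (\<gamma> t) \<noteq> {}" unfolding singular_values_def singular_def by blast+
    then obtain i where "T i \<in> collinear_triples (\<gamma> t)" using tri[of "\<gamma> t"] by blast
    then have "(i, t) \<in> set zs" using col[OF t] by blast
    then show "t \<in> set (map snd zs)" by force
  next
    fix t assume "t \<in> set (map snd zs)"
    then obtain i where i: "(i, t) \<in> set zs" by auto
    show "t \<in> singular_values \<gamma>"
      using ty[OF i] tm[OF i] unfolding singular_values_def singular_def has_type_def by simp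
  qed
  have st: "stable \<gamma> t (T i)" if it: "(i, t) \<in> set zs" for i t
  proof (rule stableI[OF gX sc])
    have t: "t \<in> {0..1}" using tm[OF it] by simp
    show "0 < t" "t < 1" using tm[OF it] by auto
    show "wall i (V t $ 3) (V t $ 4) = 0" using dl0[OF t] it by simp
    show "((\<lambda>t. wall i (V t $ 3) (V t $ 4)) has_real_derivative poly (pderiv (C i * Q i)) t) (at t)"
      unfolding dlV by (rule poly_DERIV)
    have "poly (Q i) t = 0" "poly (pderiv (Q i)) t \<noteq> 0" using Q0 it wall_poly_simple[OF dist it] by (auto simp: Q_def)
    then show "poly (pderiv (C i * Q i)) t \<noteq> 0" using C[OF t] by (simp add: pderiv_mult)
  qed
  have base: "\<gamma> t = base_config" if t: "t = 0 \<or> t = 1" for t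
  proof -
    have t01: "t \<in> {0..1}" using t by auto
    have nz: "poly N t * poly (Q 4) t \<noteq> 0" "poly N t * poly (Q 3) t \<noteq> 0" using t N[of t] Qne by auto
    have R: "poly (R i) t = - (poly (Q 4) t * poly (Q 3) t)" for i
    proof -
      have "poly (\<kappa> i) t = k i t" "poly (Q i) t \<noteq> 0" using t Qne[of i] by (auto simp: \<kappa>_def)
      then show ?thesis by (simp add: R_def k_def)
    qed
    have "poly h t = hh t" using t by (auto simp: h_def)
    then have h: "poly h t * poly N t = poly (Q 3) t * poly (Q 3) t" using N[of t] by (simp add: hh_def)
    have V3: "V t $ 3 = (poly N t * poly (Q 4) t) *\<^sub>R vector [0, 0, 1]"
      by (simp add: V_def PP_def vec_eq_iff forall_3 R h)
    have V4: "V t $ 4 = (poly N t * poly (Q 3) t) *\<^sub>R vector [1, 1, 1]"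
      by (simp add: V_def PP_def vec_eq_iff forall_3 R h) (simp add: N_def algebra_simps)
    have "rp2_point (V t $ 3) = rp2_point (vector [0, 0, 1])" "rp2_point (V t $ 4) = rp2_point (vector [1, 1, 1])"
      unfolding V3 V4 by (intro rp2_point_scaleR nz, simp add: vec3_eq_0)+
    then show ?thesis by (simp add: \<gamma>_def base_config_def vec_eq_iff forall_4)
  qed
  have nsing: "\<not> singular (\<gamma> t)" if "t = 0 \<or> t = 1" for t
  proof -
    have "t \<notin> singular_values \<gamma>" unfolding sv using tm that by force
    then show ?thesis using that unfolding singular_values_def by auto
  qed
  have "good_stable \<gamma>"
    unfolding good_stable_def
  proof (intro conjI sp nsing ballI)
    show "finite (singular_values \<gamma>)" unfolding sv by simp
    fix t assume "t \<in> singular_values \<gamma>"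
    then obtain i where "(i, t) \<in> set zs" unfolding sv by auto
    then show "\<exists>m. has_type \<gamma> t m \<and> stable \<gamma> t m" using ty st by blast
  qed simp_all
  moreover have "path_word \<gamma> = map (\<lambda>z. T (fst z)) zs"
  proof -
    have "sorted_list_of_set (singular_values \<gamma>) = map snd zs"
      unfolding sv using srt by (intro sorted_list_of_set.idem_if_sorted_distinct) (simp_all add: strict_sorted_iff)
    moreover have "(THE m. has_type \<gamma> (snd z) m) = T (fst z)" if "z \<in> set zs" for z
    proof (rule the_equality)
      show "has_type \<gamma> (snd z) (T (fst z))" using ty[of "fst z" "snd z"] that by simp
      then show "m = T (fst z)" if "has_type \<gamma> (snd z) m" for m using that unfolding has_type_def by simp
    qed
    ultimately show ?thesis unfolding path_word_def by simp
  qed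
  ultimately show ?thesis using base by blast
qed

lemma G43_tilde_eq: "G43_tilde = base_stab"
proof (intro subset_antisym G43_tilde_subset subsetI)
  fix x assume "x \<in> base_stab"
  then obtain "is" where x: "x = cl is" and cl: "act_word v0 is = v0" unfolding base_stab_def by blast
  let ?n = "length is"
  \<comment> \<open>Equally spaced times strictly between 0 and 1; the shifts by 1 keep both end
    times free of letters.\<close>
  define ts where "ts = map (\<lambda>k. (real k + 1) / (real ?n + 1)) [0..<?n]"
  have len: "length ts = ?n" by (simp add: ts_def)
  let ?zs = "zip is ts"
  have "\<exists>\<gamma>. good_stable \<gamma> \<and> \<gamma> 0 = base_config \<and> \<gamma> 1 = base_config \<and> path_word \<gamma> = map (\<lambda>z. T (fst z)) ?zs"
  proof (rule polynomial_path)
    have "sorted_wrt (<) ts"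
      unfolding ts_def sorted_wrt_map by (rule sorted_wrt_mono_rel[OF _ sorted_wrt_upt]) (simp add: divide_strict_right_mono)
    then show "sorted_wrt (<) (map snd ?zs)" by (simp add: len)
    show "act_word v0 (map fst ?zs) = v0" by (simp add: len cl)
    fix i t assume "(i, t) \<in> set ?zs"
    then have "t \<in> set ts" by (rule set_zip_rightD)
    then show "0 < t \<and> t < 1" by (auto simp: ts_def)
  qed
  then obtain \<gamma> where \<gamma>: "good_stable \<gamma>" "\<gamma> 0 = base_config" "\<gamma> 1 = base_config" "path_word \<gamma> = map (\<lambda>z. T (fst z)) ?zs"
    by (elim exE conjE)
  have m: "map (\<lambda>z. T (fst z)) ?zs = map T is"
    by (rule nth_equalityI) (simp_all add: len)
  have "x = G43_element (path_word \<gamma>)" unfolding x \<gamma>(4) m cl_G43_element ..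
  with \<gamma>(1-3) show "x \<in> G43_tilde" unfolding G43_tilde_def by (intro CollectI exI conjI)
qed

theorem theorem2:
  shows "subgroup G43_tilde G43
       \<and> card (rcosets\<^bsub>G43\<^esub> G43_tilde) = 4
       \<and> G43\<lparr>carrier := G43_tilde\<rparr> \<cong> fundamental_group config_space base_config"
  unfolding G43_tilde_eq by (intro conjI subgroup_base_stab card_rcosets_base_stab base_stab_iso)

end
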